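(* Let $N$ and $r$ be positive integers and $i \in \{0,1,\ldots,N-1\}$. Suppose that $K$ is a compact interval with non-empty interior contained in $$\Lambda = \Big\{ x \in \mathbb{R} : \lim_{j\to\infty} \operatorname{discr} X_{jN+i}(x) \text{ exists and is negative} \Big\}.$$ Assume that $$\lim_{j\to\infty} \frac{a_{(j+1)N+i-1}}{a_{jN+i-1}} = 1 \quad\text{and}\quad (X_{jN+i} : j\in\mathbb{N}) \in \mathcal{D}_r\big(K, \mathrm{GL}(2,\mathbb{R})\big).$$ Suppose that $\mathcal{X}$ is the limit of $(X_{jN+i} : j \in \mathbb{N})$ on $K$. If $$\sum_{j=1}^\infty \frac{1}{a_{jN+i-1}} = \infty,$$ then for $x\in K$ $$\bigg(\sum_{j=1}^n \frac{1}{a_{jN+i-1}}\bigg)^{-1} \sum_{j=0}^n p_{jN+i}^2(x) = \frac{|[\mathcal{X}(x)]_{2,1}|}{\pi \mu'(x)\sqrt{-\operatorname{discr}\mathcal{X}(x)}} + E_n(x), \qquad\text{where}\qquad \lim_{n\to\infty}\sup_{x\in K}|E_n(x)| = 0.$$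
   Context: $\mathbb{N}$ is the set of positive integers, $\mathbb{N}_0=\mathbb{N}\cup\{0\}$. $(a_n)_{n\ge 0}$ is a sequence of positive numbers and $(b_n)_{n\ge0}$ a sequence of real numbers. The polynomials $(p_n)_{n\ge 0}$ are defined by $p_0(x)=1$, $p_1(x)=(x-b_0)/a_0$, and $x p_n(x) = a_n p_{n+1}(x)+b_n p_n(x)+a_{n-1}p_{n-1}(x)$ for $n\ge1$. The Carleman condition $\sum_{n\ge0} 1/a_n=\infty$ (which follows from the divergence hypothesis) guarantees that there is a unique probability measure $\mu$ on $\mathbb{R}$ for which $(p_n)$ is orthonormal in $L^2(\mathbb{R},\mu)$. It is a known fact that, under the hypotheses of the claim, $\mu$ is purely absolutely continuous on $K$ with continuous positive density; $\mu'$ denotes this density. The $N$-step transfer matrix is $X_n(x)=B_{n+N-1}(x)B_{n+N-2}(x)\cdots B_n(x)$, where $B_j(x)=\begin{pmatrix}0&1\\ -\frac{a_{j-1}}{a_j}&\frac{x-b_j}{a_j}\end{pmatrix}$. For a $2\times2$ matrix $Y$: $[Y]_{k,l}$ is its $(k,l)$ entry and $\operatorname{discr}Y=(\operatorname{tr}Y)^2-4\det Y$. $\mathrm{GL}(2,\mathbb{R})$ is the set of invertible real $2\times2$ matrices equipped with the spectral norm. Stolz class: for a positive integer $r$ and a normed space $V$, a sequence $(x_n)$ in $V$ belongs to $\mathcal{D}_r(V)$ if it is bounded and for each $j\in\{1,\ldots,r\}$, $\sum_{n}\|\Delta^j x_n\|^{r/j}<\infty$, where $\Delta^0x_n=x_n$,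 $\Delta^jx_n=\Delta^{j-1}x_{n+1}-\Delta^{j-1}x_n$. $\mathcal{D}_r(K,\mathrm{GL}(2,\mathbb{R}))$ denotes sequences of continuous maps $K\to \mathrm{GL}(2,\mathbb{R})$ satisfying this with the supremum norm over $K$ (of the spectral norm). *)

theory Defs
  imports "HOL-Probability.Probability" "HOL-Computational_Algebra.Polynomial"
begin

text \<open>The orthonormal polynomials with Jacobi parameters a, b: the three-term recurrence
  is solved for the polynomial of highest degree.\<close>

fun orth_poly :: "(nat \<Rightarrow> real) \<Rightarrow> (nat \<Rightarrow> real) \<Rightarrow> nat \<Rightarrow> real poly" where
  "orth_poly a b 0 = 1"
| "orth_poly a b (Suc 0) = smult (1 / a 0) [:- b 0, 1:]"
| "orth_poly a b (Suc (Suc n)) =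
     smult (1 / a (Suc n))
       ([:- b (Suc n), 1:] * orth_poly a b (Suc n) - smult (a n) (orth_poly a b n))"

lemma orth_poly_recurrence:
  assumes "\<And>n. a n > 0" and "n \<ge> 1"
  shows "x * poly (orth_poly a b n) x =
    a n * poly (orth_poly a b (n + 1)) x + b n * poly (orth_poly a b n) x
    + a (n - 1) * poly (orth_poly a b (n - 1)) x"
proof -
  obtain m where n: "n = Suc m" using assms(2) by (cases n) auto
  have "a (Suc m) \<noteq> 0" using assms(1)[of "Suc m"] by simp
  then show ?thesis by (simp add: n field_simps)
qed

definition orthonormality_measure ::
    "(nat \<Rightarrow> real) \<Rightarrow> (nat \<Rightarrow> real) \<Rightarrow> real measure \<Rightarrow> bool" where
  "orthonormality_measure a b \<mu> \<longleftrightarrow>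
     prob_space \<mu> \<and> sets \<mu> = sets borel \<and>
     (\<forall>m n. has_bochner_integral \<mu>
        (\<lambda>x. poly (orth_poly a b m) x * poly (orth_poly a b n) x) (if m = n then 1 else 0))"

definition is_continuous_density_on ::
    "real measure \<Rightarrow> real set \<Rightarrow> (real \<Rightarrow> real) \<Rightarrow> bool" where
  "is_continuous_density_on \<mu> K w \<longleftrightarrow>
     continuous_on K w \<and> (\<forall>x\<in>K. 0 < w x) \<and>
     (\<forall>A\<in>sets borel. A \<subseteq> K \<longrightarrow> emeasure \<mu> A = (\<integral>\<^sup>+x\<in>A. ennreal (w x) \<partial>lborel))"

text \<open>On a compact interval with non-empty interior two continuous densities of the same measure
  agree at every point, so that the values on K do not depend on the choice. The values outside K
  are arbitrary.\<close>

definition continuous_density_on :: "real measure \<Rightarrow> real set \<Rightarrow> real \<Rightarrow> real" where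
  "continuous_density_on \<mu> K = (SOME w. is_continuous_density_on \<mu> K w)"

text \<open>The one-step matrix is meaningful for indices at least 1 only: at 0, truncated
  subtraction puts a 0 in place of the undefined term with index -1.\<close>

definition step_matrix ::
    "(nat \<Rightarrow> real) \<Rightarrow> (nat \<Rightarrow> real) \<Rightarrow> nat \<Rightarrow> real \<Rightarrow> real^2^2" where
  "step_matrix a b j x =
     vector [vector [0, 1], vector [- (a (j - 1) / a j), (x - b j) / a j]]"

primrec transfer_matrix ::
    "(nat \<Rightarrow> real) \<Rightarrow> (nat \<Rightarrow> real) \<Rightarrow> nat \<Rightarrow> nat \<Rightarrow> real \<Rightarrow> real^2^2" where
  "transfer_matrix a b 0 n x = mat 1"
| "transfer_matrix a b (Suc N) n x = step_matrix a b (n + N) x ** transfer_matrix a b N n x"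

definition discr :: "real^2^2 \<Rightarrow> real" where
  "discr Y = (trace Y)\<^sup>2 - 4 * det Y"

text \<open>The library norm on matrices is the Frobenius norm; the spectral norm is the operator norm
  with respect to the Euclidean norm.\<close>

definition spectral_norm :: "real^2^2 \<Rightarrow> real" where
  "spectral_norm Y = onorm (\<lambda>v. Y *v v)"

definition sup_spectral_norm :: "real set \<Rightarrow> (real \<Rightarrow> real^2^2) \<Rightarrow> real" where
  "sup_spectral_norm K F = (SUP x\<in>K. spectral_norm (F x))"

primrec fwd_diff :: "nat \<Rightarrow> (nat \<Rightarrow> 'v::minus) \<Rightarrow> nat \<Rightarrow> 'v" where
  "fwd_diff 0 x n = x n"
| "fwd_diff (Suc j) x n = fwd_diff j x (Suc n) - fwd_diff j x n"

text \<open>The norm is a parameter because the space of matrix-valued functions below carries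
  the supremum norm over K, which is not the norm of a type class instance.\<close>

definition stolz_class :: "('v::minus \<Rightarrow> real) \<Rightarrow> nat \<Rightarrow> (nat \<Rightarrow> 'v) set" where
  "stolz_class \<nu> r = {x. bdd_above (range (\<lambda>n. \<nu> (x n))) \<and>
     (\<forall>j\<in>{1..r}. summable (\<lambda>n. \<nu> (fwd_diff j x n) powr (real r / real j)))}"

definition stolz_GL2 :: "nat \<Rightarrow> real set \<Rightarrow> (nat \<Rightarrow> real \<Rightarrow> real^2^2) set" where
  "stolz_GL2 r K =
     {Y. (\<forall>n. continuous_on K (Y n) \<and> (\<forall>x\<in>K. invertible (Y n x))) \<and>
         Y \<in> stolz_class (sup_spectral_norm K) r}"

end

(* Along the subsequence j N + i the vectors of consecutive polynomials satisfy a linear recurrence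
   with matrices X_j. Newton corrections to the complex fixed point of X_j, one for each order of
   the Stolz class, produce z_j whose Riccati residual is summable; then
   phi_j = p_(jN+i) - z_j p_(jN+i-1) is multiplied at each step by a factor whose modulus is
   determined by det X_j up to a summable error, so that the amplitude
   a_(jN+i-1) |phi_j|^2 / |Im z_j| converges uniformly to a positive function g, while the phase
   of phi_j rotates and averages out. For a constant z in the upper half plane the Bernstein-Szego
   density Im z / (pi a |p_(jN+i) - z p_(jN+i-1)|^2) has the right moments, and by the Carleman
   condition these measures converge weakly to mu; freezing z at a point t of K identifies mu'(t)
   with 1 / (pi g(t)). *)

theory Submission
  imports Defs "HOL-Complex_Analysis.Complex_Analysis" "HOL-Real_Asymp.Real_Asymp"
begin

no_notation fps_nth (infixl "$" 75)

section \<open>Sequences graded by a slowly varying weight\<close>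

text \<open>The exponents r/j of the Stolz class behave badly under products. They disappear once
  one slowly varying weight \<open>v\<close> with summable \<open>v n ^ r\<close> dominates every
  k-th difference by \<open>v n ^ k\<close>: orders then add under products and a difference gains
  one order. The fixed point of the matrix itself leaves a residual of order 1, so r - 1 corrections
  reach the summable order r. That p is real is used throughout: Im phi controls p_(jN+i-1), and
  p_(jN+i)^2 splits into half of an amplitude term and half of a rotating term. At the limit z of
  the z_j, |z|^2 / |Im z| equals 2 |[X]_(2,1)| / sqrt (-discr X), which explains the constant. The
  limit of the transfer matrices is only pointwise by assumption; bounded polynomial degree makes it
  uniform. The density is a choice among functions not yet known to exist, so existence is proved as
  well, by differentiating the distribution function of \<mu>. A difference quotient moves the point
  while the index grows, hence the limits jointly in both, and hence also the proof that K carries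
  no atoms.\<close>

definition weight_bounded :: "(nat \<Rightarrow> real) \<Rightarrow> real set \<Rightarrow> nat \<Rightarrow> (nat \<Rightarrow> real \<Rightarrow> 'a::real_normed_vector) \<Rightarrow> bool" where
  "weight_bounded v K s x \<longleftrightarrow> (\<exists>C. \<forall>\<^sub>F n in sequentially. \<forall>t\<in>K. norm (x n t) \<le> C * v n ^ s)"

text \<open>The k-th forward difference is O(v ^ (s + k)) uniformly on K for k up to d. With s + d = r and v
  r-summable this encodes the Stolz class without fractional exponents, and products need only the
  Leibniz rule instead of Hoelder's inequality.\<close>

primrec weight_class :: "(nat \<Rightarrow> real) \<Rightarrow> real set \<Rightarrow> nat \<Rightarrow> nat \<Rightarrow> (nat \<Rightarrow> real \<Rightarrow> 'a::real_normed_vector) \<Rightarrow> bool" where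
  "weight_class v K s 0 x \<longleftrightarrow> weight_bounded v K s x"
| "weight_class v K s (Suc d) x \<longleftrightarrow> weight_bounded v K s x \<and> weight_class v K (Suc s) d (\<lambda>n t. x (Suc n) t - x n t)"

lemma weight_bounded_cong:
  assumes "\<forall>\<^sub>F n in sequentially. \<forall>t\<in>K. x n t = y n t" "weight_bounded v K s x"
  shows "weight_bounded v K s y"
proof -
  obtain C where "\<forall>\<^sub>F n in sequentially. \<forall>t\<in>K. norm (x n t) \<le> C * v n ^ s"
    using assms(2) unfolding weight_bounded_def by blast
  with assms(1) have "\<forall>\<^sub>F n in sequentially. \<forall>t\<in>K. norm (y n t) \<le> C * v n ^ s"
    by eventually_elim auto
  then show ?thesis unfolding weight_bounded_def by blast
qed

lemma eventually_sequentially_shift: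
  "\<forall>\<^sub>F n in sequentially. P n \<Longrightarrow> \<forall>\<^sub>F n in sequentially. P (Suc n)"
  using eventually_sequentially_Suc by blast

lemma weight_class_cong:
  assumes "\<forall>\<^sub>F n in sequentially. \<forall>t\<in>K. x n t = y n t" "weight_class v K s d x"
  shows "weight_class v K s d y"
  using assms
proof (induction d arbitrary: s x y)
  case 0
  then show ?case using weight_bounded_cong by fastforce
next
  case (Suc d)
  have "\<forall>\<^sub>F n in sequentially. \<forall>t\<in>K. x (Suc n) t - x n t = y (Suc n) t - y n t"
    using Suc.prems(1) eventually_sequentially_shift[OF Suc.prems(1)] by eventually_elim auto
  from Suc.IH[OF this] Suc.prems weight_bounded_cong[OF Suc.prems(1)] show ?case by auto
qed

lemma weight_class_imp_bounded: "weight_class v K s d x \<Longrightarrow> weight_bounded v K s x"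
  by (cases d) auto

lemma weight_class_pred: "weight_class v K s (Suc d) x \<Longrightarrow> weight_class v K s d x"
proof (induction d arbitrary: s x)
  case 0
  then show ?case by simp
next
  case (Suc d)
  have "weight_bounded v K s x" "weight_class v K (Suc s) (Suc d) (\<lambda>n t. x (Suc n) t - x n t)"
    using Suc.prems by (simp_all only: weight_class.simps(2))
  with Suc.IH[of "Suc s"] show ?case by (simp only: weight_class.simps(2))
qed

text \<open>The factor 2 keeps the order under the shift from n to n + 1, which the Leibniz rule and
  the quotient rules produce; convergence to 0 lets a higher order imply a lower one.\<close>

locale slow_weight =
  fixes v :: "nat \<Rightarrow> real" and K :: "real set"
  assumes v_nonneg: "\<And>n. 0 \<le> v n" and v_Suc: "\<And>n. v (Suc n) \<le> 2 * v n"
    and v_lim: "v \<longlonglongrightarrow> 0"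
begin

lemma weight_boundedI:
  assumes "\<forall>\<^sub>F n in sequentially. \<forall>t\<in>K. norm (x n t) \<le> C * v n ^ s"
  shows "weight_bounded v K s x"
  using assms unfolding weight_bounded_def by blast

lemma weight_boundedE:
  assumes "weight_bounded v K s x"
  obtains C where "C \<ge> 0" "\<forall>\<^sub>F n in sequentially. \<forall>t\<in>K. norm (x n t) \<le> C * v n ^ s"
proof -
  obtain C where C: "\<forall>\<^sub>F n in sequentially. \<forall>t\<in>K. norm (x n t) \<le> C * v n ^ s"
    using assms unfolding weight_bounded_def by blast
  have le: "C * v n ^ s \<le> \<bar>C\<bar> * v n ^ s" for n
    by (intro mult_right_mono) (auto simp: v_nonneg)
  have "\<forall>\<^sub>F n in sequentially. \<forall>t\<in>K. norm (x n t) \<le> \<bar>C\<bar> * v n ^ s"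
    using C by eventually_elim (use le order_trans in blast)
  then show ?thesis using that[of "\<bar>C\<bar>"] by auto
qed

lemma weight_bounded_add:
  assumes "weight_bounded v K s x" "weight_bounded v K s y"
  shows "weight_bounded v K s (\<lambda>n t. x n t + y n t)"
proof -
  obtain C where C: "\<forall>\<^sub>F n in sequentially. \<forall>t\<in>K. norm (x n t) \<le> C * v n ^ s"
    using assms(1) unfolding weight_bounded_def by blast
  obtain D where D: "\<forall>\<^sub>F n in sequentially. \<forall>t\<in>K. norm (y n t) \<le> D * v n ^ s"
    using assms(2) unfolding weight_bounded_def by blast
  have "\<forall>\<^sub>F n in sequentially. \<forall>t\<in>K. norm (x n t + y n t) \<le> (C + D) * v n ^ s"
    using C D
  proof eventually_elim
    case (elim n)
    show ?case
    proof
      fix t assume "t \<in> K"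
      then have "norm (x n t) \<le> C * v n ^ s" "norm (y n t) \<le> D * v n ^ s" using elim by auto
      then show "norm (x n t + y n t) \<le> (C + D) * v n ^ s"
        using norm_triangle_ineq[of "x n t" "y n t"] by (simp add: algebra_simps)
    qed
  qed
  then show ?thesis by (rule weight_boundedI)
qed

lemma weight_bounded_minus: "weight_bounded v K s x \<Longrightarrow> weight_bounded v K s (\<lambda>n t. - x n t)"
  unfolding weight_bounded_def by simp

lemma weight_bounded_mult:
  fixes x y :: "nat \<Rightarrow> real \<Rightarrow> 'a::real_normed_algebra"
  assumes "weight_bounded v K s x" "weight_bounded v K u y"
  shows "weight_bounded v K (s + u) (\<lambda>n t. x n t * y n t)"
proof -
  obtain C where C0: "C \<ge> 0" and C: "\<forall>\<^sub>F n in sequentially. \<forall>t\<in>K. norm (x n t) \<le> C * v n ^ s"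
    using weight_boundedE[OF assms(1)] .
  obtain D where D0: "D \<ge> 0" and D: "\<forall>\<^sub>F n in sequentially. \<forall>t\<in>K. norm (y n t) \<le> D * v n ^ u"
    using weight_boundedE[OF assms(2)] .
  have "\<forall>\<^sub>F n in sequentially. \<forall>t\<in>K. norm (x n t * y n t) \<le> (C * D) * v n ^ (s + u)"
    using C D
  proof eventually_elim
    case (elim n)
    show ?case
    proof
      fix t assume "t \<in> K"
      then have "norm (x n t) \<le> C * v n ^ s" "norm (y n t) \<le> D * v n ^ u" using elim by auto
      then have "norm (x n t) * norm (y n t) \<le> (C * v n ^ s) * (D * v n ^ u)"
        by (intro mult_mono) (auto simp: C0 v_nonneg)
      then show "norm (x n t * y n t) \<le> (C * D) * v n ^ (s + u)"
        using norm_mult_ineq[of "x n t" "y n t"] by (simp add: power_add algebra_simps)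
    qed
  qed
  then show ?thesis by (rule weight_boundedI)
qed

lemma weight_bounded_shift:
  assumes "weight_bounded v K s x"
  shows "weight_bounded v K s (\<lambda>n. x (Suc n))"
proof -
  obtain C where C0: "C \<ge> 0" and C: "\<forall>\<^sub>F n in sequentially. \<forall>t\<in>K. norm (x n t) \<le> C * v n ^ s"
    using weight_boundedE[OF assms(1)] .
  have le: "C * v (Suc n) ^ s \<le> (C * 2 ^ s) * v n ^ s" for n
  proof -
    have "v (Suc n) ^ s \<le> (2 * v n) ^ s" by (intro power_mono v_Suc v_nonneg)
    then show ?thesis using C0 by (simp add: power_mult_distrib mult_left_mono mult.assoc)
  qed
  have "\<forall>\<^sub>F n in sequentially. \<forall>t\<in>K. norm (x (Suc n) t) \<le> (C * 2 ^ s) * v n ^ s"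
    using eventually_sequentially_shift[OF C] by eventually_elim (use le order_trans in blast)
  then show ?thesis by (rule weight_boundedI)
qed

lemma weight_bounded_Suc:
  assumes "weight_bounded v K (Suc s) x"
  shows "weight_bounded v K s x"
proof -
  obtain C where C0: "C \<ge> 0" and C: "\<forall>\<^sub>F n in sequentially. \<forall>t\<in>K. norm (x n t) \<le> C * v n ^ Suc s"
    using weight_boundedE[OF assms(1)] .
  have "\<forall>\<^sub>F n in sequentially. v n < 1" using v_lim by (rule order_tendstoD) simp
  with C have "\<forall>\<^sub>F n in sequentially. \<forall>t\<in>K. norm (x n t) \<le> C * v n ^ s"
  proof eventually_elim
    case (elim n)
    have "v n ^ Suc s \<le> v n ^ s" using v_nonneg[of n] elim
      by (intro power_decreasing) auto
    then have "C * v n ^ Suc s \<le> C * v n ^ s" using C0 by (rule mult_left_mono)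
    then show ?case using elim by (meson order_trans)
  qed
  then show ?thesis by (rule weight_boundedI)
qed

lemma weight_class_add: "weight_class v K s d x \<Longrightarrow> weight_class v K s d y \<Longrightarrow> weight_class v K s d (\<lambda>n t. x n t + y n t)"
proof (induction d arbitrary: s x y)
  case 0 then show ?case by (simp add: weight_bounded_add)
next
  case (Suc d)
  have "weight_class v K (Suc s) d (\<lambda>n t. (x (Suc n) t - x n t) + (y (Suc n) t - y n t))"
    using Suc.prems by (intro Suc.IH) auto
  then show ?case using Suc.prems by (simp add: weight_bounded_add algebra_simps)
qed

lemma weight_class_minus: "weight_class v K s d x \<Longrightarrow> weight_class v K s d (\<lambda>n t. - x n t)"
proof (induction d arbitrary: s x)
  case 0 then show ?case by (simp add: weight_bounded_minus)
next
  case (Suc d)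
  have "weight_class v K (Suc s) d (\<lambda>n t. - (x (Suc n) t - x n t))"
    using Suc.prems by (intro Suc.IH) auto
  then show ?case using Suc.prems by (simp add: weight_bounded_minus)
qed

lemma weight_class_diff: "weight_class v K s d x \<Longrightarrow> weight_class v K s d y \<Longrightarrow> weight_class v K s d (\<lambda>n t. x n t - y n t)"
  using weight_class_add[of s d x "\<lambda>n t. - y n t"] weight_class_minus[of s d y] by simp

lemma weight_class_shift: "weight_class v K s d x \<Longrightarrow> weight_class v K s d (\<lambda>n. x (Suc n))"
proof (induction d arbitrary: s x)
  case 0 then show ?case by (simp add: weight_bounded_shift)
next
  case (Suc d)
  have "weight_class v K (Suc s) d (\<lambda>n t. x (Suc (Suc n)) t - x (Suc n) t)"
    using Suc.prems Suc.IH[of "Suc s" "\<lambda>n t. x (Suc n) t - x n t"] by simp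
  then show ?case using Suc.prems by (simp add: weight_bounded_shift)
qed

lemma weight_class_diff_Suc: "weight_class v K s (Suc d) x \<Longrightarrow> weight_class v K (Suc s) d (\<lambda>n t. x (Suc n) t - x n t)"
  by simp

text \<open>An order can be exchanged for a difference: both terms of
  \<open>x (Suc n) t - x n t\<close> already have the higher order, so one more difference costs
  nothing.\<close>

lemma weight_class_Suc: "weight_class v K (Suc s) d x \<Longrightarrow> weight_class v K s (Suc d) x"
  using weight_class_diff[OF weight_class_shift, of "Suc s" d x x] weight_bounded_Suc[OF weight_class_imp_bounded] by simp

text \<open>Leibniz rule in the form \<Delta>(xy) = \<Delta>x y' + x \<Delta>y, the prime denoting
  the shifted sequence. Each summand puts the gained order on one factor, so \<open>s\<close> and
  \<open>u\<close> vary in the induction.\<close>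

lemma weight_class_mult:
  fixes x y :: "nat \<Rightarrow> real \<Rightarrow> 'a::real_normed_algebra"
  shows "weight_class v K s d x \<Longrightarrow> weight_class v K u d y \<Longrightarrow> weight_class v K (s + u) d (\<lambda>n t. x n t * y n t)"
proof (induction d arbitrary: s u x y)
  case 0 then show ?case by (simp add: weight_bounded_mult)
next
  case (Suc d)
  have "weight_class v K (Suc s + u) d (\<lambda>n t. (x (Suc n) t - x n t) * y (Suc n) t)"
    using Suc.prems weight_class_pred[OF Suc.prems(2)] by (intro Suc.IH weight_class_shift) auto
  moreover have "weight_class v K (s + Suc u) d (\<lambda>n t. x n t * (y (Suc n) t - y n t))"
    using Suc.prems weight_class_pred[OF Suc.prems(1)] by (intro Suc.IH) auto
  ultimately have "weight_class v K (Suc (s + u)) d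
      (\<lambda>n t. (x (Suc n) t - x n t) * y (Suc n) t + x n t * (y (Suc n) t - y n t))"
    using weight_class_add by fastforce
  then show ?case using Suc.prems by (simp add: weight_bounded_mult algebra_simps)
qed

lemma weight_class_mult0:
  fixes x y :: "nat \<Rightarrow> real \<Rightarrow> 'a::real_normed_algebra"
  shows "weight_class v K s d x \<Longrightarrow> weight_class v K 0 d y \<Longrightarrow> weight_class v K s d (\<lambda>n t. x n t * y n t)"
  using weight_class_mult[of s d x 0 y] by simp

lemma weight_bounded_zero: "weight_bounded v K s (\<lambda>n t. 0)"
  by (rule weight_boundedI[where C = 0]) simp

lemma weight_class_zero: "weight_class v K s d (\<lambda>n t. 0)"
  by (induction d arbitrary: s) (simp_all add: weight_bounded_zero)

lemma weight_class_const: "weight_class v K 0 d (\<lambda>n t. c)"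
proof -
  have "weight_bounded v K 0 (\<lambda>n t. c)" by (rule weight_boundedI[where C = "norm c"]) simp
  then show ?thesis by (cases d) (auto simp: weight_class_zero)
qed

text \<open>The difference of 1/x is -\<Delta>x / (x x'). It carries the factor \<Delta>x of order 1
  and needs 1/x with one difference less only, which the induction supplies.\<close>

lemma weight_class_inverse:
  fixes x :: "nat \<Rightarrow> real \<Rightarrow> 'a::real_normed_field"
  assumes "weight_class v K 0 d x" "c > 0" "\<forall>\<^sub>F n in sequentially. \<forall>t\<in>K. c \<le> norm (x n t)"
  shows "weight_class v K 0 d (\<lambda>n t. inverse (x n t))"
  using assms(1)
proof (induction d)
  case 0
  have "\<forall>\<^sub>F n in sequentially. \<forall>t\<in>K. norm (inverse (x n t)) \<le> inverse c * v n ^ 0"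
    using assms(3) by eventually_elim (use assms(2) in \<open>auto simp: norm_inverse intro!: le_imp_inverse_le\<close>)
  then show ?case by (simp add: weight_boundedI)
next
  case (Suc d)
  have IH: "weight_class v K 0 d (\<lambda>n t. inverse (x n t))" using Suc weight_class_pred by blast
  have "weight_class v K (Suc 0) d (\<lambda>n t. - (x (Suc n) t - x n t) * inverse (x n t) * inverse (x (Suc n) t))"
    using Suc.prems by (intro weight_class_mult0 weight_class_minus IH weight_class_shift[OF IH]) auto
  moreover have "\<forall>\<^sub>F n in sequentially. \<forall>t\<in>K.
     - (x (Suc n) t - x n t) * inverse (x n t) * inverse (x (Suc n) t)
      = inverse (x (Suc n) t) - inverse (x n t)"
    using assms(3) eventually_sequentially_shift[OF assms(3)]
  proof eventually_elim
    case (elim n)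
    show ?case
    proof
      fix t assume "t \<in> K"
      then have "x n t \<noteq> 0" "x (Suc n) t \<noteq> 0" using elim assms(2) by fastforce+
      then show "- (x (Suc n) t - x n t) * inverse (x n t) * inverse (x (Suc n) t)
        = inverse (x (Suc n) t) - inverse (x n t)" by (simp add: field_simps)
    qed
  qed
  ultimately have "weight_class v K (Suc 0) d (\<lambda>n t. inverse (x (Suc n) t) - inverse (x n t))"
    by (rule weight_class_cong[rotated])
  then show ?case using weight_class_imp_bounded[OF IH] by simp
qed

lemma weight_class_divide:
  fixes x y :: "nat \<Rightarrow> real \<Rightarrow> 'a::real_normed_field"
  assumes "weight_class v K s d x" "weight_class v K 0 d y" "c > 0" "\<forall>\<^sub>F n in sequentially. \<forall>t\<in>K. c \<le> norm (y n t)"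
  shows "weight_class v K s d (\<lambda>n t. x n t / y n t)"
  unfolding divide_inverse by (rule weight_class_mult0[OF assms(1) weight_class_inverse[OF assms(2-4)]])

text \<open>Rationalising turns the difference into \<Delta>x / (sqrt x + sqrt x') with a
  denominator away from 0; the induction then runs as for the inverse.\<close>

lemma weight_class_sqrt:
  assumes "weight_class v K 0 d x" "c > 0" "\<forall>\<^sub>F n in sequentially. \<forall>t\<in>K. c \<le> x n t"
  shows "weight_class v K 0 d (\<lambda>n t. sqrt (x n t))"
  using assms(1)
proof (induction d)
  case 0
  then obtain C where C: "\<forall>\<^sub>F n in sequentially. \<forall>t\<in>K. norm (x n t) \<le> C"
    unfolding weight_bounded_def weight_class.simps by auto
  have "\<forall>\<^sub>F n in sequentially. \<forall>t\<in>K. norm (sqrt (x n t)) \<le> sqrt C * v n ^ 0"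
    using assms(3) C
  proof eventually_elim
    case (elim n)
    show ?case
    proof
      fix t assume "t \<in> K"
      then have "c \<le> x n t" "x n t \<le> C" using elim by fastforce+
      then have "0 \<le> sqrt (x n t)" "sqrt (x n t) \<le> sqrt C" using assms(2) by simp_all
      then show "norm (sqrt (x n t)) \<le> sqrt C * v n ^ 0" by simp
    qed
  qed
  then show ?case by (simp add: weight_boundedI)
next
  case (Suc d)
  have IH: "weight_class v K 0 d (\<lambda>n t. sqrt (x n t))" using Suc weight_class_pred by blast
  have "weight_class v K (Suc 0) d (\<lambda>n t. (x (Suc n) t - x n t) / (sqrt (x n t) + sqrt (x (Suc n) t)))"
  proof (rule weight_class_divide[where c = "sqrt c"])
    show "weight_class v K (Suc 0) d (\<lambda>n t. x (Suc n) t - x n t)" using Suc.prems by simp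
    show "weight_class v K 0 d (\<lambda>n t. sqrt (x n t) + sqrt (x (Suc n) t))" by (intro weight_class_add IH weight_class_shift[OF IH])
    show "sqrt c > 0" using assms(2) by simp
    show "\<forall>\<^sub>F n in sequentially. \<forall>t\<in>K. sqrt c \<le> norm (sqrt (x n t) + sqrt (x (Suc n) t))"
      using assms(3) eventually_sequentially_shift[OF assms(3)]
    proof eventually_elim
      case (elim n)
      show ?case
      proof
        fix t assume "t \<in> K"
        then have "c \<le> x n t" "0 \<le> x (Suc n) t" using elim assms(2) by force+
        then have "sqrt c \<le> sqrt (x n t)" "0 \<le> sqrt (x (Suc n) t)" by simp_all
        then show "sqrt c \<le> norm (sqrt (x n t) + sqrt (x (Suc n) t))"
          unfolding real_norm_def by linarith
      qed
    qed
  qed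
  moreover have "\<forall>\<^sub>F n in sequentially. \<forall>t\<in>K.
      (x (Suc n) t - x n t) / (sqrt (x n t) + sqrt (x (Suc n) t)) = sqrt (x (Suc n) t) - sqrt (x n t)"
    using assms(3) eventually_sequentially_shift[OF assms(3)]
  proof eventually_elim
    case (elim n)
    show ?case
    proof
      fix t assume t: "t \<in> K"
      have p: "x n t > 0" "x (Suc n) t > 0" using elim t assms(2) by force+
      then have s: "sqrt (x n t) + sqrt (x (Suc n) t) > 0" by (intro add_pos_pos) auto
      have "(sqrt (x (Suc n) t) - sqrt (x n t)) * (sqrt (x n t) + sqrt (x (Suc n) t)) = x (Suc n) t - x n t"
        using p by (simp add: algebra_simps flip: power2_eq_square)
      then show "(x (Suc n) t - x n t) / (sqrt (x n t) + sqrt (x (Suc n) t)) = sqrt (x (Suc n) t) - sqrt (x n t)"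
        using s by (metis less_numeral_extra(3) nonzero_eq_divide_eq)
    qed
  qed
  ultimately have "weight_class v K (Suc 0) d (\<lambda>n t. sqrt (x (Suc n) t) - sqrt (x n t))"
    by (rule weight_class_cong[rotated])
  then show ?case using weight_class_imp_bounded[OF IH] by simp
qed

lemma weight_bounded_of_real: "weight_bounded v K s x \<Longrightarrow> weight_bounded v K s (\<lambda>n t. of_real (x n t) :: complex)"
  unfolding weight_bounded_def by simp

lemma weight_class_of_real: "weight_class v K s d x \<Longrightarrow> weight_class v K s d (\<lambda>n t. of_real (x n t) :: complex)"
proof (induction d arbitrary: s x)
  case 0 then show ?case by (simp add: weight_bounded_of_real)
next
  case (Suc d)
  have "weight_class v K (Suc s) d (\<lambda>n t. of_real (x (Suc n) t - x n t) :: complex)"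
    using Suc.prems by (intro Suc.IH) auto
  then show ?case using Suc.prems by (simp add: weight_bounded_of_real)
qed

lemma weight_bounded_uniform_limit:
  assumes "weight_bounded v K (Suc s) x"
  shows "uniform_limit K x (\<lambda>t. 0) sequentially"
proof (rule uniform_limitI)
  fix e :: real assume e: "e > 0"
  obtain C where C0: "C \<ge> 0" and C: "\<forall>\<^sub>F n in sequentially. \<forall>t\<in>K. norm (x n t) \<le> C * v n ^ Suc s"
    using weight_boundedE[OF assms] .
  have "(\<lambda>n. C * v n ^ Suc s) \<longlonglongrightarrow> C * 0 ^ Suc s" by (intro tendsto_intros v_lim)
  then have "\<forall>\<^sub>F n in sequentially. C * v n ^ Suc s < e" using e by (intro order_tendstoD) auto
  with C show "\<forall>\<^sub>F n in sequentially. \<forall>t\<in>K. dist (x n t) 0 < e"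
    by eventually_elim auto
qed

end

section \<open>Approximate solutions of the Riccati recurrence\<close>

context slow_weight
begin

text \<open>Orders are traded for differences one at a time until \<open>s'\<close> is reached, and
  surplus differences are dropped. The sum of order and number of differences is the quantity that
  must not grow.\<close>

lemma weight_class_mono:
  assumes "weight_class v K s d x" "s' \<le> s" "s' + d' \<le> s + d"
  shows "weight_class v K s' d' x"
proof -
  have 1: "weight_class v K (s - k) (d + k) x" if "k \<le> s" for k
    using that
  proof (induction k)
    case 0 then show ?case using assms(1) by simp
  next
    case (Suc k)
    then have "weight_class v K (Suc (s - Suc k)) (d + k) x" by (simp add: Suc_diff_Suc)
    from weight_class_Suc[OF this] show ?case by simp
  qed
  have 2: "weight_class v K s' (e - k) x" if "weight_class v K s' e x" "k \<le> e" for e k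
    using that
  proof (induction k)
    case (Suc k)
    then have "weight_class v K s' (Suc (e - Suc k)) x" by (simp add: Suc_diff_Suc)
    from weight_class_pred[OF this] show ?case .
  qed simp
  have "weight_class v K s' (d + (s - s')) x" using 1[of "s - s'"] assms(2) by simp
  from 2[OF this, of "d + (s - s') - d'"] show ?thesis using assms by (simp add: algebra_simps)
qed

lemma eventually_bounded_below_limit:
  fixes x y :: "nat \<Rightarrow> real \<Rightarrow> 'a::real_normed_vector"
  assumes "uniform_limit K (\<lambda>n t. x n t - y n t) (\<lambda>t. 0) sequentially"
    and "c > 0" "\<forall>\<^sub>F n in sequentially. \<forall>t\<in>K. c \<le> norm (y n t)"
  shows "\<forall>\<^sub>F n in sequentially. \<forall>t\<in>K. c / 2 \<le> norm (x n t)"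
proof -
  have "\<forall>\<^sub>F n in sequentially. \<forall>t\<in>K. dist (x n t - y n t) 0 < c / 2"
    using assms(1,2) by (intro uniform_limitD) auto
  with assms(3) show ?thesis
  proof eventually_elim
    case (elim n)
    show ?case
    proof
      fix t assume "t \<in> K"
      then have "norm (x n t - y n t) < c / 2" "c \<le> norm (y n t)" using elim by auto
      then show "c / 2 \<le> norm (x n t)"
        using norm_triangle_ineq4[of "x n t" "x n t - y n t"] by simp
    qed
  qed
qed

end

text \<open>\<open>D_ge\<close> says that the matrices are elliptic, with eigenvalues uniformly away
  from the real line; \<open>x12_ge\<close> keeps the fixed point equation a genuine
  quadratic.\<close>

locale elliptic_sequence = slow_weight +
  fixes r :: nat and x11 x12 x21 x22 :: "nat \<Rightarrow> real \<Rightarrow> real" and c :: real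
  assumes r_pos: "r \<ge> 1" and c_pos: "c > 0"
    and W11: "weight_class v K 0 r x11" and W12: "weight_class v K 0 r x12" and W21: "weight_class v K 0 r x21" and W22: "weight_class v K 0 r x22"
    and cont: "\<And>n. continuous_on K (x11 n)" "\<And>n. continuous_on K (x12 n)"
      "\<And>n. continuous_on K (x21 n)" "\<And>n. continuous_on K (x22 n)"
    and x12_ge: "\<forall>\<^sub>F n in sequentially. \<forall>t\<in>K. c \<le> \<bar>x12 n t\<bar>"
    and D_ge: "\<forall>\<^sub>F n in sequentially. \<forall>t\<in>K. c \<le> - ((x22 n t - x11 n t)\<^sup>2 + 4 * x12 n t * x21 n t)"
begin

definition D :: "nat \<Rightarrow> real \<Rightarrow> real" where
  "D n t = - ((x22 n t - x11 n t)\<^sup>2 + 4 * x12 n t * x21 n t)"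

text \<open>A non-real fixed point of the Moebius map w -> (\<open>x21\<close> + \<open>x22\<close>
  w) / (\<open>x11\<close> + \<open>x12\<close> w), by which the matrix acts on the quotient p / q
  of consecutive polynomials. The sign of the root is fixed, so Im \<open>z0\<close> has the sign of
  \<open>x12\<close>.\<close>

definition z0 :: "nat \<Rightarrow> real \<Rightarrow> complex" where
  "z0 n t = (of_real (x22 n t - x11 n t) + \<i> * of_real (sqrt (D n t))) / of_real (2 * x12 n t)"

text \<open>The equation z' = (\<open>x21\<close> + \<open>x22\<close> z) / (\<open>x11\<close> +
  \<open>x12\<close> z) with cleared denominator, z' being the value at the next index. For an exact
  solution p - z q is carried to a multiple of itself.\<close>

definition residual :: "(nat \<Rightarrow> real \<Rightarrow> complex) \<Rightarrow> nat \<Rightarrow> real \<Rightarrow> complex" where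
  "residual z n t = z n t * (x22 n t - z (Suc n) t * complex_of_real (x12 n t)) - z (Suc n) t * complex_of_real (x11 n t) + complex_of_real (x21 n t)"

lemma weight_class_D: "weight_class v K 0 r D"
proof -
  have "weight_class v K 0 r (\<lambda>n t. - ((x22 n t - x11 n t) * (x22 n t - x11 n t) + 4 * x12 n t * x21 n t))"
    by (intro weight_class_minus weight_class_add weight_class_mult0 weight_class_diff W11 W12 W21 W22 weight_class_const)
  then show ?thesis by (simp add: D_def[abs_def] power2_eq_square)
qed

lemma weight_class_z0: "weight_class v K 0 r z0"
  unfolding z0_def[abs_def]
proof (rule weight_class_divide[where c = "2 * c"])
  show "weight_class v K 0 r (\<lambda>n t. complex_of_real (x22 n t - x11 n t) + \<i> * complex_of_real (sqrt (D n t)))"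
    by (intro weight_class_add weight_class_mult0[where x = "\<lambda>n t. \<i>"] weight_class_const weight_class_of_real weight_class_diff W11 W22 weight_class_sqrt[OF weight_class_D c_pos])
       (use D_ge in \<open>simp add: D_def\<close>)
  show "weight_class v K 0 r (\<lambda>n t. complex_of_real (2 * x12 n t))"
    by (intro weight_class_of_real weight_class_mult0[where x = "\<lambda>n t. 2"] weight_class_const W12)
  show "2 * c > 0" using c_pos by simp
  show "\<forall>\<^sub>F n in sequentially. \<forall>t\<in>K. 2 * c \<le> norm (complex_of_real (2 * x12 n t))"
    using x12_ge by eventually_elim (simp add: norm_mult abs_mult)
qed

text \<open>The second identity is the derivative of the fixed point equation at its root; its
  modulus, the root of \<open>D\<close>, is what a Newton step divides by.\<close>

lemma z0_root:
  assumes "c \<le> \<bar>x12 n t\<bar>" "c \<le> D n t"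
  shows "z0 n t * x22 n t - z0 n t * z0 n t * x12 n t - z0 n t * complex_of_real (x11 n t) + complex_of_real (x21 n t) = 0"
    and "complex_of_real (x22 n t) - x11 n t - 2 * z0 n t * complex_of_real (x12 n t) = - \<i> * sqrt (D n t)"
proof -
  have nz: "complex_of_real (x12 n t) \<noteq> 0" using assms c_pos by auto
  have D0: "D n t \<ge> 0" using assms c_pos by simp
  let ?w = "complex_of_real (x22 n t - x11 n t) + \<i> * complex_of_real (sqrt (D n t))"
  have w: "2 * z0 n t * complex_of_real (x12 n t) = ?w" using nz by (simp add: z0_def)
  then show "complex_of_real (x22 n t) - x11 n t - 2 * z0 n t * complex_of_real (x12 n t) = - \<i> * sqrt (D n t)"
    by simp
  have sq: "complex_of_real (sqrt (D n t)) * complex_of_real (sqrt (D n t)) = D n t"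
    using D0 by (simp flip: of_real_mult)
  have "4 * complex_of_real (x12 n t) * (z0 n t * x22 n t - z0 n t * z0 n t * x12 n t - z0 n t * complex_of_real (x11 n t) + complex_of_real (x21 n t))
    = 2 * ?w * (x22 n t - x11 n t) - ?w * ?w + 4 * complex_of_real (x12 n t) * complex_of_real (x21 n t)"
    unfolding w[symmetric] by (simp add: algebra_simps)
  also have "\<dots> = complex_of_real (x22 n t - x11 n t) * (x22 n t - x11 n t)
       + complex_of_real (sqrt (D n t)) * complex_of_real (sqrt (D n t)) + 4 * x12 n t * x21 n t"
    by (simp add: algebra_simps)
  also have "\<dots> = 0" unfolding sq by (simp add: D_def power2_eq_square algebra_simps)
  finally show "z0 n t * x22 n t - z0 n t * z0 n t * x12 n t - z0 n t * complex_of_real (x11 n t) + complex_of_real (x21 n t) = 0"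
    using nz by simp
qed

text \<open>With both indices frozen \<open>z0\<close> is an exact root, so what remains is a
  multiple of the change of \<open>z0\<close> to the next index, which has order 1.\<close>

lemma residual_z0: "weight_class v K 1 (r - 1) (residual z0)"
proof -
  have "weight_class v K 1 (r - 1) (\<lambda>n t. - (z0 (Suc n) t - z0 n t) * (z0 n t * complex_of_real (x12 n t) + complex_of_real (x11 n t)))"
  proof (intro weight_class_mult0 weight_class_minus)
    show "weight_class v K 1 (r - 1) (\<lambda>n t. z0 (Suc n) t - z0 n t)"
      using weight_class_diff_Suc[of 0 "r - 1" z0] weight_class_z0 r_pos by simp
    show "weight_class v K 0 (r - 1) (\<lambda>n t. z0 n t * complex_of_real (x12 n t) + complex_of_real (x11 n t))"
      by (rule weight_class_mono[where s = 0 and d = r])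
         (intro weight_class_add weight_class_mult0 weight_class_of_real weight_class_z0 W12 W11 | simp)+
  qed
  moreover have "\<forall>\<^sub>F n in sequentially. \<forall>t\<in>K.
    - (z0 (Suc n) t - z0 n t) * (z0 n t * complex_of_real (x12 n t) + complex_of_real (x11 n t)) = residual z0 n t"
    using x12_ge D_ge
  proof eventually_elim
    case (elim n)
    show ?case
    proof
      fix t assume "t \<in> K"
      then have "c \<le> \<bar>x12 n t\<bar>" "c \<le> D n t" using elim by (auto simp: D_def)
      from z0_root(1)[OF this] show "- (z0 (Suc n) t - z0 n t) * (z0 n t * complex_of_real (x12 n t) + complex_of_real (x11 n t)) = residual z0 n t"
        unfolding residual_def by (simp add: algebra_simps)
    qed
  qed
  ultimately show ?thesis by (rule weight_class_cong[rotated])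
qed

text \<open>Closeness to \<open>z0\<close> is carried along because it keeps the Newton denominators
  away from 0 and later identifies the limit of \<open>z\<close>. Continuity is eventual, as
  denominators may vanish at small indices.\<close>

definition approx :: "nat \<Rightarrow> (nat \<Rightarrow> real \<Rightarrow> complex) \<Rightarrow> bool" where
  "approx s z \<longleftrightarrow> weight_class v K 0 r z \<and> weight_class v K s (r - s) (residual z) \<and>
     weight_class v K 1 (r - 1) (\<lambda>n t. z n t - z0 n t) \<and> (\<forall>\<^sub>F n in sequentially. continuous_on K (z n))"

lemma approx_z0: "approx 1 z0"
proof -
  have "\<forall>\<^sub>F n in sequentially. continuous_on K (z0 n)"
    using x12_ge
  proof eventually_elim
    case (elim n)
    have "complex_of_real (2 * x12 n t) \<noteq> 0" if "t \<in> K" for t using elim that c_pos by fastforce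
    then show ?case unfolding z0_def D_def
      by (intro continuous_intros cont) auto
  qed
  then show ?thesis unfolding approx_def using weight_class_z0 residual_z0 by (simp add: weight_class_zero)
qed

text \<open>A Newton step leaves a residual made of a forward difference of the correction and a product
  of two corrections; both are of higher order in the weight.\<close>

lemma approx_step:
  assumes z: "approx s z" and s: "1 \<le> s" "s < r"
  shows "\<exists>z'. approx (Suc s) z'"
proof -
  note Wz = z[unfolded approx_def, THEN conjunct1]
  have Wr: "weight_class v K s (r - s) (residual z)" and Wd: "weight_class v K 1 (r - 1) (\<lambda>n t. z n t - z0 n t)"
    and zc: "\<forall>\<^sub>F n in sequentially. continuous_on K (z n)"
    using z by (auto simp: approx_def)
  \<comment> \<open>\<open>B\<close> multiplies a correction that is taken equal at both indices;
    its actual variation leaves the difference of \<delta> behind.\<close>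
  define B where "B n t = complex_of_real (x22 n t) - x11 n t - (z n t + z (Suc n) t) * complex_of_real (x12 n t)" for n t
  have WB: "weight_class v K 0 r B"
    unfolding B_def[abs_def] by (intro weight_class_diff weight_class_mult0 weight_class_add weight_class_of_real W11 W12 W22 Wz weight_class_shift[OF Wz])
  have Bge: "\<forall>\<^sub>F n in sequentially. \<forall>t\<in>K. sqrt c / 2 \<le> norm (B n t)"
  proof (rule eventually_bounded_below_limit)
    let ?y = "\<lambda>n t. complex_of_real (x22 n t) - x11 n t - 2 * z0 n t * complex_of_real (x12 n t)"
    \<comment> \<open>\<open>B\<close> deviates from the derivative at \<open>z0\<close> by the
      errors of \<open>z\<close> at two indices and one difference of \<open>z0\<close>, all of
      order 1 and thus uniformly small.\<close>
    have "weight_class v K 1 (r - 1) (\<lambda>n t. ((z n t - z0 n t) + ((z (Suc n) t - z0 (Suc n) t) + (z0 (Suc n) t - z0 n t))) * (- complex_of_real (x12 n t)))"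
    proof (intro weight_class_mult0 weight_class_add Wd weight_class_shift[OF Wd] weight_class_minus weight_class_of_real)
      show "weight_class v K 1 (r - 1) (\<lambda>n t. z0 (Suc n) t - z0 n t)"
        using weight_class_diff_Suc[of 0 "r - 1" z0] weight_class_z0 r_pos by simp
      show "weight_class v K 0 (r - 1) x12" by (rule weight_class_mono[OF W12]) simp_all
    qed
    then have "weight_class v K 1 (r - 1) (\<lambda>n t. B n t - ?y n t)"
      by (simp add: B_def algebra_simps)
    from weight_class_imp_bounded[OF this] show "uniform_limit K (\<lambda>n t. B n t - ?y n t) (\<lambda>t. 0) sequentially"
      using weight_bounded_uniform_limit by simp
    show "sqrt c > 0" using c_pos by simp
    show "\<forall>\<^sub>F n in sequentially. \<forall>t\<in>K. sqrt c \<le> norm (?y n t)"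
      using x12_ge D_ge
    proof eventually_elim
      case (elim n)
      show ?case
      proof
        fix t assume "t \<in> K"
        then have "c \<le> \<bar>x12 n t\<bar>" "c \<le> D n t" using elim by (auto simp: D_def)
        then show "sqrt c \<le> norm (?y n t)"
          using c_pos by (subst z0_root(2)) (simp_all add: norm_mult)
      qed
    qed
  qed
  have sc: "sqrt c / 2 > 0" using c_pos by simp
  define \<delta> where "\<delta> n t = - residual z n t / B n t" for n t
  have W\<delta>: "weight_class v K s (r - s) \<delta>"
    unfolding \<delta>_def[abs_def] by (rule weight_class_divide[OF weight_class_minus[OF Wr] weight_class_mono[OF WB] sc Bge]) simp_all
  define z' where "z' n t = z n t + \<delta> n t" for n t
  have W0: "weight_class v K 0 r \<delta>" by (rule weight_class_mono[OF W\<delta>]) (use s in simp_all)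
  have "weight_class v K 0 r z'" unfolding z'_def[abs_def] by (intro weight_class_add Wz W0)
  moreover have "weight_class v K 1 (r - 1) (\<lambda>n t. z' n t - z0 n t)"
  proof -
    have "weight_class v K 1 (r - 1) \<delta>" by (rule weight_class_mono[OF W\<delta>]) (use s in simp_all)
    from weight_class_add[OF Wd this] show ?thesis by (simp add: z'_def algebra_simps)
  qed
  moreover have "weight_class v K (Suc s) (r - Suc s) (residual z')"
  proof -
    have "weight_class v K (Suc s) (r - Suc s) (\<lambda>n t. - (\<delta> (Suc n) t - \<delta> n t) * (z n t * complex_of_real (x12 n t) + complex_of_real (x11 n t))
        - \<delta> n t * \<delta> (Suc n) t * complex_of_real (x12 n t))"
    proof (rule weight_class_diff[OF weight_class_mult0[OF weight_class_minus] weight_class_mult0])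
      show "weight_class v K (Suc s) (r - Suc s) (\<lambda>n t. \<delta> (Suc n) t - \<delta> n t)"
        using weight_class_diff_Suc[of s "r - Suc s" \<delta>] W\<delta> s by (simp add: Suc_diff_Suc)
      show "weight_class v K 0 (r - Suc s) (\<lambda>n t. z n t * complex_of_real (x12 n t) + complex_of_real (x11 n t))"
        by (rule weight_class_mono[where s = 0 and d = r]) (intro weight_class_add weight_class_mult0 weight_class_of_real Wz W12 W11 | simp)+
      \<comment> \<open>The product has order 2 s, and 2 s \<ge> s + 1 because s \<ge> 1.\<close>
      show "weight_class v K (Suc s) (r - Suc s) (\<lambda>n t. \<delta> n t * \<delta> (Suc n) t)"
        by (rule weight_class_mono[OF weight_class_mult[OF W\<delta> weight_class_shift[OF W\<delta>]]]) (use s in auto)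
      show "weight_class v K 0 (r - Suc s) (\<lambda>n t. complex_of_real (x12 n t))"
        by (intro weight_class_of_real weight_class_mono[OF W12]) auto
    qed
    moreover have "\<forall>\<^sub>F n in sequentially. \<forall>t\<in>K.
      - (\<delta> (Suc n) t - \<delta> n t) * (z n t * complex_of_real (x12 n t) + complex_of_real (x11 n t)) - \<delta> n t * \<delta> (Suc n) t * complex_of_real (x12 n t) = residual z' n t"
      using Bge
    proof eventually_elim
      case (elim n)
      show ?case
      proof
        fix t assume "t \<in> K"
        then have "B n t \<noteq> 0" using elim sc by fastforce
        then have "\<delta> n t * B n t = - residual z n t" by (simp add: \<delta>_def)
        then have "residual z n t + \<delta> n t * (complex_of_real (x22 n t) - x11 n t - (z n t + z (Suc n) t) * complex_of_real (x12 n t)) = 0"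
          by (simp add: B_def)
        moreover have "residual z' n t = (residual z n t + \<delta> n t * (complex_of_real (x22 n t) - x11 n t - (z n t + z (Suc n) t) * complex_of_real (x12 n t)))
          + (- (\<delta> (Suc n) t - \<delta> n t) * (z n t * complex_of_real (x12 n t) + complex_of_real (x11 n t)) - \<delta> n t * \<delta> (Suc n) t * complex_of_real (x12 n t))"
          unfolding residual_def z'_def by (simp add: algebra_simps)
        ultimately show "- (\<delta> (Suc n) t - \<delta> n t) * (z n t * complex_of_real (x12 n t) + complex_of_real (x11 n t)) - \<delta> n t * \<delta> (Suc n) t * complex_of_real (x12 n t) = residual z' n t"
          by simp
      qed
    qed
    ultimately show ?thesis by (rule weight_class_cong[rotated])
  qed
  moreover have "\<forall>\<^sub>F n in sequentially. continuous_on K (z' n)"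
    using Bge zc eventually_sequentially_shift[OF zc]
  proof eventually_elim
    case (elim n)
    have "complex_of_real (x22 n t) - x11 n t - (z n t + z (Suc n) t) * complex_of_real (x12 n t) \<noteq> 0" if "t \<in> K" for t
      using elim(1) that sc unfolding B_def by fastforce
    then show ?case unfolding z'_def \<delta>_def B_def residual_def
      by (intro continuous_intros cont elim(2,3)) auto
  qed
  ultimately show ?thesis unfolding approx_def by blast
qed

theorem riccati_approx:
  obtains z where "approx r z"
proof -
  have "\<exists>z. approx s z" if "1 \<le> s" "s \<le> r" for s
    using that
  proof (induction s rule: dec_induct)
    case base then show ?case using approx_z0 by blast
  next
    case (step s) then show ?case using approx_step[of s] by auto
  qed
  then show ?thesis using that r_pos by blast
qed

end

section \<open>Bernstein-Szego measures\<close>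

text \<open>By Cauchy's theorem the segment can be replaced by the lower semicircle, where f is
  close to c / z, and c / z integrates to i pi c. For c \<noteq> 0 the decay is only that of 1 / z
  and the truncation has to be symmetric.\<close>

lemma lower_half_plane_integral_limit:
  fixes f :: "complex \<Rightarrow> complex"
  assumes holo: "f holomorphic_on {z. Im z \<le> 0}"
    and lim: "((\<lambda>z. z * f z) \<longlongrightarrow> c) at_infinity"
  shows "((\<lambda>R. integral {-R..R} (\<lambda>x. f (of_real x))) \<longlongrightarrow> \<i> * pi * c) at_top"
proof (rule tendstoI)
  fix e :: real assume e: "e > 0"
  define e' where "e' = e / (2 * pi)"
  have e': "e' > 0" using e by (simp add: e'_def)
  have "\<forall>\<^sub>F z in at_infinity. dist (z * f z) c < e'" using lim e' by (rule tendstoD)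
  then obtain R0 where R0: "\<And>z. R0 \<le> norm z \<Longrightarrow> norm (z * f z - c) < e'"
    unfolding eventually_at_infinity dist_norm by blast
  have "dist (integral {-R..R} (\<lambda>x. f (of_real x))) (\<i> * pi * c) < e" if R: "R \<ge> max R0 1" for R
  proof -
    have R1: "R > 0" "R \<ge> R0" using R by auto
    \<comment> \<open>The angle runs from -pi to 0: the arc leads from -R through the lower half
      plane to R, and \<open>l\<close> leads back.\<close>
    define \<gamma> where "\<gamma> = part_circlepath 0 R (-pi) 0"
    define l where "l = linepath (of_real R :: complex) (of_real (-R))"
    have S: "path_image \<gamma> \<subseteq> {z. Im z \<le> 0}"
    proof
      fix z assume "z \<in> path_image \<gamma>"
      then obtain u where u: "u \<in> closed_segment (-pi) 0" "z = R * exp (\<i> * u)"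
        unfolding \<gamma>_def path_image_part_circlepath' by (auto simp: cis_conv_exp)
      then have "u \<le> 0" "u \<ge> -pi" by (auto simp: closed_segment_eq_real_ivl)
      then have "sin u \<le> 0" using sin_ge_zero[of "-u"] by simp
      then show "z \<in> {z. Im z \<le> 0}" using u R1 by (simp add: Im_exp mult_nonneg_nonpos)
    qed
    have vp: "valid_path \<gamma>" "valid_path l" by (simp_all add: \<gamma>_def l_def)
    have ends: "pathfinish \<gamma> = R" "pathstart \<gamma> = -R" "pathstart l = R" "pathfinish l = - R"
      by (simp_all add: \<gamma>_def l_def exp_eq_polar complex_eq_iff)
    have pl: "path_image l \<subseteq> {z. Im z \<le> 0}"
    proof
      fix z assume "z \<in> path_image l"
      then show "z \<in> {z. Im z \<le> 0}" unfolding l_def path_image_linepath closed_segment_def by auto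
    qed
    have cf: "continuous_on {z. Im z \<le> 0} f" using holo by (rule holomorphic_on_imp_continuous_on)
    have i1: "f contour_integrable_on \<gamma>"
      unfolding \<gamma>_def by (rule contour_integrable_continuous_part_circlepath)
        (use continuous_on_subset[OF cf S] in \<open>simp add: \<gamma>_def\<close>)
    have i2: "f contour_integrable_on l"
      unfolding l_def by (rule contour_integrable_continuous_linepath)
        (use continuous_on_subset[OF cf pl] in \<open>simp add: l_def\<close>)
    have "(f has_contour_integral 0) (\<gamma> +++ l)"
    proof (rule Cauchy_theorem_convex_simple[OF holo])
      show "convex {z. Im z \<le> 0}" using convex_halfspace_Im_le[of 0] by simp
      show "path_image (\<gamma> +++ l) \<subseteq> {z. Im z \<le> 0}"
        using S pl by (simp add: path_image_join ends)
    qed (use vp in \<open>auto simp: ends\<close>)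
    then have "contour_integral \<gamma> f + contour_integral l f = 0"
      using contour_integral_join[OF i1 i2 vp] by (simp add: contour_integral_unique)
    moreover have "contour_integral l f = - contour_integral (linepath (of_real (-R)) (of_real R)) f"
      unfolding l_def
      by (rule contour_integral_reverse_linepath)
         (use continuous_on_subset[OF cf pl] in \<open>simp add: l_def closed_segment_commute\<close>)
    moreover have "contour_integral (linepath (of_real (-R)) (of_real R)) f
        = integral {-R..R} (\<lambda>x. f (of_real x))"
      using contour_integral_linepath_Reals_eq[of "of_real (-R)" "of_real R" f] R1 by simp
    ultimately have I: "integral {-R..R} (\<lambda>x. f (of_real x)) = contour_integral \<gamma> f" by simp
    have cz: "(\<lambda>z. c / z) contour_integrable_on \<gamma>"
      unfolding \<gamma>_def using R1
      by (intro contour_integrable_continuous_part_circlepath continuous_intros)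
         (auto simp: path_image_part_circlepath')
    have "contour_integral \<gamma> (\<lambda>z. c / z) = integral {-pi..0} (\<lambda>t. c * \<i>)"
      unfolding \<gamma>_def using R1
      by (subst contour_integral_part_circlepath_eq) (auto intro!: integral_cong)
    also have "\<dots> = \<i> * pi * c" by (simp add: scaleR_conv_of_real)
    finally have has_improper_integral: "contour_integral \<gamma> (\<lambda>z. c / z) = \<i> * pi * c" .
    have "norm (contour_integral \<gamma> (\<lambda>z. f z - c / z)) \<le> (e' / R) * R * \<bar>0 - (-pi)\<bar>"
      unfolding \<gamma>_def
    proof (rule contour_integral_bound_part_circlepath)
      show "(\<lambda>z. f z - c / z) contour_integrable_on part_circlepath 0 R (- pi) 0"
        using contour_integrable_diff[OF i1 cz] by (simp add: \<gamma>_def)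
      show "0 \<le> e' / R" "0 \<le> R" using e' R1 by auto
      fix z assume "z \<in> path_image (part_circlepath 0 R (- pi) 0)"
      then have nz: "norm z = R" using R1 by (auto simp: path_image_part_circlepath' norm_mult)
      then have "norm (z * f z - c) \<le> e'" using R0[of z] R1 by simp
      moreover have "z \<noteq> 0" using nz R1 by auto
      then have "f z - c / z = (z * f z - c) / z" by (simp add: field_simps)
      ultimately show "norm (f z - c / z) \<le> e' / R"
        using R1 nz by (simp add: norm_divide divide_right_mono)
    qed
    also have "\<dots> = e / 2" using R1 by (simp add: e'_def)
    finally have "norm (contour_integral \<gamma> f - \<i> * pi * c) \<le> e / 2"
      using contour_integral_diff[OF i1 cz] has_improper_integral by simp
    then show ?thesis using e I by (simp add: dist_norm)
  qed
  then show "\<forall>\<^sub>F R in at_top. dist (integral {-R..R} (\<lambda>x. f (of_real x))) (\<i> * pi * c) < e"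
    using eventually_ge_at_top[of "max R0 1"] by (rule eventually_mono[rotated])
qed

section \<open>Orthogonal polynomials at complex arguments: growth and zeros\<close>

fun orth_poly_complex :: "(nat \<Rightarrow> real) \<Rightarrow> (nat \<Rightarrow> real) \<Rightarrow> nat \<Rightarrow> complex \<Rightarrow> complex" where
  "orth_poly_complex a b 0 z = 1"
| "orth_poly_complex a b (Suc 0) z = (z - b 0) / a 0"
| "orth_poly_complex a b (Suc (Suc n)) z = ((z - b (Suc n)) * orth_poly_complex a b (Suc n) z - a n * orth_poly_complex a b n z) / a (Suc n)"

lemma orth_poly_complex_of_real: "orth_poly_complex a b n (of_real x) = of_real (poly (orth_poly a b n) x)"
  by (induction a b n "of_real x :: complex" rule: orth_poly_complex.induct) (simp_all add: diff_divide_distrib add_divide_distrib algebra_simps)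

locale jacobi =
  fixes a b :: "nat \<Rightarrow> real"
  assumes a_pos: "\<And>n. a n > 0"
begin

text \<open>Extending a by 0 at index -1 makes the three-term recurrence valid from n = 0 on.\<close>

definition am :: "nat \<Rightarrow> real" where "am n = (if n = 0 then 0 else a (n - 1))"

lemma am_simps [simp]: "am 0 = 0" "am (Suc n) = a n"
  by (simp_all add: am_def)

lemma a_nz [simp]: "a n \<noteq> 0"
  using a_pos[of n] by simp

abbreviation P :: "nat \<Rightarrow> complex \<Rightarrow> complex" where "P \<equiv> orth_poly_complex a b"

abbreviation p :: "nat \<Rightarrow> real \<Rightarrow> real" where "p n x \<equiv> poly (orth_poly a b n) x"

lemma P_rec: "z * P n z = a n * P (Suc n) z + b n * P n z + am n * P (n - 1) z"
  by (cases n) (simp_all, simp add: algebra_simps)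

lemma p_rec: "x * p n x = a n * p (Suc n) x + b n * p n x + am n * p (n - 1) x"
  by (cases n) (simp_all add: field_simps)

lemma P_Suc: "P (Suc n) = (\<lambda>z::complex. ((z - b n) * P n z - am n * P (n - 1) z) / a n)"
  by (cases n) auto

lemma P_holo: "P n holomorphic_on A"
proof (induction n rule: less_induct)
  case (less n)
  show ?case
  proof (cases n)
    case 0
    then have "P n = (\<lambda>z. 1)" by auto
    then show ?thesis by simp
  next
    case (Suc m)
    have "P m holomorphic_on A" "P (m - 1) holomorphic_on A" using less Suc by auto
    then have "(\<lambda>z::complex. ((z - b m) * P m z - am m * P (m - 1) z) / a m) holomorphic_on A"
      by (intro holomorphic_intros) auto
    then show ?thesis using Suc P_Suc[of m] by simp
  qed
qed

declare orth_poly_complex.simps(3) [simp del]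

text \<open>The leading coefficient of \<open>P n\<close>.\<close>

definition lc :: "nat \<Rightarrow> real" where "lc n = (\<Prod>k<n. inverse (a k))"

lemma lc_pos: "lc n > 0"
  unfolding lc_def by (intro prod_pos) (simp add: a_pos)

lemma lc_Suc: "lc (Suc n) = lc n / a n"
  unfolding lc_def by (simp add: divide_inverse mult.commute)

lemma inv_lim: "((\<lambda>z::complex. c / z) \<longlongrightarrow> 0) at_infinity"
  by (rule tendsto_divide_0[OF tendsto_const]) (rule filterlim_ident)

lemma P_lim: "((\<lambda>z. P n z / z ^ n) \<longlongrightarrow> of_real (lc n)) at_infinity"
proof (induction n rule: less_induct)
  case (less n)
  have nz: "\<forall>\<^sub>F z::complex in at_infinity. z \<noteq> 0" by (rule eventually_not_equal_at_infinity)
  show ?case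
  proof (cases n)
    case 0 then show ?thesis by (simp add: lc_def)
  next
    case (Suc m)
    have 1: "((\<lambda>z. P m z / z ^ m) \<longlongrightarrow> of_real (lc m)) at_infinity" using less Suc by simp
    have 3: "((\<lambda>z. am m * P (m - 1) z / z ^ (Suc m)) \<longlongrightarrow> 0) at_infinity"
    proof (cases m)
      case 0 then show ?thesis by simp
    next
      case (Suc k)
      have "((\<lambda>z::complex. P k z / z ^ k * (a k / z) * (1 / z)) \<longlongrightarrow> of_real (lc k) * 0 * 0) at_infinity"
        by (intro tendsto_mult inv_lim less) (use Suc \<open>n = Suc m\<close> in auto)
      then show ?thesis by (simp add: Suc mult.assoc mult.commute mult.left_commute power2_eq_square)
    qed
    have "((\<lambda>z::complex. (P m z / z ^ m * (1 - of_real (b m) / z) - am m * P (m - 1) z / z ^ (Suc m)) / a m)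
        \<longlongrightarrow> (complex_of_real (lc m) * (1 - 0) - 0) / of_real (a m)) at_infinity"
      by (intro tendsto_intros 1 3 inv_lim) auto
    moreover have "\<forall>\<^sub>F z in at_infinity.
      (P m z / z ^ m * (1 - of_real (b m) / z) - am m * P (m - 1) z / z ^ (Suc m)) / a m = P n z / z ^ n"
      using nz
    proof eventually_elim
      case (elim z)
      have "P m z / z ^ m * (1 - of_real (b m) / z) - am m * P (m - 1) z / z ^ (Suc m)
        = (z * P m z - b m * P m z - am m * P (m - 1) z) / z ^ Suc m"
        using elim by (simp add: field_simps)
      also have "\<dots> = a m * (P n z / z ^ n)" using P_rec[of z m] Suc by simp
      finally show ?case by simp
    qed
    ultimately show ?thesis using Suc lc_Suc[of m]
      by (simp add: tendsto_cong)
  qed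
qed

lemma CD_Im: "Im (a n * P (Suc n) z * cnj (P n z)) = Im z * (\<Sum>k\<le>n. (norm (P k z))\<^sup>2)"
proof (induction n)
  case 0 then show ?case by simp
next
  case (Suc n)
  have "a (Suc n) * P (Suc (Suc n)) z = (z - b (Suc n)) * P (Suc n) z - a n * P n z"
    using P_rec[of z "Suc n"] by (simp add: algebra_simps)
  then have "a (Suc n) * P (Suc (Suc n)) z * cnj (P (Suc n) z)
    = (z - b (Suc n)) * (P (Suc n) z * cnj (P (Suc n) z)) - cnj (a n * P (Suc n) z * cnj (P n z))"
    by (simp only:) (simp add: algebra_simps)
  then have "Im (a (Suc n) * P (Suc (Suc n)) z * cnj (P (Suc n) z))
    = Im z * (norm (P (Suc n) z))\<^sup>2 + Im (a n * P (Suc n) z * cnj (P n z))"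
    by (simp add: complex_norm_square[symmetric] del: of_real_power)
  then show ?case using Suc by (simp add: algebra_simps)
qed

lemma P_not_both_zero: "P n z \<noteq> 0 \<or> P (Suc n) z \<noteq> 0"
proof (induction n)
  case 0 then show ?case by simp
next
  case (Suc n)
  show ?case
  proof (rule ccontr)
    assume "\<not> ?thesis"
    then have z: "P (Suc n) z = 0" "P (Suc (Suc n)) z = 0" by auto
    then have "a n * P n z = 0" using P_rec[of z "Suc n"] by (simp)
    then show False using Suc z by (simp)
  qed
qed

text \<open>At a zero, a n P(n+1) times the conjugate of P(n) equals m |P(n)|^2, with non-negative
  imaginary part, while \<open>CD_Im\<close> makes that part non-positive. Hence P(n) and then
  P(n+1) would vanish, which the recurrence forbids.\<close>

lemma P_quasi_nonzero:
  assumes m: "Im m > 0" and z: "Im z \<le> 0"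
  shows "a n * P (Suc n) z - m * P n z \<noteq> 0"
proof
  assume "a n * P (Suc n) z - m * P n z = 0"
  then have e: "a n * P (Suc n) z = m * P n z" by simp
  then have "a n * P (Suc n) z * cnj (P n z) = m * of_real ((norm (P n z))\<^sup>2)"
    by (simp add: complex_norm_square[symmetric] mult.assoc del: of_real_power)
  then have *: "Im m * (norm (P n z))\<^sup>2 = Im z * (\<Sum>k\<le>n. (norm (P k z))\<^sup>2)"
    using CD_Im[of n z] by simp
  have "Im z * (\<Sum>k\<le>n. (norm (P k z))\<^sup>2) \<le> 0"
    using z by (intro mult_nonpos_nonneg sum_nonneg) auto
  moreover have "Im m * (norm (P n z))\<^sup>2 \<ge> 0" using m by simp
  ultimately have "Im m * (norm (P n z))\<^sup>2 = 0" using * by linarith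
  then have "P n z = 0" using m by simp
  then show False using e P_not_both_zero[of n z] by simp
qed

end

context jacobi
begin

text \<open>Comparison of leading terms: the limit is 1 for k = n because
  \<open>a n * lc (Suc n)\<close> is \<open>lc n\<close>.\<close>

lemma quasi_quotient_lim:
  assumes "k \<le> n"
  shows "((\<lambda>z. z * (P k z / (a n * P (Suc n) z - m * P n z))) \<longlongrightarrow> (if k = n then 1 else 0)) at_infinity"
proof -
  have nz: "\<forall>\<^sub>F z::complex in at_infinity. z \<noteq> 0" by (rule eventually_not_equal_at_infinity)
  have D: "((\<lambda>z::complex. of_real (a n) * (P (Suc n) z / z ^ Suc n) - m * (P n z / z ^ n) * (1 / z))
      \<longlongrightarrow> of_real (a n) * of_real (lc (Suc n)) - m * of_real (lc n) * 0) at_infinity"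
    by (intro tendsto_intros P_lim inv_lim)
  have *: "of_real (a n) * of_real (lc (Suc n)) - m * of_real (lc n) * 0 = complex_of_real (lc n)"
    by (simp add: lc_Suc)
  have lim: "((\<lambda>z::complex. (P k z / z ^ k) * (1 / z) ^ (n - k) /
       (of_real (a n) * (P (Suc n) z / z ^ Suc n) - m * (P n z / z ^ n) * (1 / z)))
     \<longlongrightarrow> of_real (lc k) * 0 ^ (n - k) / of_real (lc n)) at_infinity"
    using D unfolding *
    by (intro tendsto_divide tendsto_mult tendsto_power P_lim inv_lim) (use lc_pos[of n] in auto)
  have eq: "\<forall>\<^sub>F z::complex in at_infinity. (P k z / z ^ k) * (1 / z) ^ (n - k) /
       (of_real (a n) * (P (Suc n) z / z ^ Suc n) - m * (P n z / z ^ n) * (1 / z))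
     = z * (P k z / (a n * P (Suc n) z - m * P n z))"
    using nz
  proof eventually_elim
    case (elim z)
    have 1: "(P k z / z ^ k) * (1 / z) ^ (n - k) = P k z / z ^ n"
      using assms by (simp add: power_one_over power_add[symmetric] divide_inverse mult.assoc
          flip: power_inverse)
    have 2: "of_real (a n) * (P (Suc n) z / z ^ Suc n) - m * (P n z / z ^ n) * (1 / z)
        = (a n * P (Suc n) z - m * P n z) / z ^ Suc n"
      by (simp add: diff_divide_distrib mult.commute)
    show ?case unfolding 1 2 using elim by (simp add: mult.commute)
  qed
  have val: "of_real (lc k) * 0 ^ (n - k) / of_real (lc n) = (if k = n then 1 else 0 :: complex)"
    using assms lc_pos[of n] by auto
  from lim eq show ?thesis unfolding val using tendsto_cong by fastforce
qed

end

section \<open>The Bernstein-Szego density and its orthogonality relations\<close>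

locale bernstein_szego = jacobi +
  fixes n :: nat and m :: complex
  assumes m_pos: "Im m > 0"
begin

definition E :: "complex \<Rightarrow> complex" where "E z = a n * P (Suc n) z - m * P n z"

text \<open>On the real line p n times \<open>dens\<close> is Im (1 / E) / pi. Integrals against p n
  thus become contour integrals in the lower half plane, where \<open>E\<close> has no
  zeros.\<close>

definition dens :: "real \<Rightarrow> real" where
  "dens x = Im m / (pi * (norm (a n * p (Suc n) x - m * p n x))\<^sup>2)"

lemma E_of_real: "E (of_real x) = a n * p (Suc n) x - m * p n x"
  by (simp add: E_def orth_poly_complex_of_real)

lemma E_nz: "Im z \<le> 0 \<Longrightarrow> E z \<noteq> 0"
  unfolding E_def by (rule P_quasi_nonzero[OF m_pos])

lemma dens_pos: "dens x > 0"
  using E_nz[of "of_real x"] m_pos by (simp add: dens_def E_of_real)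

lemma dens_eq: "dens x = Im m / pi / (norm (E x))\<^sup>2"
  by (simp add: dens_def E_of_real)

lemma continuous_dens: "continuous_on A dens"
proof -
  have "complex_of_real (a n * p (Suc n) x) - m * p n x \<noteq> 0" for x
    using E_nz[of "of_real x"] by (simp add: E_of_real)
  then show ?thesis unfolding dens_def
    by (intro continuous_intros) auto
qed

text \<open>Truncation is symmetric because the quotients behind these integrals may decay like 1 /
  z only; absolute integrability is regained afterwards.\<close>

definition has_improper_integral :: "(real \<Rightarrow> real) \<Rightarrow> real \<Rightarrow> bool" where
  "has_improper_integral f l \<longleftrightarrow> ((\<lambda>R. integral {-R..R} (\<lambda>x. f x * dens x)) \<longlongrightarrow> l) at_top"

lemma integrable_dens:
  assumes "continuous_on UNIV f"
  shows "(\<lambda>x. f x * dens x) integrable_on {-R..R}"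
  by (intro integrable_continuous_interval continuous_on_mult continuous_dens
      continuous_on_subset[OF assms]) auto

lemma improper_integral_add:
  assumes "has_improper_integral f l" "has_improper_integral g k" "continuous_on UNIV f" "continuous_on UNIV g"
  shows "has_improper_integral (\<lambda>x. c * f x + d * g x) (c * l + d * k)"
proof -
  have "((\<lambda>R. c * integral {-R..R} (\<lambda>x. f x * dens x) + d * integral {-R..R} (\<lambda>x. g x * dens x))
     \<longlongrightarrow> c * l + d * k) at_top"
    using assms unfolding has_improper_integral_def by (intro tendsto_intros) auto
  moreover have "integral {-R..R} (\<lambda>x. (c * f x + d * g x) * dens x)
    = c * integral {-R..R} (\<lambda>x. f x * dens x) + d * integral {-R..R} (\<lambda>x. g x * dens x)" for R
    using integral_add[of "\<lambda>x. c * (f x * dens x)" "{-R..R}" "\<lambda>x. d * (g x * dens x)"]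
      integrable_dens[OF assms(3), of R] integrable_dens[OF assms(4), of R]
      integrable_on_cmult_left[OF integrable_dens[OF assms(3), of R], of c]
      integrable_on_cmult_left[OF integrable_dens[OF assms(4), of R], of d]
    by (simp add: algebra_simps)
  ultimately show ?thesis unfolding has_improper_integral_def by simp
qed

lemma quotient_limit:
  assumes "k \<le> n"
  shows "((\<lambda>R. integral {-R..R} (\<lambda>x. P k (of_real x) / E (of_real x)))
     \<longlongrightarrow> \<i> * pi * (if k = n then 1 else 0)) at_top"
proof (rule lower_half_plane_integral_limit)
  show "(\<lambda>z. P k z / E z) holomorphic_on {z. Im z \<le> 0}"
    using E_nz unfolding E_def by (intro holomorphic_intros P_holo) auto
  show "((\<lambda>z. z * (P k z / E z)) \<longlongrightarrow> (if k = n then 1 else 0)) at_infinity"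
    unfolding E_def by (rule quasi_quotient_lim[OF assms])
qed

text \<open>Only the top index has a non-zero contour limit, and a constant c enters through Im (c i
  pi) / pi = Re c.\<close>

lemma improper_integral_linear:
  assumes k: "k \<le> n" and f: "\<And>x. f x * dens x = Im (c * (P k (of_real x) / E (of_real x))) / pi"
  shows "has_improper_integral f (if k = n then Re c else 0)"
proof -
  have cont: "continuous_on {-R..R} (\<lambda>x. P k (of_real x) / E (of_real x))" for R
  proof -
    have "(\<lambda>z. P k z / E z) holomorphic_on {z. Im z \<le> 0}"
      using E_nz unfolding E_def by (intro holomorphic_intros P_holo) auto
    from holomorphic_on_imp_continuous_on[OF this] show ?thesis
      by (rule continuous_on_compose2[where g = "\<lambda>z. P k z / E z"]) (auto intro!: continuous_intros)
  qed
  have "integral {-R..R} (\<lambda>x. f x * dens x)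
      = Im (c * integral {-R..R} (\<lambda>x. P k (of_real x) / E (of_real x))) / pi" for R
  proof -
    have h: "((\<lambda>x. P k (of_real x) / E (of_real x)) has_integral
        integral {-R..R} (\<lambda>x. P k (of_real x) / E (of_real x))) {-R..R}"
      using integrable_continuous_interval[OF cont] by (rule integrable_integral)
    have "((\<lambda>x. Im (c * (P k (of_real x) / E (of_real x))) / pi) has_integral
        Im (c * integral {-R..R} (\<lambda>x. P k (of_real x) / E (of_real x))) / pi) {-R..R}"
      by (intro has_integral_divide has_integral_Im has_integral_mult_right h)
    then show ?thesis unfolding f by (rule integral_unique)
  qed
  moreover have "((\<lambda>R. Im (c * integral {-R..R} (\<lambda>x. P k (of_real x) / E (of_real x))) / pi)
    \<longlongrightarrow> Im (c * (\<i> * pi * (if k = n then 1 else 0))) / pi) at_top"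
    by (intro tendsto_intros quotient_limit k) auto
  ultimately show ?thesis unfolding has_improper_integral_def by (auto simp: if_distrib cong: if_cong)
qed

lemma improper_integral_top: "k \<le> n \<Longrightarrow> has_improper_integral (\<lambda>x. p n x * p k x) (if k = n then 1 else 0)"
proof -
  assume k: "k \<le> n"
  have "p n x * p k x * dens x = Im (1 * (P k (of_real x) / E (of_real x))) / pi" for x
  proof -
    have "Im (cnj (E x)) = Im m * p n x" by (simp add: E_of_real)
    moreover have "P k x / E x = p k x * cnj (E x) / (norm (E x))\<^sup>2"
      by (simp add: orth_poly_complex_of_real complex_div_cnj[of _ "E x"])
    ultimately show ?thesis
      by (simp add: dens_eq Im_divide_of_real algebra_simps flip: of_real_power)
  qed
  from improper_integral_linear[OF k this] show ?thesis by (simp cong: if_cong)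
qed

text \<open>With the constant m / a n in place of 1, the imaginary part selects p (Suc n) instead of
  p n. At k = n the limit would be Re (m / a n), hence the restriction to k < n.\<close>

lemma improper_integral_top_Suc: "k < n \<Longrightarrow> has_improper_integral (\<lambda>x. p (Suc n) x * p k x) 0"
proof -
  assume k: "k < n"
  have "p (Suc n) x * p k x * dens x = Im ((m / a n) * (P k (of_real x) / E (of_real x))) / pi" for x
  proof -
    have "Im (m / a n * cnj (E x)) = Im m * p (Suc n) x"
      by (simp add: E_of_real field_simps)
    moreover have "P k x / E x = p k x * cnj (E x) / (norm (E x))\<^sup>2"
      by (simp add: orth_poly_complex_of_real complex_div_cnj[of _ "E x"])
    then have "m / a n * (P k x / E x) = p k x * (m / a n * cnj (E x)) / of_real ((norm (E x))\<^sup>2)"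
      by simp
    ultimately have "Im (m / a n * (P k x / E x)) = p k x * (Im m * p (Suc n) x) / (norm (E x))\<^sup>2"
      by (simp only: Im_divide_of_real Im_complex_of_real times_complex.sel) simp
    then show ?thesis unfolding dens_eq by (simp only: mult_ac divide_divide_eq_left times_divide_eq_left times_divide_eq_right)
  qed
  from improper_integral_linear[OF less_imp_le[OF k] this] show ?thesis using k by simp
qed

text \<open>Going down in j, the recurrence writes \<open>a j * p j x\<close> through p (Suc j), p
  (Suc (Suc j)) and a factor x, which is moved to p k and expanded there. This consumes both
  relations one index up, so both are carried along.\<close>

lemma improper_integral_down:
  assumes "j \<le> n"
  shows "(\<forall>k\<le>j. has_improper_integral (\<lambda>x. p j x * p k x) (if k = j then 1 else 0)) \<and> (\<forall>k<j. has_improper_integral (\<lambda>x. p (Suc j) x * p k x) 0)"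
  using assms
proof (induction rule: inc_induct)
  case base
  then show ?case using improper_integral_top improper_integral_top_Suc by blast
next
  case (step j)
  have c: "continuous_on UNIV (\<lambda>x. p i x * p k x)" for i k by (intro continuous_intros)
  have A: "has_improper_integral (\<lambda>x. p (Suc j) x * p k x) (if k = Suc j then 1 else 0)" if "k \<le> Suc j" for k
    using step.IH that by blast
  have A0: "has_improper_integral (\<lambda>x. p (Suc j) x * p k x) 0" if "k < Suc j" for k
    using A[of k] that by simp
  have B: "has_improper_integral (\<lambda>x. p (Suc (Suc j)) x * p k x) 0" if "k < Suc j" for k
    using step.IH that by blast
  have 1: "has_improper_integral (\<lambda>x. p j x * p k x) (if k = j then 1 else 0)" if k: "k \<le> j" for k
  proof -
    \<comment> \<open>For k = 0 truncated subtraction yields the index 0; the term is later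
      multiplied by \<open>am 0\<close>, which is 0.\<close>
    have Am: "has_improper_integral (\<lambda>x. p (Suc j) x * p (k - 1) x) 0" using A0[of "k - 1"] k by simp
    have I1: "has_improper_integral (\<lambda>x. a k * (p (Suc j) x * p (Suc k) x) + (b k - b (Suc j)) * (p (Suc j) x * p k x))
        (a k * (if Suc k = Suc j then 1 else 0) + (b k - b (Suc j)) * 0)"
      by (intro improper_integral_add c) (use A[of "Suc k"] A[of k] k in auto)
    have I2: "has_improper_integral (\<lambda>x. am k * (p (Suc j) x * p (k - 1) x) + (- a (Suc j)) * (p (Suc (Suc j)) x * p k x))
        (am k * 0 + (- a (Suc j)) * 0)"
      by (intro improper_integral_add c Am B) (use k in auto)
    have "has_improper_integral (\<lambda>x. (1 / a j) * (a k * (p (Suc j) x * p (Suc k) x) + (b k - b (Suc j)) * (p (Suc j) x * p k x))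
         + (1 / a j) * (am k * (p (Suc j) x * p (k - 1) x) + (- a (Suc j)) * (p (Suc (Suc j)) x * p k x)))
       ((1 / a j) * (a k * (if Suc k = Suc j then 1 else 0) + (b k - b (Suc j)) * 0)
         + (1 / a j) * (am k * 0 + (- a (Suc j)) * 0))"
      by (intro improper_integral_add I1 I2 continuous_intros)
    moreover have "(1 / a j) * (a k * (p (Suc j) x * p (Suc k) x) + (b k - b (Suc j)) * (p (Suc j) x * p k x))
         + (1 / a j) * (am k * (p (Suc j) x * p (k - 1) x) + (- a (Suc j)) * (p (Suc (Suc j)) x * p k x))
         = p j x * p k x" for x
    proof -
      have "a k * (p (Suc j) x * p (Suc k) x) + (b k - b (Suc j)) * (p (Suc j) x * p k x)
         + (am k * (p (Suc j) x * p (k - 1) x) + (- a (Suc j)) * (p (Suc (Suc j)) x * p k x))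
         = p (Suc j) x * (a k * p (Suc k) x + b k * p k x + am k * p (k - 1) x)
           - p k x * (b (Suc j) * p (Suc j) x + a (Suc j) * p (Suc (Suc j)) x)"
        by (simp only: algebra_simps)
      also have "\<dots> = p (Suc j) x * (x * p k x) - p k x * (x * p (Suc j) x - a j * p j x)"
        using p_rec[of x k] p_rec[of x "Suc j"] by simp
      also have "\<dots> = a j * (p j x * p k x)" by (simp only: algebra_simps)
      finally show ?thesis by (simp only: flip: distrib_left) simp
    qed
    ultimately have "has_improper_integral (\<lambda>x. p j x * p k x) ((1 / a j) * (a k * (if Suc k = Suc j then 1 else 0)))"
      by simp
    then show ?thesis by (cases "k = j") simp_all
  qed
  have 2: "has_improper_integral (\<lambda>x. p (Suc j) x * p k x) 0" if "k < j" for k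
    using A0[of k] that by simp
  show ?case using 1 2 by blast
qed

lemma improper_integral_orthonormal_aux: "j \<le> n \<Longrightarrow> k \<le> j \<Longrightarrow> has_improper_integral (\<lambda>x. p j x * p k x) (if k = j then 1 else 0)"
  using improper_integral_down by blast

lemma improper_integral_orthonormal: "j \<le> n \<Longrightarrow> k \<le> n \<Longrightarrow> has_improper_integral (\<lambda>x. p j x * p k x) (if j = k then 1 else 0)"
  using improper_integral_orthonormal_aux[of j k] improper_integral_orthonormal_aux[of k j]
  by (cases "k \<le> j") (simp_all add: mult.commute eq_commute)

end

section \<open>From symmetric truncations to Lebesgue integrals\<close>

lemma tendsto_integral_truncate:
  fixes f g :: "real \<Rightarrow> real"
  assumes f: "continuous_on UNIV f" and g: "integrable lborel g" "\<And>x. \<bar>f x\<bar> \<le> g x"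
  shows "integrable lborel f" "((\<lambda>n. integral {-real n..real n} f) \<longlongrightarrow> integral\<^sup>L lborel f) sequentially"
proof -
  have meas: "f \<in> borel_measurable lborel"
    using borel_measurable_continuous_onI[OF f] by simp
  show "integrable lborel f"
    by (rule Bochner_Integration.integrable_bound[OF g(1) meas]) (rule AE_I2, metis abs_ge_self g(2) order_trans real_norm_def)
  have si: "set_integrable lborel {-real n..real n} f" for n
    by (rule borel_integrable_atLeastAtMost') (rule continuous_on_subset[OF f], simp)
  have "(\<lambda>n. integral\<^sup>L lborel (\<lambda>x. indicator {-real n..real n} x *\<^sub>R f x)) \<longlonglongrightarrow> integral\<^sup>L lborel f"
  proof (rule integral_dominated_convergence[OF meas _ g(1)])
    show "AE x in lborel. (\<lambda>n. indicator {- real n..real n} x *\<^sub>R f x) \<longlonglongrightarrow> f x"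
    proof (rule AE_I2)
      fix x :: real
      have "\<forall>\<^sub>F n in sequentially. indicator {- real n..real n} x *\<^sub>R f x = f x"
        using eventually_ge_at_top[of "nat \<lceil>\<bar>x\<bar>\<rceil>"]
      proof eventually_elim
        case (elim n)
        then have "\<bar>x\<bar> \<le> real n" by linarith
        then show ?case by (auto simp: indicator_def)
      qed
      then show "(\<lambda>n. indicator {- real n..real n} x *\<^sub>R f x) \<longlonglongrightarrow> f x"
        by (rule tendsto_eventually)
    qed
    show "AE x in lborel. norm (indicator {- real n..real n} x *\<^sub>R f x) \<le> g x" for n
    proof (rule AE_I2)
      fix x show "norm (indicator {- real n..real n} x *\<^sub>R f x) \<le> g x"
        using g(2)[of x] abs_ge_zero[of "f x"] unfolding indicator_def real_norm_def
        by (simp, linarith)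
    qed
  qed (use meas in auto)
  moreover have "integral\<^sup>L lborel (\<lambda>x. indicator {-real n..real n} x *\<^sub>R f x) = integral {-real n..real n} f" for n
    using set_borel_integral_eq_integral(2)[OF si] by (simp add: set_lebesgue_integral_def)
  ultimately show "((\<lambda>n. integral {-real n..real n} f) \<longlongrightarrow> integral\<^sup>L lborel f) sequentially"
    by simp
qed

lemma integrable_nonneg_truncate:
  fixes f :: "real \<Rightarrow> real"
  assumes f: "continuous_on UNIV f" and nonneg: "\<And>x. 0 \<le> f x"
    and lim: "((\<lambda>R. integral {-R..R} f) \<longlongrightarrow> l) at_top"
  shows "integrable lborel f"
proof -
  have meas: "f \<in> borel_measurable lborel"
    using borel_measurable_continuous_onI[OF f] by simp
  have si: "set_integrable lborel {-real n..real n} f" for n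
    by (rule borel_integrable_atLeastAtMost') (rule continuous_on_subset[OF f], simp)
  show ?thesis
  proof (rule integrable_monotone_convergence)
    show "integrable lborel (\<lambda>x. indicator {-real n..real n} x *\<^sub>R f x)" for n
      using si unfolding set_integrable_def .
    show "AE x in lborel. mono (\<lambda>n. indicator {- real n..real n} x *\<^sub>R f x)"
    proof (intro AE_I2 monoI)
      fix x and i j :: nat assume "i \<le> j"
      then show "indicator {- real i..real i} x *\<^sub>R f x \<le> indicator {- real j..real j} x *\<^sub>R f x"
        using nonneg[of x] by (auto simp: indicator_def)
    qed
    show "AE x in lborel. (\<lambda>n. indicator {- real n..real n} x *\<^sub>R f x) \<longlonglongrightarrow> f x"
    proof (rule AE_I2)
      fix x :: real
      have "\<forall>\<^sub>F n in sequentially. indicator {- real n..real n} x *\<^sub>R f x = f x"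
        using eventually_ge_at_top[of "nat \<lceil>\<bar>x\<bar>\<rceil>"]
      proof eventually_elim
        case (elim n)
        then have "\<bar>x\<bar> \<le> real n" by linarith
        then show ?case by (auto simp: indicator_def)
      qed
      then show "(\<lambda>n. indicator {- real n..real n} x *\<^sub>R f x) \<longlonglongrightarrow> f x"
        by (rule tendsto_eventually)
    qed
    have "(\<lambda>n. integral {-real n..real n} f) \<longlonglongrightarrow> l"
      using filterlim_compose[OF lim filterlim_real_sequentially] .
    then show "(\<lambda>n. integral\<^sup>L lborel (\<lambda>x. indicator {-real n..real n} x *\<^sub>R f x)) \<longlonglongrightarrow> l"
      using set_borel_integral_eq_integral(2)[OF si] by (simp add: set_lebesgue_integral_def)
  qed (rule meas)
qed

context jacobi
begin

text \<open>The index is bounded because a Bernstein-Szego density built from \<open>P n\<close> and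
  \<open>P (Suc n)\<close> decays too slowly for the polynomials beyond n to be square
  integrable.\<close>

definition orthonormal_upto :: "nat \<Rightarrow> real measure \<Rightarrow> bool" where
  "orthonormal_upto n M \<longleftrightarrow> prob_space M \<and> sets M = sets borel \<and>
     (\<forall>j\<le>n. \<forall>k\<le>n. has_bochner_integral M (\<lambda>x. p j x * p k x) (if j = k then 1 else 0))"

end

context bernstein_szego
begin

definition bs_measure :: "real measure" where
  "bs_measure = density lborel (\<lambda>x. ennreal (dens x))"

lemma dens_measurable [measurable]: "dens \<in> borel_measurable borel"
  by (rule borel_measurable_continuous_onI[OF continuous_dens])

lemma improper_integral_integral:
  assumes j: "j \<le> n" and k: "k \<le> n"
  shows "integrable lborel (\<lambda>x. p j x * p k x * dens x)"
    "integral\<^sup>L lborel (\<lambda>x. p j x * p k x * dens x) = (if j = k then 1 else 0)"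
proof -
  have c: "continuous_on UNIV (\<lambda>x. p i x * p l x * dens x)" for i l
    by (intro continuous_intros continuous_dens)
  \<comment> \<open>Squares are non-negative, so the symmetric limit yields integrability by
    monotone convergence; mixed products are then dominated by sums of squares.\<close>
  have sq: "integrable lborel (\<lambda>x. p i x * p i x * dens x)" if "i \<le> n" for i
    by (rule integrable_nonneg_truncate[OF c, where l = 1])
       (use improper_integral_orthonormal[OF that that] dens_pos in \<open>auto simp: has_improper_integral_def less_imp_le\<close>)
  have G: "integrable lborel (\<lambda>x. p j x * p j x * dens x + p k x * p k x * dens x)"
    by (intro Bochner_Integration.integrable_add sq j k)
  have le: "\<bar>p j x * p k x * dens x\<bar> \<le> p j x * p j x * dens x + p k x * p k x * dens x" for x
  proof -
    have "\<bar>p j x * p k x\<bar> \<le> p j x * p j x + p k x * p k x"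
    proof -
      have "2 * (\<bar>p j x\<bar> * \<bar>p k x\<bar>) \<le> p j x * p j x + p k x * p k x"
        using sum_squares_bound[of "\<bar>p j x\<bar>" "\<bar>p k x\<bar>"] by (simp add: power2_eq_square)
      moreover have "0 \<le> \<bar>p j x\<bar> * \<bar>p k x\<bar>" by simp
      ultimately show ?thesis unfolding abs_mult by linarith
    qed
    then have "\<bar>p j x * p k x\<bar> * dens x \<le> (p j x * p j x + p k x * p k x) * dens x"
      by (rule mult_right_mono) (simp add: dens_pos less_imp_le)
    then show ?thesis using dens_pos[of x] by (simp add: abs_mult algebra_simps)
  qed
  from tendsto_integral_truncate[OF c G le]
  show "integrable lborel (\<lambda>x. p j x * p k x * dens x)" by simp
  have "(\<lambda>i. integral {-real i..real i} (\<lambda>x. p j x * p k x * dens x)) \<longlonglongrightarrow> (if j = k then 1 else 0)"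
    using filterlim_compose[OF improper_integral_orthonormal[OF j k, unfolded has_improper_integral_def] filterlim_real_sequentially] .
  with tendsto_integral_truncate(2)[OF c G le]
  show "integral\<^sup>L lborel (\<lambda>x. p j x * p k x * dens x) = (if j = k then 1 else 0)"
    using LIMSEQ_unique by blast
qed

lemma bs_measure_orthonormal: "orthonormal_upto n bs_measure"
proof -
  have orthonormal_integral: "has_bochner_integral bs_measure (\<lambda>x. p j x * p k x) (if j = k then 1 else 0)"
    if "j \<le> n" "k \<le> n" for j k
  proof -
    have "has_bochner_integral lborel (\<lambda>x. dens x *\<^sub>R (p j x * p k x)) (if j = k then 1 else 0)"
      using improper_integral_integral[OF that] by (simp add: has_bochner_integral_iff mult.commute)
    then show ?thesis unfolding bs_measure_def
      by (intro has_bochner_integral_density)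
         (auto simp: dens_pos less_imp_le intro!: AE_I2 borel_measurable_continuous_onI continuous_intros)
  qed
  have "has_bochner_integral bs_measure (\<lambda>x. p 0 x * p 0 x) 1" using orthonormal_integral[of 0 0] by simp
  then have "has_bochner_integral bs_measure (\<lambda>x. 1 :: real) 1" by simp
  then have one: "integrable bs_measure (\<lambda>x. 1::real)" "integral\<^sup>L bs_measure (\<lambda>x. 1::real) = 1"
    by (auto simp: has_bochner_integral_iff)
  have "(\<integral>\<^sup>+x. ennreal 1 \<partial>bs_measure) = ennreal 1"
    using nn_integral_eq_integral[OF one(1)] one(2) by simp
  then have "prob_space bs_measure" by (intro prob_spaceI) simp
  then show ?thesis using orthonormal_integral unfolding orthonormal_upto_def by (simp add: bs_measure_def)
qed

end

section \<open>Stieltjes transforms and determinacy\<close>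

context jacobi
begin

text \<open>The Fourier coefficient of the kernel 1 / (x - z) along p k; index 0 is the Stieltjes
  transform itself.\<close>

definition stieltjes :: "real measure \<Rightarrow> nat \<Rightarrow> complex \<Rightarrow> complex" where
  "stieltjes M k z = (\<integral>x. of_real (p k x) / (of_real x - z) \<partial>M)"

lemma p_measurable [measurable]: "p k \<in> borel_measurable borel"
  by (intro borel_measurable_continuous_onI continuous_intros)

context
  fixes n :: nat and M :: "real measure"
  assumes M: "orthonormal_upto n M"
begin

lemma prob_M: "prob_space M" and sets_M [measurable_cong]: "sets M = sets borel"
  using M by (auto simp: orthonormal_upto_def)

lemma orthonormal_integral: "j \<le> n \<Longrightarrow> k \<le> n \<Longrightarrow> has_bochner_integral M (\<lambda>x. p j x * p k x) (if j = k then 1 else 0)"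
  using M unfolding orthonormal_upto_def by blast

lemma integral_p: "k \<le> n \<Longrightarrow> has_bochner_integral M (p k) (if k = 0 then 1 else 0)"
  using orthonormal_integral[of k 0] by simp

lemma integrable_mult_bounded:
  fixes u :: "real \<Rightarrow> 'a::{banach, second_countable_topology, real_normed_field}"
  assumes k: "k \<le> n" and u: "u \<in> borel_measurable borel" "\<And>x. norm (u x) \<le> B"
  shows "integrable M (\<lambda>x. of_real (p k x) * u x)"
proof (rule Bochner_Integration.integrable_bound)
  show "integrable M (\<lambda>x. B * p k x)"
    using integral_p[OF k] by (auto simp: has_bochner_integral_iff)
  show "(\<lambda>x. of_real (p k x) * u x) \<in> borel_measurable M" using u(1) by measurable
  show "AE x in M. norm (of_real (p k x) * u x) \<le> norm (B * p k x)"
  proof (rule AE_I2)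
    fix x
    have "norm (u x) \<le> \<bar>B\<bar>" using u(2)[of x] by linarith
    then show "norm (of_real (p k x) * u x) \<le> norm (B * p k x)"
      by (simp add: norm_mult abs_mult mult.commute mult_right_mono)
  qed
qed

text \<open>Bessel's inequality, from integrating the square of u minus its partial Fourier sum.
  Complex functions are treated later through real and imaginary parts.\<close>

lemma bessel_real:
  fixes u :: "real \<Rightarrow> real"
  assumes u [measurable]: "u \<in> borel_measurable borel" and B: "\<And>x. \<bar>u x\<bar> \<le> B"
  shows "(\<Sum>k\<le>n. (\<integral>x. p k x * u x \<partial>M)\<^sup>2) \<le> (\<integral>x. (u x)\<^sup>2 \<partial>M)"
proof -
  interpret prob_space M by (rule prob_M)
  define c where "c k = (\<integral>x. p k x * u x \<partial>M)" for k
  have iu: "has_bochner_integral M (\<lambda>x. (u x)\<^sup>2) (\<integral>x. (u x)\<^sup>2 \<partial>M)"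
    unfolding has_bochner_integral_iff
  proof (intro conjI refl integrable_const_bound[where B = "B\<^sup>2"])
    show "AE x in M. norm ((u x)\<^sup>2) \<le> B\<^sup>2"
      using power_mono[OF B abs_ge_zero, of _ 2] by (intro AE_I2) simp
  qed measurable
  have ip: "has_bochner_integral M (\<lambda>x. p k x * u x) (c k)" if "k \<le> n" for k
    using integrable_mult_bounded[OF that u, of B] B by (simp add: has_bochner_integral_iff c_def)
  define S where "S x = (\<Sum>k\<le>n. c k * p k x)" for x
  have sq: "(u x - S x)\<^sup>2 =
     (u x)\<^sup>2 - 2 * (\<Sum>k\<le>n. c k * (p k x * u x)) + (\<Sum>j\<le>n. \<Sum>k\<le>n. c j * c k * (p j x * p k x))" for x
  proof -
    have "(\<Sum>k\<le>n. c k * (p k x * u x)) = S x * u x"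
      by (simp add: S_def sum_distrib_right mult.assoc)
    moreover have "(\<Sum>j\<le>n. \<Sum>k\<le>n. c j * c k * (p j x * p k x)) = S x * S x"
      by (simp add: S_def sum_product mult_ac)
    ultimately show ?thesis by (simp add: power2_eq_square algebra_simps)
  qed
  have "has_bochner_integral M (\<lambda>x. (u x - S x)\<^sup>2)
     ((\<integral>x. (u x)\<^sup>2 \<partial>M) - 2 * (\<Sum>k\<le>n. c k * c k)
       + (\<Sum>j\<le>n. \<Sum>k\<le>n. c j * c k * (if j = k then 1 else 0)))"
    unfolding sq
    by (intro has_bochner_integral_add has_bochner_integral_diff has_bochner_integral_mult_right
        has_bochner_integral_sum iu ip orthonormal_integral) auto
  from has_bochner_integral_integral_eq[OF this]
  have "0 \<le> (\<integral>x. (u x)\<^sup>2 \<partial>M) - 2 * (\<Sum>k\<le>n. c k * c k)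
       + (\<Sum>j\<le>n. \<Sum>k\<le>n. c j * c k * (if j = k then 1 else 0))"
    using Bochner_Integration.integral_nonneg[of M "\<lambda>x. (u x - S x)\<^sup>2"] by simp
  also have "(\<Sum>j\<le>n. \<Sum>k\<le>n. c j * c k * (if j = k then 1 else 0)) = (\<Sum>j\<le>n. c j * c j)"
    by (intro sum.cong refl) (simp add: if_distrib cong: if_cong)
  finally show ?thesis by (simp add: c_def power2_eq_square)
qed

context
  fixes z :: complex
  assumes z: "Im z > 0"
begin

lemma kernel_bound: "norm (1 / (of_real x - z)) \<le> 1 / Im z"
proof -
  have "Im z \<le> norm (of_real x - z)" using abs_Im_le_cmod[of "of_real x - z"] z by simp
  then show ?thesis using z by (simp add: norm_divide frac_le)
qed

lemma kernel_nz: "of_real x - z \<noteq> 0"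
  using z by (auto simp: complex_eq_iff)

lemma kernel_measurable [measurable]: "(\<lambda>x. 1 / (of_real x - z)) \<in> borel_measurable borel"
  by (intro borel_measurable_continuous_onI continuous_intros) (use kernel_nz in auto)

lemma stieltjes_integrable:
  assumes "k \<le> n"
  shows "integrable M (\<lambda>x. of_real (p k x) / (of_real x - z))"
  using integrable_mult_bounded[OF assms kernel_measurable kernel_bound] by simp

lemma bessel_stieltjes: "(\<Sum>k\<le>n. (norm (stieltjes M k z))\<^sup>2) \<le> 1 / (Im z)\<^sup>2"
proof -
  interpret prob_space M by (rule prob_M)
  define h where "h x = 1 / (of_real x - z)" for x
  have hm [measurable]: "h \<in> borel_measurable borel" unfolding h_def by measurable
  have hB: "norm (h x) \<le> 1 / Im z" for x unfolding h_def by (rule kernel_bound)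
  have hR: "\<bar>Re (h x)\<bar> \<le> 1 / Im z" "\<bar>Im (h x)\<bar> \<le> 1 / Im z" for x
    using hB[of x] abs_Re_le_cmod[of "h x"] abs_Im_le_cmod[of "h x"] by linarith+
  have isq: "integrable M (\<lambda>x. (Re (h x))\<^sup>2)" "integrable M (\<lambda>x. (Im (h x))\<^sup>2)"
    using power_mono[OF hR(1) abs_ge_zero, of _ 2] power_mono[OF hR(2) abs_ge_zero, of _ 2]
    by (auto intro!: integrable_const_bound[where B = "(1 / Im z)\<^sup>2"] AE_I2)
  have "(norm (stieltjes M k z))\<^sup>2 = (\<integral>x. p k x * Re (h x) \<partial>M)\<^sup>2 + (\<integral>x. p k x * Im (h x) \<partial>M)\<^sup>2" if "k \<le> n" for k
  proof -
    have i: "integrable M (\<lambda>x. of_real (p k x) * h x)"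
      using stieltjes_integrable[OF that] by (simp add: h_def)
    have st: "stieltjes M k z = (\<integral>x. of_real (p k x) * h x \<partial>M)"
      by (simp add: stieltjes_def h_def)
    have "Re (stieltjes M k z) = (\<integral>x. p k x * Re (h x) \<partial>M)" "Im (stieltjes M k z) = (\<integral>x. p k x * Im (h x) \<partial>M)"
      unfolding st using integral_Re[OF i] integral_Im[OF i] by simp_all
    then show ?thesis by (simp add: cmod_power2)
  qed
  then have "(\<Sum>k\<le>n. (norm (stieltjes M k z))\<^sup>2)
    = (\<Sum>k\<le>n. (\<integral>x. p k x * Re (h x) \<partial>M)\<^sup>2) + (\<Sum>k\<le>n. (\<integral>x. p k x * Im (h x) \<partial>M)\<^sup>2)"
    by (simp add: sum.distrib)
  also have "\<dots> \<le> (\<integral>x. (Re (h x))\<^sup>2 \<partial>M) + (\<integral>x. (Im (h x))\<^sup>2 \<partial>M)"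
  proof -
    have "(\<lambda>x. Re (h x)) \<in> borel_measurable borel" "(\<lambda>x. Im (h x)) \<in> borel_measurable borel"
      by measurable
    from bessel_real[OF this(1) hR(1)] bessel_real[OF this(2) hR(2)] show ?thesis by (rule add_mono)
  qed
  also have "\<dots> = (\<integral>x. (norm (h x))\<^sup>2 \<partial>M)"
    using isq by (simp add: cmod_power2)
  also have "\<dots> \<le> (\<integral>x. (1 / Im z)\<^sup>2 \<partial>M)"
  proof (rule integral_mono)
    show "integrable M (\<lambda>x. (norm (h x))\<^sup>2)" using isq by (simp add: cmod_power2)
    show "(norm (h x))\<^sup>2 \<le> (1 / Im z)\<^sup>2" for x by (intro power_mono hB) simp
  qed simp
  also have "\<dots> = 1 / (Im z)\<^sup>2" by (simp add: prob_space power_divide)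
  finally show ?thesis .
qed

text \<open>From x / (x - z) = 1 + z / (x - z): the coefficients obey the recurrence of the
  polynomials up to the integral of p k, which is 1 for k = 0 and 0 otherwise.\<close>

lemma stieltjes_rec:
  assumes k: "Suc k \<le> n"
  shows "z * stieltjes M k z = a k * stieltjes M (Suc k) z + b k * stieltjes M k z + am k * stieltjes M (k - 1) z - (if k = 0 then 1 else 0)"
proof -
  have h: "has_bochner_integral M (\<lambda>x. of_real (p j x) / (of_real x - z)) (stieltjes M j z)" if "j \<le> n" for j
    using stieltjes_integrable[OF that] by (simp add: has_bochner_integral_iff stieltjes_def)
  have "has_bochner_integral M (\<lambda>x. of_real (p k x)) (of_real (if k = 0 then 1 else 0) :: complex)"
    by (intro has_bochner_integral_of_real integral_p) (use k in auto)
  then have "has_bochner_integral M (\<lambda>x. of_real (a k) * (of_real (p (Suc k) x) / (of_real x - z))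
     + of_real (b k) * (of_real (p k x) / (of_real x - z))
     + of_real (am k) * (of_real (p (k - 1) x) / (of_real x - z)) - of_real (p k x))
     (a k * stieltjes M (Suc k) z + b k * stieltjes M k z + am k * stieltjes M (k - 1) z - of_real (if k = 0 then 1 else 0))"
    by (intro has_bochner_integral_add has_bochner_integral_diff has_bochner_integral_mult_right h)
       (use k in auto)
  moreover have "of_real (a k) * (of_real (p (Suc k) x) / (of_real x - z))
     + of_real (b k) * (of_real (p k x) / (of_real x - z))
     + of_real (am k) * (of_real (p (k - 1) x) / (of_real x - z)) - of_real (p k x)
     = z * (of_real (p k x) / (of_real x - z))" for x
  proof -
    have "of_real (a k) * of_real (p (Suc k) x) + of_real (b k) * of_real (p k x)
       + of_real (am k) * of_real (p (k - 1) x) = of_real x * (of_real (p k x) :: complex)"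
      using arg_cong[OF p_rec[of x k], of complex_of_real] by simp
    moreover have "of_real x * (of_real (p k x) :: complex) / (of_real x - z) - of_real (p k x)
       = z * (of_real (p k x) / (of_real x - z))"
      using kernel_nz[of x] by (simp add: field_simps)
    ultimately show ?thesis by (simp add: add_divide_distrib[symmetric])
  qed
  ultimately have 1: "has_bochner_integral M (\<lambda>x. z * (of_real (p k x) / (of_real x - z)))
     (a k * stieltjes M (Suc k) z + b k * stieltjes M k z + am k * stieltjes M (k - 1) z - of_real (if k = 0 then 1 else 0))"
    by simp
  have "has_bochner_integral M (\<lambda>x. z * (of_real (p k x) / (of_real x - z))) (z * stieltjes M k z)"
    by (intro has_bochner_integral_mult_right h) (use k in auto)
  from has_bochner_integral_eq[OF this 1] show ?thesis by simp
qed

end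
end

lemma orthonormal_upto_mono: "orthonormal_upto n M \<Longrightarrow> m \<le> n \<Longrightarrow> orthonormal_upto m M"
  unfolding orthonormal_upto_def by auto

text \<open>Both coefficient sequences solve the same inhomogeneous recurrence, so that their difference is a
  multiple of the polynomials.\<close>

lemma stieltjes_difference:
  assumes M: "orthonormal_upto n M" and M': "orthonormal_upto n M'" and z: "Im z > 0" and k: "k \<le> n"
  shows "stieltjes M k z - stieltjes M' k z = (stieltjes M 0 z - stieltjes M' 0 z) * P k z"
  using k
proof (induction k rule: less_induct)
  case (less k)
  show ?case
  proof (cases k)
    case 0 then show ?thesis by simp
  next
    case (Suc j)
    let ?d = "\<lambda>k. stieltjes M k z - stieltjes M' k z"
    have dj: "?d j = ?d 0 * P j z" using less.IH[of j] less.prems Suc by simp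
    have dj1: "am j * ?d (j - 1) = am j * (?d 0 * P (j - 1) z)"
      using less.IH[of "j - 1"] less.prems Suc by (cases j) auto
    have "z * ?d j = a j * ?d (Suc j) + b j * ?d j + am j * ?d (j - 1)"
    proof -
      have le: "Suc j \<le> n" using less.prems Suc by simp
      show ?thesis
        unfolding right_diff_distrib[of z] stieltjes_rec[OF M z le] stieltjes_rec[OF M' z le]
        by (simp add: algebra_simps)
    qed
    then have "a j * ?d (Suc j) = ?d 0 * ((z - b j) * P j z - am j * P (j - 1) z)"
      unfolding dj dj1 by (simp add: algebra_simps)
    also have "\<dots> = a j * (?d 0 * P (Suc j) z)"
      using P_rec[of z j] by (simp add: algebra_simps)
    finally show ?thesis using Suc by simp
  qed
qed

text \<open>The coefficient differences are multiples of P k, and Bessel's inequality bounds their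
  square sum. A large sum of |P k|^2 thus forces the transforms together, as in the shrinking of
  Weyl's circles. The 4 comes from |u - v|^2 \<le> 2 |u|^2 + 2 |v|^2.\<close>

lemma stieltjes_difference_bound:
  assumes M: "orthonormal_upto n M" and M': "orthonormal_upto n M'" and z: "Im z > 0"
  shows "(norm (stieltjes M 0 z - stieltjes M' 0 z))\<^sup>2 * (\<Sum>k\<le>n. (norm (P k z))\<^sup>2) \<le> 4 / (Im z)\<^sup>2"
proof -
  have "(norm (stieltjes M 0 z - stieltjes M' 0 z))\<^sup>2 * (\<Sum>k\<le>n. (norm (P k z))\<^sup>2)
    = (\<Sum>k\<le>n. (norm (stieltjes M k z - stieltjes M' k z))\<^sup>2)"
    unfolding sum_distrib_left
  proof (intro sum.cong refl)
    fix k assume "k \<in> {..n}"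
    then have "k \<le> n" by simp
    from stieltjes_difference[OF M M' z this]
    show "(norm (stieltjes M 0 z - stieltjes M' 0 z))\<^sup>2 * (norm (P k z))\<^sup>2 = (norm (stieltjes M k z - stieltjes M' k z))\<^sup>2"
      by (simp only: norm_mult power_mult_distrib)
  qed
  also have "\<dots> \<le> (\<Sum>k\<le>n. 2 * (norm (stieltjes M k z))\<^sup>2 + 2 * (norm (stieltjes M' k z))\<^sup>2)"
  proof (intro sum_mono)
    fix k
    have "(norm (stieltjes M k z - stieltjes M' k z))\<^sup>2 \<le> (norm (stieltjes M k z) + norm (stieltjes M' k z))\<^sup>2"
      by (intro power_mono norm_triangle_ineq4) auto
    also have "\<dots> \<le> 2 * (norm (stieltjes M k z))\<^sup>2 + 2 * (norm (stieltjes M' k z))\<^sup>2"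
      using sum_squares_bound[of "norm (stieltjes M k z)" "norm (stieltjes M' k z)"] by (simp add: power2_sum)
    finally show "(norm (stieltjes M k z - stieltjes M' k z))\<^sup>2 \<le> 2 * (norm (stieltjes M k z))\<^sup>2 + 2 * (norm (stieltjes M' k z))\<^sup>2" .
  qed
  also have "\<dots> = 2 * (\<Sum>k\<le>n. (norm (stieltjes M k z))\<^sup>2) + 2 * (\<Sum>k\<le>n. (norm (stieltjes M' k z))\<^sup>2)"
    by (simp add: sum.distrib sum_distrib_left)
  also have "\<dots> \<le> 4 / (Im z)\<^sup>2"
    using bessel_stieltjes[OF M z] bessel_stieltjes[OF M' z] by simp
  finally show ?thesis .
qed

text \<open>P and the Fourier coefficients of the kernel have Wronskian -1, so 1 / a k is at most a
  sum of their squares at k and k + 1. The coefficients are square summable by Bessel; if P were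
  too, the series of 1 / a k would converge.\<close>

lemma carleman:
  assumes M: "\<And>n. orthonormal_upto n M" and z: "Im z > 0" and div: "\<not> summable (\<lambda>n. 1 / a n)"
  shows "\<not> summable (\<lambda>k. (norm (P k z))\<^sup>2)"
proof
  assume s: "summable (\<lambda>k. (norm (P k z))\<^sup>2)"
  let ?f = "\<lambda>k. stieltjes M k z"
  have sf: "summable (\<lambda>k. (norm (?f k))\<^sup>2)"
  proof (rule summableI_nonneg_bounded)
    fix n
    have "(\<Sum>k<n. (norm (?f k))\<^sup>2) \<le> (\<Sum>k\<le>n. (norm (?f k))\<^sup>2)" by (intro sum_mono2) auto
    then show "(\<Sum>k<n. (norm (?f k))\<^sup>2) \<le> 1 / (Im z)\<^sup>2"
      using bessel_stieltjes[OF M[of n] z] by (rule order_trans)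
  qed simp
  have w: "a k * (P (Suc k) z * ?f k - P k z * ?f (Suc k)) = -1" for k
  proof (induction k)
    case 0
    have "a 0 * P (Suc 0) z = z - b 0" by simp
    moreover have "a 0 * ?f (Suc 0) = (z - b 0) * ?f 0 + 1"
      using stieltjes_rec[OF M[of 1] z, of 0] by (simp add: algebra_simps)
    ultimately show ?case
      by (simp only: right_diff_distrib mult.assoc[symmetric] orth_poly_complex.simps(1)) (simp add: mult.commute)
  next
    case (Suc k)
    have "a (Suc k) * (P (Suc (Suc k)) z * ?f (Suc k) - P (Suc k) z * ?f (Suc (Suc k)))
      = (z * P (Suc k) z - b (Suc k) * P (Suc k) z - a k * P k z) * ?f (Suc k)
       - P (Suc k) z * (z * ?f (Suc k) - b (Suc k) * ?f (Suc k) - a k * ?f k)"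
    proof -
      have "a (Suc k) * P (Suc (Suc k)) z = z * P (Suc k) z - b (Suc k) * P (Suc k) z - a k * P k z"
        using P_rec[of z "Suc k"] by simp
      moreover have "a (Suc k) * ?f (Suc (Suc k)) = z * ?f (Suc k) - b (Suc k) * ?f (Suc k) - a k * ?f k"
        using stieltjes_rec[OF M[of "Suc (Suc k)"] z, of "Suc k"] by simp
      moreover have "a (Suc k) * (P (Suc (Suc k)) z * ?f (Suc k) - P (Suc k) z * ?f (Suc (Suc k)))
        = (a (Suc k) * P (Suc (Suc k)) z) * ?f (Suc k) - P (Suc k) z * (a (Suc k) * ?f (Suc (Suc k)))"
        by (simp add: algebra_simps)
      ultimately show ?thesis by (simp only:)
    qed
    also have "\<dots> = a k * (P (Suc k) z * ?f k - P k z * ?f (Suc k))" by (simp add: algebra_simps)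
    finally show ?case using Suc by simp
  qed
  have le: "1 / a k \<le> ((norm (P (Suc k) z))\<^sup>2 + (norm (?f k))\<^sup>2) + ((norm (P k z))\<^sup>2 + (norm (?f (Suc k)))\<^sup>2)" for k
  proof -
    have "1 / a k = norm (P (Suc k) z * ?f k - P k z * ?f (Suc k))"
    proof -
      have "a k * norm (P (Suc k) z * ?f k - P k z * ?f (Suc k)) = 1"
        using arg_cong[OF w[of k], of norm] a_pos[of k] by (simp only: norm_mult) simp
      then show ?thesis by (simp add: divide_eq_eq mult.commute)
    qed
    also have "\<dots> \<le> norm (P (Suc k) z) * norm (?f k) + norm (P k z) * norm (?f (Suc k))"
      using norm_triangle_ineq4 by (metis norm_mult)
    also have "\<dots> \<le> ((norm (P (Suc k) z))\<^sup>2 + (norm (?f k))\<^sup>2) + ((norm (P k z))\<^sup>2 + (norm (?f (Suc k)))\<^sup>2)"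
    proof -
      have aux: "x * y \<le> x\<^sup>2 + y\<^sup>2" if "x \<ge> 0" "y \<ge> 0" for x y :: real
        using sum_squares_bound[of x y] mult_nonneg_nonneg[OF that] by simp
      show ?thesis by (intro add_mono aux) auto
    qed
    finally show ?thesis .
  qed
  have sm: "summable (\<lambda>k. ((norm (P (Suc k) z))\<^sup>2 + (norm (?f k))\<^sup>2) + ((norm (P k z))\<^sup>2 + (norm (?f (Suc k)))\<^sup>2))"
  proof -
    have "summable (\<lambda>k. (norm (P (Suc k) z))\<^sup>2)"
      by (rule iffD2[OF summable_Suc_iff[of "\<lambda>k. (norm (P k z))\<^sup>2"] s])
    moreover have "summable (\<lambda>k. (norm (?f (Suc k)))\<^sup>2)"
      by (rule iffD2[OF summable_Suc_iff[of "\<lambda>k. (norm (?f k))\<^sup>2"] sf])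
    ultimately show ?thesis
      by (rule summable_add[OF summable_add[OF _ sf] summable_add[OF s]])
  qed
  have "summable (\<lambda>k. 1 / a k)"
  proof (rule summable_comparison_test'[OF sm])
    fix k
    have "norm (1 / a k) = 1 / a k" using a_pos[of k] by simp
    then show "norm (1 / a k) \<le> ((norm (P (Suc k) z))\<^sup>2 + (norm (?f k))\<^sup>2) + ((norm (P k z))\<^sup>2 + (norm (?f (Suc k)))\<^sup>2)"
      using le[of k] by (simp only:)
  qed
  with div show False by simp
qed

lemma stieltjes_convergence:
  assumes M: "\<And>n. orthonormal_upto n M" and M': "\<And>l. orthonormal_upto (s l) (M' l)"
    and s: "filterlim s at_top sequentially"
    and z: "Im z > 0" and div: "\<not> summable (\<lambda>n. 1 / a n)"
  shows "(\<lambda>l. stieltjes (M' l) 0 z) \<longlonglongrightarrow> stieltjes M 0 z"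
proof (rule tendstoI)
  fix e :: real assume e: "e > 0"
  \<comment> \<open>This n makes the bound on the squared difference of the transforms smaller than
    e^2, for every measure orthonormal up to n.\<close>
  have "\<exists>n. (\<Sum>k<n. (norm (P k z))\<^sup>2) > 4 / (Im z)\<^sup>2 / e\<^sup>2"
    using carleman[OF M z div] summableI_nonneg_bounded[of "\<lambda>k. (norm (P k z))\<^sup>2"]
    by (meson not_le zero_le_power2)
  then obtain n where n: "4 / (Im z)\<^sup>2 / e\<^sup>2 < (\<Sum>k<n. (norm (P k z))\<^sup>2)" by blast
  also have "\<dots> \<le> (\<Sum>k\<le>n. (norm (P k z))\<^sup>2)" by (intro sum_mono2) auto
  finally have S: "4 / (Im z)\<^sup>2 < e\<^sup>2 * (\<Sum>k\<le>n. (norm (P k z))\<^sup>2)"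
    using e by (subst (asm) pos_divide_less_eq) (simp_all add: mult.commute)
  have "\<forall>\<^sub>F l in sequentially. n \<le> s l" using s by (simp add: filterlim_at_top)
  then show "\<forall>\<^sub>F l in sequentially. dist (stieltjes (M' l) 0 z) (stieltjes M 0 z) < e"
  proof eventually_elim
    case (elim l)
    have "(norm (stieltjes (M' l) 0 z - stieltjes M 0 z))\<^sup>2 * (\<Sum>k\<le>n. (norm (P k z))\<^sup>2) \<le> 4 / (Im z)\<^sup>2"
      by (rule stieltjes_difference_bound[OF orthonormal_upto_mono[OF M'[of l] elim] M z])
    also note S
    finally have "(norm (stieltjes (M' l) 0 z - stieltjes M 0 z))\<^sup>2 < e\<^sup>2"
      by (rule mult_right_less_imp_less) (auto intro: sum_nonneg)
    then show ?case using e by (simp add: dist_norm power_less_imp_less_base)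
  qed
qed

end

section \<open>Stieltjes inversion\<close>

context real_distribution
begin

lemma poisson_kernel_nn_integral:
  fixes y c x :: real
  assumes y: "y > 0"
  shows "(\<integral>\<^sup>+t. ennreal (y / ((x - t)\<^sup>2 + y\<^sup>2)) * indicator {c..} t \<partial>lborel)
    = ennreal (pi / 2 - arctan ((c - x) / y))"
proof (rule nn_integral_FTC_atLeast)
  show "DERIV (\<lambda>t. arctan ((t - x) / y)) t :> y / ((x - t)\<^sup>2 + y\<^sup>2)" for t
  proof -
    have "0 < (x - t)\<^sup>2 + y\<^sup>2" using y by (intro add_nonneg_pos) auto
    moreover have "1 + ((t - x) / y)\<^sup>2 = ((x - t)\<^sup>2 + y\<^sup>2) / y\<^sup>2"
      using y by (simp add: power_divide field_simps power2_commute)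
    ultimately have "inverse (1 + ((t - x) / y)\<^sup>2) * (1 / y) = y / ((x - t)\<^sup>2 + y\<^sup>2)"
      using y by (simp add: power2_eq_square)
    moreover have "DERIV (\<lambda>t. arctan ((t - x) / y)) t :> inverse (1 + ((t - x) / y)\<^sup>2) * (1 / y)"
      using y by (auto intro!: derivative_eq_intros simp: divide_inverse)
    ultimately show ?thesis by simp
  qed
  show "((\<lambda>t. arctan ((t - x) / y)) \<longlongrightarrow> pi / 2) at_top"
  proof (rule filterlim_compose[OF tendsto_arctan_at_top])
    show "filterlim (\<lambda>t. (t - x) / y) at_top at_top"
      using y by real_asymp
  qed
qed (use y in \<open>auto intro!: divide_nonneg_nonneg\<close>)

lemma poisson_nn_integral:
  assumes y: "y > 0"
  shows "(\<integral>\<^sup>+x. ennreal (y / ((x - t)\<^sup>2 + y\<^sup>2)) \<partial>M) = ennreal (Im (\<integral>x. 1 / (of_real x - Complex t y) \<partial>M))"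
proof -
  let ?h = "\<lambda>x. 1 / (complex_of_real x - Complex t y)"
  have nz: "complex_of_real x - Complex t y \<noteq> 0" for x using y by (auto simp: complex_eq_iff)
  have "?h \<in> borel_measurable borel"
    by (intro borel_measurable_continuous_onI continuous_intros) (use nz in auto)
  then have i: "integrable M ?h"
  proof (intro integrable_const_bound[where B = "1 / y"] AE_I2)
    fix x
    have "y \<le> norm (complex_of_real x - Complex t y)"
      using abs_Im_le_cmod[of "complex_of_real x - Complex t y"] y by simp
    then show "norm (?h x) \<le> 1 / y" using y by (simp add: norm_divide frac_le)
  qed auto
  have Im: "Im (?h x) = y / ((x - t)\<^sup>2 + y\<^sup>2)" for x
    by (simp add: Im_divide)
  have "integrable M (\<lambda>x. Im (?h x))" using i by simp
  then have "(\<integral>\<^sup>+x. ennreal (Im (?h x)) \<partial>M) = ennreal (\<integral>x. Im (?h x) \<partial>M)"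
    by (rule nn_integral_eq_integral) (use y in \<open>auto simp: Im intro!: AE_I2 divide_nonneg_nonneg\<close>)
  then show ?thesis using i unfolding Im by (simp flip: Im)
qed

text \<open>Fubini for the Poisson kernel over the half line from c: the left side integrates a
  smoothed indicator, while the right side depends on the Stieltjes transform alone.\<close>

lemma arctan_integral:
  assumes y: "y > 0"
  shows "(\<integral>\<^sup>+x. ennreal (pi / 2 - arctan ((c - x) / y)) \<partial>M)
    = (\<integral>\<^sup>+t. ennreal (Im (\<integral>x. 1 / (of_real x - Complex t y) \<partial>M)) * indicator {c..} t \<partial>lborel)"
proof -
  interpret pair_sigma_finite M lborel ..
  have "(\<integral>\<^sup>+x. ennreal (pi / 2 - arctan ((c - x) / y)) \<partial>M)
    = (\<integral>\<^sup>+x. \<integral>\<^sup>+t. ennreal (y / ((x - t)\<^sup>2 + y\<^sup>2)) * indicator {c..} t \<partial>lborel \<partial>M)"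
    by (simp add: poisson_kernel_nn_integral[OF y])
  also have "\<dots> = (\<integral>\<^sup>+t. \<integral>\<^sup>+x. ennreal (y / ((x - t)\<^sup>2 + y\<^sup>2)) * indicator {c..} t \<partial>M \<partial>lborel)"
    by (rule Fubini'[symmetric]) measurable
  also have "\<dots> = (\<integral>\<^sup>+t. (\<integral>\<^sup>+x. ennreal (y / ((x - t)\<^sup>2 + y\<^sup>2)) \<partial>M) * indicator {c..} t \<partial>lborel)"
    by (intro nn_integral_cong nn_integral_multc) measurable
  finally show ?thesis unfolding poisson_nn_integral[OF y] .
qed

text \<open>The boundary is shifted by 1 / (n + 1), while the height 1 / (n + 1)^2 is smaller. Even
  at x = c the quotient tends to infinity, so an atom at c gets weight 0 and the distribution
  function is recovered at every point, not only at points of continuity.\<close>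

lemma arctan_integral_limit:
  "(\<lambda>n. \<integral>x. (pi / 2 - arctan ((c + 1 / real (Suc n) - x) / (1 / real (Suc n) ^ 2))) \<partial>M) \<longlonglongrightarrow> pi * (1 - cdf M c)"
proof -
  have "(\<lambda>n. \<integral>x. (pi / 2 - arctan ((c + 1 / real (Suc n) - x) / (1 / real (Suc n) ^ 2))) \<partial>M)
     \<longlonglongrightarrow> (\<integral>x. pi * indicator {c<..} x \<partial>M)"
  proof (rule integral_dominated_convergence[where w = "\<lambda>_. pi"])
    show "AE x in M. (\<lambda>n. pi / 2 - arctan ((c + 1 / real (Suc n) - x) / (1 / real (Suc n) ^ 2)))
       \<longlonglongrightarrow> pi * indicator {c<..} x"
    proof (rule AE_I2)
      fix x
      show "(\<lambda>n. pi / 2 - arctan ((c + 1 / real (Suc n) - x) / (1 / real (Suc n) ^ 2)))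
         \<longlonglongrightarrow> pi * indicator {c<..} x"
      proof (cases "x > c")
        case True
        have "filterlim (\<lambda>n. (c + 1 / real (Suc n) - x) / (1 / real (Suc n) ^ 2)) at_bot sequentially"
          using True by real_asymp
        from tendsto_diff[OF tendsto_const filterlim_compose[OF tendsto_arctan_at_bot this], of "pi / 2"]
        show ?thesis using True by simp
      next
        case False
        have "filterlim (\<lambda>n. (c + 1 / real (Suc n) - x) / (1 / real (Suc n) ^ 2)) at_top sequentially"
        proof (cases "x = c")
          case True
          show ?thesis unfolding True by real_asymp
        next
          case False
          with \<open>\<not> x > c\<close> have "x < c" by simp
          then show ?thesis by real_asymp
        qed
        from tendsto_diff[OF tendsto_const filterlim_compose[OF tendsto_arctan_at_top this], of "pi / 2"]
        show ?thesis using False by simp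
      qed
    qed
    show "AE x in M. norm (pi / 2 - arctan ((c + 1 / real (Suc n) - x) / (1 / real (Suc n) ^ 2))) \<le> pi" for n
    proof (rule AE_I2)
      fix x
      show "norm (pi / 2 - arctan ((c + 1 / real (Suc n) - x) / (1 / real (Suc n) ^ 2))) \<le> pi"
        using arctan_bounded[of "(c + 1 / real (Suc n) - x) / (1 / real (Suc n) ^ 2)"]
        by (simp del: of_nat_Suc)
    qed
  qed auto
  moreover have "measure M {c<..} = 1 - cdf M c"
    using prob_compl[of "{..c}"] by (simp add: cdf_def Compl_eq_Diff_UNIV[symmetric] Compl_atMost)
  ultimately show ?thesis by simp
qed

end

lemma stieltjes_unique:
  assumes M: "real_distribution M" and M': "real_distribution M'"
    and eq: "\<And>z. Im z > 0 \<Longrightarrow> (\<integral>x. 1 / (of_real x - z) \<partial>M) = (\<integral>x. 1 / (of_real x - z) \<partial>M')"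
  shows "M = M'"
proof (rule cdf_unique[OF M M'], rule ext)
  fix c
  interpret M: real_distribution M by (rule M)
  interpret M': real_distribution M' by (rule M')
  have A: "(\<integral>x. (pi / 2 - arctan ((d - x) / y)) \<partial>M) = (\<integral>x. (pi / 2 - arctan ((d - x) / y)) \<partial>M')"
    if y: "y > 0" for d y
  proof -
    have nn: "0 \<le> pi / 2 - arctan u" for u using arctan_bounded[of u] by simp
    have "(\<integral>\<^sup>+x. ennreal (pi / 2 - arctan ((d - x) / y)) \<partial>M) = (\<integral>\<^sup>+x. ennreal (pi / 2 - arctan ((d - x) / y)) \<partial>M')"
      unfolding M.arctan_integral[OF y] M'.arctan_integral[OF y]
      using eq y by simp
    then show ?thesis
      by (subst (1 2) integral_eq_nn_integral) (auto intro!: AE_I2 nn simp del: diff_ge_0_iff_ge)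
  qed
  have "(\<integral>x. (pi / 2 - arctan ((c + 1 / real (Suc n) - x) / (1 / real (Suc n) ^ 2))) \<partial>M)
    = (\<integral>x. (pi / 2 - arctan ((c + 1 / real (Suc n) - x) / (1 / real (Suc n) ^ 2))) \<partial>M')" for n
    by (rule A) simp
  then have "(\<lambda>n. \<integral>x. (pi / 2 - arctan ((c + 1 / real (Suc n) - x) / (1 / real (Suc n) ^ 2))) \<partial>M) \<longlonglongrightarrow> pi * (1 - cdf M' c)"
    using M'.arctan_integral_limit[of c] by (simp only:)
  from LIMSEQ_unique[OF M.arctan_integral_limit this] show "cdf M c = cdf M' c" by simp
qed

section \<open>Tightness and weak convergence\<close>

context jacobi
begin

lemma orthonormal_real_distribution: "orthonormal_upto n M \<Longrightarrow> real_distribution M"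
  by (simp add: real_distribution_def real_distribution_axioms_def orthonormal_upto_def)

text \<open>x is a combination of p 1 and p 0, so its second moment is the same for all measures
  orthonormal up to 1; tightness follows.\<close>

lemma second_moment:
  assumes M: "orthonormal_upto n M" and n: "n \<ge> 1"
  shows "has_bochner_integral M (\<lambda>x. x\<^sup>2) ((a 0)\<^sup>2 + (b 0)\<^sup>2)"
proof -
  have "has_bochner_integral M
    (\<lambda>x. (a 0)\<^sup>2 * (p 1 x * p 1 x) + 2 * a 0 * b 0 * (p 1 x * p 0 x) + (b 0)\<^sup>2 * (p 0 x * p 0 x))
    ((a 0)\<^sup>2 * (if 1 = (1::nat) then 1 else 0) + 2 * a 0 * b 0 * (if 1 = (0::nat) then 1 else 0) + (b 0)\<^sup>2 * (if 0 = (0::nat) then 1 else 0))"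
    by (intro has_bochner_integral_add has_bochner_integral_mult_right orthonormal_integral[OF M]) (use n in auto)
  moreover have "(a 0)\<^sup>2 * (p 1 x * p 1 x) + 2 * a 0 * b 0 * (p 1 x * p 0 x) + (b 0)\<^sup>2 * (p 0 x * p 0 x) = x\<^sup>2" for x
  proof -
    have "a 0 * p 1 x + b 0 = x" using p_rec[of x 0] by simp
    then have "x\<^sup>2 = (a 0 * p 1 x + b 0)\<^sup>2" by simp
    then show ?thesis by (simp add: power2_eq_square algebra_simps)
  qed
  ultimately show ?thesis by simp
qed

lemma orthonormal_tight:
  assumes M: "\<And>l. orthonormal_upto (s l) (M l)" and s: "\<And>l. s l \<ge> 1"
  shows "tight M"
  unfolding tight_def
proof (intro conjI allI impI)
  show "real_distribution (M n)" for n by (rule orthonormal_real_distribution[OF M])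
  fix e :: real assume e: "e > 0"
  define V where "V = (a 0)\<^sup>2 + (b 0)\<^sup>2"
  have V: "V > 0" unfolding V_def by (intro add_pos_nonneg) auto
  \<comment> \<open>Chebyshev's inequality: the mass outside the interval is at most V / R^2 = e /
    2.\<close>
  define R where "R = sqrt (2 * V / e)"
  have R: "R > 0" "V / R\<^sup>2 < e" using V e by (auto simp: R_def field_simps)
  have "1 - e < measure (M n) {-R<..R}" for n
  proof -
    interpret real_distribution "M n" by (rule orthonormal_real_distribution[OF M])
    have h: "has_bochner_integral (M n) (\<lambda>x. x\<^sup>2) V" unfolding V_def by (rule second_moment[OF M s])
    have "measure (M n) (UNIV - {-R<..R}) = (\<integral>x. indicator (UNIV - {-R<..R}) x \<partial>M n)" by simp
    also have "\<dots> \<le> (\<integral>x. x\<^sup>2 / R\<^sup>2 \<partial>M n)"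
    proof (rule integral_mono)
      show "integrable (M n) (\<lambda>x. x\<^sup>2 / R\<^sup>2)" using h by (auto simp: has_bochner_integral_iff)
      fix x
      show "indicator (UNIV - {-R<..R}) x \<le> x\<^sup>2 / R\<^sup>2"
      proof (cases "x \<in> {-R<..R}")
        case False
        then have "R \<le> \<bar>x\<bar>" by auto
        then have "R\<^sup>2 \<le> x\<^sup>2" using R(1) abs_le_square_iff[of R x] by simp
        then show ?thesis using R(1) by (simp add: indicator_def)
      qed (simp add: indicator_def)
    qed (auto simp: less_top[symmetric] emeasure_eq_measure)
    also have "\<dots> = V / R\<^sup>2" using h by (simp add: has_bochner_integral_iff)
    also have "\<dots> < e" by (rule R)
    finally have "measure (M n) (UNIV - {-R<..R}) < e" .
    then show ?thesis using prob_compl[of "{-R<..R}"] by simp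
  qed
  then show "\<exists>a b. a < b \<and> (\<forall>n. 1 - e < measure (M n) {a<..b})"
    using R(1) by (intro exI[of _ "-R"] exI[of _ R]) auto
qed

text \<open>A subsequential limit \<nu> is compared with M through Stieltjes transforms, since weak
  convergence controls bounded test functions but not the moments of \<nu>.\<close>

theorem orthonormal_weak_convergence:
  assumes M: "\<And>n. orthonormal_upto n M" and M': "\<And>l. orthonormal_upto (s l) (M' l)"
    and s: "filterlim s at_top sequentially" "\<And>l. s l \<ge> 1"
    and div: "\<not> summable (\<lambda>n. 1 / a n)"
  shows "weak_conv_m M' M"
proof (rule tight_subseq_weak_converge)
  show "real_distribution (M' n)" for n by (rule orthonormal_real_distribution[OF M'])
  show "real_distribution M" by (rule orthonormal_real_distribution[OF M])
  show "tight M'" by (rule orthonormal_tight[OF M' s(2)])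
  fix r \<nu> assume r: "strict_mono r" and \<nu>: "real_distribution \<nu>" and w: "weak_conv_m (M' \<circ> r) \<nu>"
  have "M = \<nu>"
  proof (rule stieltjes_unique[OF orthonormal_real_distribution[OF M] \<nu>])
    fix z assume z: "Im z > 0"
    let ?h = "\<lambda>x. 1 / (complex_of_real x - z)"
    have nz: "complex_of_real x - z \<noteq> 0" for x using z by (auto simp: complex_eq_iff)
    have st: "stieltjes N 0 z = integral\<^sup>L N ?h" for N by (simp add: stieltjes_def)
    have "(\<lambda>l. integral\<^sup>L ((M' \<circ> r) l) ?h) \<longlonglongrightarrow> integral\<^sup>L \<nu> ?h"
    proof (rule weak_conv_imp_integral_bdd_continuous_conv)
      show "real_distribution ((M' \<circ> r) n)" for n by (simp add: orthonormal_real_distribution[OF M'])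
      show "isCont ?h x" for x using nz by (intro continuous_intros) auto
      show "norm (?h x) \<le> 1 / Im z" for x by (rule kernel_bound[OF M z])
    qed (use \<nu> w in \<open>simp_all add: o_def\<close>)
    moreover have "(\<lambda>l. integral\<^sup>L ((M' \<circ> r) l) ?h) \<longlonglongrightarrow> integral\<^sup>L M ?h"
      using LIMSEQ_subseq_LIMSEQ[OF stieltjes_convergence[OF M M' s(1) z div] r]
      by (simp add: st o_def)
    ultimately show "integral\<^sup>L M ?h = integral\<^sup>L \<nu> ?h" using LIMSEQ_unique by blast
  qed
  then show "weak_conv_m (M' \<circ> r) M" using w by simp
qed

end

section \<open>Uniform limits and weighted averages\<close>

lemma uniform_limit_Pair:
  assumes "uniform_limit K f l F" "uniform_limit K g m F"
  shows "uniform_limit K (\<lambda>n t. (f n t, g n t)) (\<lambda>t. (l t, m t)) F"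
proof (rule uniform_limitI)
  fix e :: real assume e: "e > 0"
  have "\<forall>\<^sub>F n in F. \<forall>t\<in>K. dist (f n t) (l t) < e / 2" "\<forall>\<^sub>F n in F. \<forall>t\<in>K. dist (g n t) (m t) < e / 2"
    using uniform_limitD[OF assms(1), of "e / 2"] uniform_limitD[OF assms(2), of "e / 2"] e by auto
  then show "\<forall>\<^sub>F n in F. \<forall>t\<in>K. dist (f n t, g n t) (l t, m t) < e"
  proof eventually_elim
    case (elim n)
    show ?case
    proof
      fix t assume "t \<in> K"
      then have "dist (f n t) (l t) < e / 2" "dist (g n t) (m t) < e / 2" using elim by auto
      then show "dist (f n t, g n t) (l t, m t) < e"
        unfolding dist_Pair_Pair using sqrt_sum_squares_le_sum[of "dist (f n t) (l t)" "dist (g n t) (m t)"] by simp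
    qed
  qed
qed

text \<open>The compact image of \<open>l\<close> has a compact neighbourhood inside
  \<open>U\<close>. It eventually contains all values of \<open>f\<close>, and \<open>h\<close> is
  uniformly continuous on it.\<close>

lemma uniform_limit_continuous_compose:
  fixes l :: "'a::topological_space \<Rightarrow> 'b::heine_borel" and h :: "'b \<Rightarrow> 'c::metric_space"
  assumes K: "compact K" and l: "continuous_on K l" and lim: "uniform_limit K f l F"
    and U: "open U" "l ` K \<subseteq> U" and h: "continuous_on U h"
  shows "uniform_limit K (\<lambda>n t. h (f n t)) (\<lambda>t. h (l t)) F"
proof (cases "K = {}")
  case True then show ?thesis by simp
next
  case False
  have c: "compact (l ` K)" using l K by (rule compact_continuous_image)
  obtain e where e: "e > 0" "(\<Union>x\<in>l ` K. cball x e) \<subseteq> U"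
    using compact_subset_open_imp_cball_epsilon_subset[OF c U] .
  define B where "B = {x. infdist x (l ` K) \<le> e / 2}"
  have B: "compact B"
    unfolding B_def using c e False by (intro compact_infdist_le) auto
  have "B \<subseteq> U"
  proof
    fix x assume "x \<in> B"
    then have "infdist x (l ` K) \<le> e / 2" by (simp add: B_def)
    moreover obtain y where "y \<in> l ` K" "infdist x (l ` K) = dist x y"
      using infdist_attains_inf[of "l ` K" x] c False compact_imp_closed by auto
    ultimately have "x \<in> cball y e" "y \<in> l ` K" using e by (auto simp: dist_commute)
    then show "x \<in> U" using e by blast
  qed
  then have "continuous_on B h" using h continuous_on_subset by blast
  then have uc: "uniformly_continuous_on B h" using B compact_uniformly_continuous by blast
  have ev: "\<forall>\<^sub>F n in F. \<forall>t\<in>K. f n t \<in> B"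
    using uniform_limitD[OF lim, of "e / 2"] e
  proof (simp, elim eventually_mono, intro ballI)
    fix n t assume a: "\<forall>t\<in>K. dist (f n t) (l t) * 2 < e" and t: "t \<in> K"
    have "infdist (f n t) (l ` K) \<le> dist (f n t) (l t)" using t by (intro infdist_le) auto
    then show "f n t \<in> B" using a t unfolding B_def by force
  qed
  show ?thesis
    by (rule uniform_limit_compose_uniformly_continuous_on[OF lim uc ev compact_imp_closed[OF B]])
qed

lemma uniform_limit_of_real_const: "(f \<longlongrightarrow> c) F \<Longrightarrow> uniform_limit K (\<lambda>n t. f n) (\<lambda>t. c) F"
  unfolding uniform_limit_iff tendsto_iff by (fast elim: eventually_mono)

text \<open>Logarithms turn the relative increments into a series dominated by 2 \<eta>, to which
  the Weierstrass test applies; exponentiating back makes the limit positive.\<close>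

lemma perturbed_product_limit:
  fixes G :: "nat \<Rightarrow> real \<Rightarrow> real"
  assumes K: "compact K" and s: "summable \<eta>"
    and cont: "\<forall>\<^sub>F n in sequentially. continuous_on K (G n)"
    and pos: "\<forall>\<^sub>F n in sequentially. \<forall>t\<in>K. G n t > 0"
    and step: "\<forall>\<^sub>F n in sequentially. \<forall>t\<in>K. \<bar>G (Suc n) t - G n t\<bar> \<le> \<eta> n * G n t"
  shows "\<exists>g. continuous_on K g \<and> (\<forall>t\<in>K. g t > 0) \<and> uniform_limit K G g sequentially"
proof -
  have "\<eta> \<longlonglongrightarrow> 0" using s by (rule summable_LIMSEQ_zero)
  then have "\<forall>\<^sub>F n in sequentially. \<eta> n < 1 / 2" by (rule order_tendstoD) simp
  with cont pos step have "\<forall>\<^sub>F n in sequentially. continuous_on K (G n) \<and> (\<forall>t\<in>K. G n t > 0)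
      \<and> (\<forall>t\<in>K. \<bar>G (Suc n) t - G n t\<bar> \<le> \<eta> n * G n t) \<and> \<eta> n < 1 / 2"
    by eventually_elim blast
  then obtain N where N: "\<And>n. n \<ge> N \<Longrightarrow> continuous_on K (G n) \<and> (\<forall>t\<in>K. G n t > 0)
      \<and> (\<forall>t\<in>K. \<bar>G (Suc n) t - G n t\<bar> \<le> \<eta> n * G n t) \<and> \<eta> n < 1 / 2"
    unfolding eventually_sequentially by blast
  define L where "L n t = ln (G (n + N) t)" for n t
  have Lc: "continuous_on K (L n)" for n
    unfolding L_def using N[of "n + N"] by (intro continuous_intros) (auto simp: less_imp_neq[symmetric])
  have dL: "norm (L (Suc n) t - L n t) \<le> 2 * \<eta> (n + N)" if t: "t \<in> K" for n t
  proof -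
    have p: "G (n + N) t > 0" "G (Suc n + N) t > 0" using N[of "n + N"] N[of "Suc n + N"] t by auto
    define u where "u = G (Suc n + N) t / G (n + N) t - 1"
    have "u = (G (Suc n + N) t - G (n + N) t) / G (n + N) t"
      using p by (simp add: u_def diff_divide_distrib)
    then have "\<bar>u\<bar> = \<bar>G (Suc n + N) t - G (n + N) t\<bar> / G (n + N) t"
      using p by (simp add: abs_divide)
    also have "\<dots> \<le> \<eta> (n + N)" using N[of "n + N"] t p by (simp add: divide_le_eq)
    finally have u: "\<bar>u\<bar> \<le> \<eta> (n + N)" .
    then have "\<bar>u\<bar> \<le> 1 / 2" using N[of "n + N"] by simp
    then have "\<bar>ln (1 + u) - u\<bar> \<le> 2 * u\<^sup>2" by (rule abs_ln_one_plus_x_minus_x_bound)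
    moreover have "2 * u\<^sup>2 \<le> \<bar>u\<bar>"
    proof -
      have "\<bar>u\<bar> * \<bar>u\<bar> \<le> (1 / 2) * \<bar>u\<bar>" by (rule mult_right_mono[OF \<open>\<bar>u\<bar> \<le> 1 / 2\<close>]) simp
      then show ?thesis by (simp add: power2_eq_square)
    qed
    ultimately have "\<bar>ln (1 + u)\<bar> \<le> 2 * \<bar>u\<bar>" by linarith
    moreover have "L (Suc n) t - L n t = ln (1 + u)"
      using p by (simp add: L_def u_def ln_div)
    ultimately show ?thesis using u by simp
  qed
  have "summable (\<lambda>n. \<eta> (n + N))" using s by (rule summable_ignore_initial_segment)
  then have sm: "summable (\<lambda>n. 2 * \<eta> (n + N))" by (rule summable_mult)
  define S where "S t = (\<Sum>n. L (Suc n) t - L n t)" for t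
  have "uniform_limit K (\<lambda>n t. \<Sum>i<n. (L (Suc i) t - L i t)) S sequentially"
    unfolding S_def by (rule Weierstrass_m_test[OF dL sm])
  moreover have "(\<Sum>i<n. (L (Suc i) t - L i t)) = L n t - L 0 t" for n t
    using sum_lessThan_telescope[of "\<lambda>i. L i t" n] by simp
  ultimately have UL: "uniform_limit K (\<lambda>n t. L n t - L 0 t) S sequentially" by simp
  have "uniform_limit K (\<lambda>n t. (L n t - L 0 t) + L 0 t) (\<lambda>t. S t + L 0 t) sequentially"
    by (intro uniform_limit_add UL uniform_limit_const)
  then have UL': "uniform_limit K L (\<lambda>t. S t + L 0 t) sequentially" by simp
  have Sc: "continuous_on K (\<lambda>t. S t + L 0 t)"
    by (rule uniform_limit_theorem[OF _ UL']) (auto simp: Lc)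
  have "uniform_limit K (\<lambda>n t. exp (L n t)) (\<lambda>t. exp (S t + L 0 t)) sequentially"
    by (rule uniform_limit_continuous_compose[OF K Sc UL', of UNIV]) (auto intro!: continuous_intros)
  then have "uniform_limit K (\<lambda>n t. G (n + N) t) (\<lambda>t. exp (S t + L 0 t)) sequentially"
  proof (rule uniform_limit_cong[THEN iffD1, rotated 2])
    show "\<forall>\<^sub>F n in sequentially. \<forall>t\<in>K. exp (L n t) = G (n + N) t"
      using N by (intro always_eventually) (auto simp: L_def)
  qed simp
  then have "uniform_limit K G (\<lambda>t. exp (S t + L 0 t)) sequentially"
    unfolding uniform_limit_iff
    using eventually_sequentially_seg[of "\<lambda>n. \<forall>x\<in>K. dist (G n x) (exp (S x + L 0 x)) < e" N for e]
    by blast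
  then show ?thesis using Sc by (intro exI[of _ "\<lambda>t. exp (S t + L 0 t)"]) (auto intro!: continuous_intros)
qed

section \<open>Averages with divergent weights\<close>

context
  fixes w :: "nat \<Rightarrow> real"
  assumes w_pos: "\<And>n. w n > 0" and div: "filterlim (\<lambda>n. \<Sum>j<n. w j) at_top sequentially"
begin

text \<open>Toeplitz averaging: a finite initial segment, bounded on K, is swamped by the diverging
  total weight.\<close>

lemma weighted_average_null:
  fixes e :: "nat \<Rightarrow> 'b \<Rightarrow> 'a::real_normed_vector"
  assumes lim: "uniform_limit K e (\<lambda>t. 0) sequentially"
    and bd: "\<And>n. bounded (e n ` K)"
  shows "uniform_limit K (\<lambda>n t. inverse (\<Sum>j<n. w j) *\<^sub>R (\<Sum>j<n. w j *\<^sub>R e j t)) (\<lambda>t. 0) sequentially"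
proof (rule uniform_limitI)
  fix \<epsilon> :: real assume \<epsilon>: "\<epsilon> > 0"
  have "\<forall>\<^sub>F n in sequentially. \<forall>t\<in>K. dist (e n t) 0 < \<epsilon> / 2"
    using lim \<epsilon> by (intro uniform_limitD) auto
  then obtain N where N: "\<And>n t. n \<ge> N \<Longrightarrow> t \<in> K \<Longrightarrow> norm (e n t) < \<epsilon> / 2"
    by (auto simp: eventually_sequentially)
  have "\<forall>n. \<exists>B. \<forall>t\<in>K. norm (e n t) \<le> B" using bd by (auto simp: bounded_iff)
  then obtain B where B: "\<And>n t. t \<in> K \<Longrightarrow> norm (e n t) \<le> B n" by metis
  define C where "C = (\<Sum>j<N. w j * \<bar>B j\<bar>)"
  \<comment> \<open>From here on the initial segment contributes less than \<epsilon> / 2; the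
    choice of N bounds the rest by \<epsilon> / 2.\<close>
  have "\<forall>\<^sub>F n in sequentially. (\<Sum>j<n. w j) > 2 * C / \<epsilon>"
    using div by (simp add: filterlim_at_top_dense)
  moreover have "\<forall>\<^sub>F n in sequentially. (\<Sum>j<n. w j) > 0"
    using div by (simp add: filterlim_at_top_dense)
  ultimately show "\<forall>\<^sub>F n in sequentially. \<forall>t\<in>K. dist (inverse (\<Sum>j<n. w j) *\<^sub>R (\<Sum>j<n. w j *\<^sub>R e j t)) 0 < \<epsilon>"
    using eventually_ge_at_top[of N]
  proof eventually_elim
    case (elim n)
    show ?case
    proof
      fix t assume t: "t \<in> K"
      let ?W = "\<Sum>j<n. w j"
      have "norm (\<Sum>j<n. w j *\<^sub>R e j t) \<le> (\<Sum>j<n. w j * norm (e j t))"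
        using w_pos by (intro order_trans[OF norm_sum] sum_mono) (simp add: less_imp_le)
      also have "\<dots> = (\<Sum>j<N. w j * norm (e j t)) + (\<Sum>j=N..<n. w j * norm (e j t))"
        using elim by (simp add: sum.atLeastLessThan_concat lessThan_atLeast0)
      also have "\<dots> \<le> C + (\<Sum>j=N..<n. w j * (\<epsilon> / 2))"
        unfolding C_def using w_pos N t B
        by (intro add_mono sum_mono mult_left_mono) (auto simp: less_imp_le intro: order_trans[OF B[OF t] abs_ge_self])
      also have "(\<Sum>j=N..<n. w j * (\<epsilon> / 2)) \<le> ?W * (\<epsilon> / 2)"
        unfolding sum_distrib_right using w_pos \<epsilon> by (intro sum_mono2) (auto simp: less_imp_le)
      also have "C + ?W * (\<epsilon> / 2) < ?W * \<epsilon>"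
        using elim \<epsilon> by (simp add: field_simps)
      finally show "dist (inverse ?W *\<^sub>R (\<Sum>j<n. w j *\<^sub>R e j t)) 0 < \<epsilon>"
        using elim by (simp add: field_simps)
    qed
  qed
qed

text \<open>Averaging the null sequence \<open>w (Suc n) / w n - 1\<close> telescopes to w n - w 0
  over the total weight.\<close>

lemma weight_over_sum_null:
  assumes ratio: "(\<lambda>n. w (Suc n) / w n) \<longlonglongrightarrow> 1"
  shows "(\<lambda>n. w n / (\<Sum>j<n. w j)) \<longlonglongrightarrow> 0"
proof -
  let ?e = "\<lambda>n (t::real). w (Suc n) / w n - 1"
  have "uniform_limit {0} ?e (\<lambda>t. 0) sequentially"
    using ratio by (intro uniform_limit_of_real_const) (simp add: LIM_zero)
  then have "uniform_limit {0} (\<lambda>n t. inverse (\<Sum>j<n. w j) *\<^sub>R (\<Sum>j<n. w j *\<^sub>R ?e j t)) (\<lambda>t. 0) sequentially"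
    by (rule weighted_average_null) auto
  moreover have "(\<Sum>j<n. w j *\<^sub>R (w (Suc j) / w j - 1)) = w n - w 0" for n
  proof -
    have "w j * (w (Suc j) / w j - 1) = w (Suc j) - w j" for j using w_pos[of j] by (simp add: field_simps)
    then show ?thesis by (simp add: sum_lessThan_telescope)
  qed
  ultimately have "(\<lambda>n. (w n - w 0) / (\<Sum>j<n. w j)) \<longlonglongrightarrow> 0"
    by (simp add: divide_inverse mult.commute)
  moreover have "(\<lambda>n. w 0 / (\<Sum>j<n. w j)) \<longlonglongrightarrow> 0"
    using div by (rule real_tendsto_divide_at_top[OF tendsto_const])
  ultimately have "(\<lambda>n. (w n - w 0) / (\<Sum>j<n. w j) + w 0 / (\<Sum>j<n. w j)) \<longlonglongrightarrow> 0 + 0"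
    by (rule tendsto_add)
  then show ?thesis by (simp add: add_divide_distrib[symmetric])
qed

text \<open>Summation by parts: up to a telescoping sum and a null sequence, the weighted sum of an
  almost rotating sequence is annihilated by the factor 1 - \<kappa>.\<close>

lemma rotating_average_null:
  fixes S :: "nat \<Rightarrow> 'b \<Rightarrow> complex"
  assumes ratio: "(\<lambda>n. w (Suc n) / w n) \<longlonglongrightarrow> 1"
    and bd: "\<And>n t. t \<in> K \<Longrightarrow> norm (S n t) \<le> B"
    and rot: "uniform_limit K (\<lambda>n t. S (Suc n) t - \<kappa> t * S n t) (\<lambda>t. 0) sequentially"
    and c: "c > 0" "\<And>t. t \<in> K \<Longrightarrow> c \<le> norm (1 - \<kappa> t)"
    and \<kappa>: "\<And>t. t \<in> K \<Longrightarrow> norm (\<kappa> t) \<le> 1"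
  shows "uniform_limit K (\<lambda>n t. inverse (\<Sum>j<n. w j) *\<^sub>R (\<Sum>j<n. w j *\<^sub>R S j t)) (\<lambda>t. 0) sequentially"
proof -
  \<comment> \<open>Chosen such that w n e n = w (Suc n) S (Suc n) - \<kappa> w n S n, which sums to
    1 - \<kappa> times the weighted sum up to boundary terms.\<close>
  define e where "e n t = (w (Suc n) / w n - 1) *\<^sub>R S (Suc n) t + (S (Suc n) t - \<kappa> t * S n t)" for n t
  let ?W = "\<lambda>n. \<Sum>j<n. w j"
  have B0: "B \<ge> 0" if "K \<noteq> {}" using bd that by (meson all_not_in_conv norm_ge_zero order_trans)
  have e0: "uniform_limit K e (\<lambda>t. 0) sequentially"
  proof -
    have "uniform_limit K (\<lambda>n t. (w (Suc n) / w n - 1) *\<^sub>R S (Suc n) t) (\<lambda>t. 0) sequentially"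
    proof (rule uniform_limit_null_comparison)
      show "\<forall>\<^sub>F n in sequentially. \<forall>t\<in>K. norm ((w (Suc n) / w n - 1) *\<^sub>R S (Suc n) t) \<le> \<bar>w (Suc n) / w n - 1\<bar> * B"
        using bd by (auto intro!: always_eventually mult_left_mono)
      have "(\<lambda>n. \<bar>w (Suc n) / w n - 1\<bar> * B) \<longlonglongrightarrow> \<bar>1 - 1\<bar> * B"
        by (intro tendsto_intros ratio)
      then show "uniform_limit K (\<lambda>n t. \<bar>w (Suc n) / w n - 1\<bar> * B) (\<lambda>t. 0) sequentially"
        by (intro uniform_limit_of_real_const) simp
    qed
    from uniform_limit_add[OF this rot] show ?thesis by (simp add: e_def[abs_def])
  qed
  have eb: "bounded (e n ` K)" for n
  proof -
    have "norm (e n t) \<le> \<bar>w (Suc n) / w n - 1\<bar> * B + (B + 1 * B)" if t: "t \<in> K" for t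
    proof -
      have "norm (e n t) \<le> norm ((w (Suc n) / w n - 1) *\<^sub>R S (Suc n) t) + (norm (S (Suc n) t) + norm (\<kappa> t * S n t))"
        unfolding e_def by (intro order_trans[OF norm_triangle_ineq] add_mono norm_triangle_ineq4 order_refl)
      also have "\<dots> \<le> \<bar>w (Suc n) / w n - 1\<bar> * B + (B + 1 * B)"
        unfolding norm_mult norm_scaleR
        using bd[OF t] \<kappa>[OF t] B0 t by (intro add_mono mult_mono bd) auto
      finally show ?thesis .
    qed
    then show ?thesis unfolding bounded_iff by blast
  qed
  have avg: "uniform_limit K (\<lambda>n t. inverse (?W n) *\<^sub>R (\<Sum>j<n. w j *\<^sub>R e j t)) (\<lambda>t. 0) sequentially"
    by (rule weighted_average_null[OF e0 eb])
  have id: "(1 - \<kappa> t) * (\<Sum>j<n. w j *\<^sub>R S j t) = w 0 *\<^sub>R S 0 t - w n *\<^sub>R S n t + (\<Sum>j<n. w j *\<^sub>R e j t)" for n t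
  proof (induction n)
    case 0 then show ?case by simp
  next
    case (Suc n)
    have we: "w n *\<^sub>R e n t = w (Suc n) *\<^sub>R S (Suc n) t - \<kappa> t * (w n *\<^sub>R S n t)"
      using w_pos[of n] by (simp add: e_def scaleR_conv_of_real field_simps)
    show ?case unfolding sum.lessThan_Suc we distrib_left Suc by (simp add: left_diff_distrib scaleR_right_diff_distrib)
  qed
  have q0: "uniform_limit K (\<lambda>n t. (w 0 / ?W n + w n / ?W n) * B) (\<lambda>t. 0) sequentially"
  proof (rule uniform_limit_of_real_const)
    have "(\<lambda>n. w 0 / ?W n) \<longlonglongrightarrow> 0"
      using div by (rule real_tendsto_divide_at_top[OF tendsto_const])
    from tendsto_mult[OF tendsto_add[OF this weight_over_sum_null[OF ratio]] tendsto_const, of B]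
    show "(\<lambda>n. (w 0 / ?W n + w n / ?W n) * B) \<longlonglongrightarrow> 0" by simp
  qed
  have "uniform_limit K (\<lambda>n t. ((w 0 / ?W n + w n / ?W n) * B + norm (inverse (?W n) *\<^sub>R (\<Sum>j<n. w j *\<^sub>R e j t))) * (1 / c)) (\<lambda>t. 0) sequentially"
    using bounded_linear.uniform_limit[OF bounded_linear_mult_left uniform_limit_add[OF q0 uniform_limit_norm[OF avg]], of "1 / c"]
    by simp
  then show ?thesis
  proof (rule uniform_limit_null_comparison[rotated])
    show "\<forall>\<^sub>F n in sequentially. \<forall>t\<in>K. norm (inverse (?W n) *\<^sub>R (\<Sum>j<n. w j *\<^sub>R S j t))
      \<le> ((w 0 / ?W n + w n / ?W n) * B + norm (inverse (?W n) *\<^sub>R (\<Sum>j<n. w j *\<^sub>R e j t))) * (1 / c)"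
    proof (intro always_eventually allI ballI)
      fix n t assume t: "t \<in> K"
      have W0: "?W n \<ge> 0" using w_pos by (intro sum_nonneg) (auto simp: less_imp_le)
      have "c * norm (inverse (?W n) *\<^sub>R (\<Sum>j<n. w j *\<^sub>R S j t))
        \<le> norm (1 - \<kappa> t) * norm (inverse (?W n) *\<^sub>R (\<Sum>j<n. w j *\<^sub>R S j t))"
        using c(2)[OF t] by (rule mult_right_mono) simp
      also have "\<dots> = norm (inverse (?W n) *\<^sub>R ((1 - \<kappa> t) * (\<Sum>j<n. w j *\<^sub>R S j t)))"
        by (simp add: norm_mult)
      also have "\<dots> = norm ((w 0 / ?W n) *\<^sub>R S 0 t - (w n / ?W n) *\<^sub>R S n t + inverse (?W n) *\<^sub>R (\<Sum>j<n. w j *\<^sub>R e j t))"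
        unfolding id by (simp add: scaleR_right_distrib scaleR_right_diff_distrib divide_inverse mult.commute)
      also have "\<dots> \<le> (norm ((w 0 / ?W n) *\<^sub>R S 0 t) + norm ((w n / ?W n) *\<^sub>R S n t))
         + norm (inverse (?W n) *\<^sub>R (\<Sum>j<n. w j *\<^sub>R e j t))"
        by (intro order_trans[OF norm_triangle_ineq] add_mono norm_triangle_ineq4 order_refl)
      also have "\<dots> \<le> ((w 0 / ?W n) * B + (w n / ?W n) * B) + norm (inverse (?W n) *\<^sub>R (\<Sum>j<n. w j *\<^sub>R e j t))"
        unfolding norm_scaleR using W0 w_pos[of n] w_pos[of 0] bd[OF t]
        by (intro add_mono order_refl) (auto simp: abs_of_nonneg less_imp_le intro!: mult_left_mono divide_right_mono)
      finally show "norm (inverse (?W n) *\<^sub>R (\<Sum>j<n. w j *\<^sub>R S j t))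
      \<le> ((w 0 / ?W n + w n / ?W n) * B + norm (inverse (?W n) *\<^sub>R (\<Sum>j<n. w j *\<^sub>R e j t))) * (1 / c)"
        using c(1) by (simp add: field_simps)
    qed
  qed
qed

end

section \<open>Amplitude and phase of the orthogonal polynomials\<close>

text \<open>In the application p has the index jN+i, q the index jN+i-1, and \<open>al\<close> is
  the parameter a at jN+i-1. The assumption \<open>det\<close> comes from multiplying the one-step
  determinants, and it is what the amplitude relies on.\<close>

locale elliptic_recurrence = elliptic_sequence +
  fixes l11 l12 l21 l22 :: "real \<Rightarrow> real" and al :: "nat \<Rightarrow> real" and p q :: "nat \<Rightarrow> real \<Rightarrow> real"
  assumes compact_K: "compact K"
    and lim11: "uniform_limit K x11 l11 sequentially" and lim12: "uniform_limit K x12 l12 sequentially"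
    and lim21: "uniform_limit K x21 l21 sequentially" and lim22: "uniform_limit K x22 l22 sequentially"
    and al_pos: "\<And>n. al n > 0" and al_ratio: "(\<lambda>n. al (Suc n) / al n) \<longlonglongrightarrow> 1"
    and det: "\<And>n t. x11 n t * x22 n t - x12 n t * x21 n t = al n / al (Suc n)"
    and rec_q: "\<And>n t. q (Suc n) t = x11 n t * q n t + x12 n t * p n t"
    and rec_p: "\<And>n t. p (Suc n) t = x21 n t * q n t + x22 n t * p n t"
    and nontrivial: "\<And>n t. p n t \<noteq> 0 \<or> q n t \<noteq> 0"
    and cont_pq: "\<And>n. continuous_on K (p n)" "\<And>n. continuous_on K (q n)"
    and summable_v: "summable (\<lambda>n. v n ^ r)"
    and div: "filterlim (\<lambda>n. \<Sum>j<n. 1 / al j) at_top sequentially"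
begin

definition Dl :: "real \<Rightarrow> real" where
  "Dl t = - ((l22 t - l11 t)\<^sup>2 + 4 * l12 t * l21 t)"

definition zl :: "real \<Rightarrow> complex" where
  "zl t = (of_real (l22 t - l11 t) + \<i> * of_real (sqrt (Dl t))) / of_real (2 * l12 t)"

lemma cont_l: "continuous_on K l11" "continuous_on K l12" "continuous_on K l21" "continuous_on K l22"
  using uniform_limit_theorem[OF _ lim11] uniform_limit_theorem[OF _ lim12]
    uniform_limit_theorem[OF _ lim21] uniform_limit_theorem[OF _ lim22] cont by auto

lemma pointwise_l:
  assumes "t \<in> K"
  shows "(\<lambda>n. x11 n t) \<longlonglongrightarrow> l11 t" "(\<lambda>n. x12 n t) \<longlonglongrightarrow> l12 t"
    "(\<lambda>n. x21 n t) \<longlonglongrightarrow> l21 t" "(\<lambda>n. x22 n t) \<longlonglongrightarrow> l22 t"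
  using assms lim11 lim12 lim21 lim22 by (auto intro: tendsto_uniform_limitI)

lemma l12_ge: "t \<in> K \<Longrightarrow> c \<le> \<bar>l12 t\<bar>"
  by (rule tendsto_lowerbound[OF tendsto_rabs[OF pointwise_l(2)]])
     (use x12_ge in \<open>auto elim: eventually_mono\<close>)

lemma Dl_ge: "t \<in> K \<Longrightarrow> c \<le> Dl t"
proof -
  assume t: "t \<in> K"
  have "(\<lambda>n. D n t) \<longlonglongrightarrow> Dl t"
    unfolding D_def Dl_def by (intro tendsto_intros pointwise_l t)
  then show ?thesis
    by (rule tendsto_lowerbound) (use D_ge t in \<open>auto simp: D_def elim: eventually_mono\<close>)
qed

lemma det_l: "t \<in> K \<Longrightarrow> l11 t * l22 t - l12 t * l21 t = 1"
proof -
  assume t: "t \<in> K"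
  have "(\<lambda>n. x11 n t * x22 n t - x12 n t * x21 n t) \<longlonglongrightarrow> l11 t * l22 t - l12 t * l21 t"
    by (intro tendsto_intros pointwise_l t)
  moreover have "(\<lambda>n. inverse (al (Suc n) / al n)) \<longlonglongrightarrow> inverse 1"
    by (intro tendsto_inverse al_ratio) simp
  ultimately show ?thesis unfolding det using LIMSEQ_unique by fastforce
qed

lemma cont_Dl: "continuous_on K Dl"
  unfolding Dl_def by (intro continuous_intros cont_l)

lemma l12_nz: "t \<in> K \<Longrightarrow> l12 t \<noteq> 0"
  using l12_ge[of t] c_pos by auto

lemma cont_zl: "continuous_on K zl"
  unfolding zl_def by (intro continuous_intros cont_l cont_Dl) (use l12_nz in auto)

lemma uniform_z0: "uniform_limit K z0 zl sequentially"
proof -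
  define h where "h = (\<lambda>(a::real, b::real, e::real, d::real).
    (complex_of_real (d - a) + \<i> * complex_of_real (sqrt (- ((d - a)\<^sup>2 + 4 * b * e)))) / complex_of_real (2 * b))"
  define U where "U = {(a::real, b::real, e::real, d::real). b \<noteq> 0}"
  have U': "U = (\<lambda>x. fst (snd x)) -` (- {0})" by (auto simp: U_def)
  have "uniform_limit K (\<lambda>n t. h (x11 n t, x12 n t, x21 n t, x22 n t)) (\<lambda>t. h (l11 t, l12 t, l21 t, l22 t)) sequentially"
  proof (rule uniform_limit_continuous_compose[OF compact_K, of _ _ _ U])
    show "continuous_on K (\<lambda>t. (l11 t, l12 t, l21 t, l22 t))" by (intro continuous_intros cont_l)
    show "uniform_limit K (\<lambda>n t. (x11 n t, x12 n t, x21 n t, x22 n t)) (\<lambda>t. (l11 t, l12 t, l21 t, l22 t)) sequentially"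
      by (intro uniform_limit_Pair lim11 lim12 lim21 lim22)
    show "open U" unfolding U' by (intro open_vimage) (auto intro!: continuous_intros)
    show "(\<lambda>t. (l11 t, l12 t, l21 t, l22 t)) ` K \<subseteq> U" using l12_nz by (auto simp: U_def)
    show "continuous_on U h" unfolding h_def split_beta
      by (intro continuous_intros) (auto simp: U_def)
  qed
  then show ?thesis by (simp add: h_def z0_def[abs_def] zl_def[abs_def] D_def Dl_def)
qed

text \<open>The limit matrix has determinant 1 and non-real eigenvalues;
  \<open>l22 t - zl t * l12 t\<close> is one of them, of modulus 1 and imaginary part minus half the
  root of \<open>Dl\<close>. Its square keeps distance sqrt \<open>Dl\<close> from 1, the gap needed
  for averaging the phase. The third fact is the source of the (2,1) entry in the result.\<close>

lemma zl_facts: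
  assumes "t \<in> K"
  shows "Im (zl t) = sqrt (Dl t) / (2 * l12 t)" "Im (zl t) \<noteq> 0"
    and "(norm (zl t))\<^sup>2 / \<bar>Im (zl t)\<bar> = 2 * \<bar>l21 t\<bar> / sqrt (Dl t)"
    and "norm (l22 t - zl t * l12 t) = 1" "norm (1 - (l22 t - zl t * l12 t)\<^sup>2) = sqrt (Dl t)"
proof -
  have D0: "Dl t > 0" using Dl_ge[OF assms] c_pos by simp
  have nz: "l12 t \<noteq> 0" using l12_nz[OF assms] .
  have Re: "Re (zl t) = (l22 t - l11 t) / (2 * l12 t)" and Im: "Im (zl t) = sqrt (Dl t) / (2 * l12 t)"
    unfolding zl_def by (simp_all add: Re_divide_of_real Im_divide_of_real)
  show "Im (zl t) = sqrt (Dl t) / (2 * l12 t)" by (rule Im)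
  show "Im (zl t) \<noteq> 0" using Im D0 nz by simp
  have "(norm (zl t))\<^sup>2 = ((l22 t - l11 t)\<^sup>2 + Dl t) / (2 * l12 t)\<^sup>2"
    using D0 by (simp add: cmod_power2 Re Im power_divide add_divide_distrib)
  also have "\<dots> = - l21 t / l12 t"
    using nz by (simp add: Dl_def power2_eq_square field_simps)
  finally have "\<bar>(norm (zl t))\<^sup>2\<bar> = \<bar>l21 t\<bar> / \<bar>l12 t\<bar>" by simp
  then have n2: "(norm (zl t))\<^sup>2 = \<bar>l21 t\<bar> / \<bar>l12 t\<bar>" by simp
  show "(norm (zl t))\<^sup>2 / \<bar>Im (zl t)\<bar> = 2 * \<bar>l21 t\<bar> / sqrt (Dl t)"
    unfolding n2 Im using nz D0 by (simp add: abs_mult)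
  define lam where "lam = l22 t - zl t * l12 t"
  have lRe: "Re lam = (l22 t + l11 t) / 2" and lIm: "Im lam = - sqrt (Dl t) / 2"
    unfolding lam_def using nz by (simp_all add: Re Im field_simps)
  have "(norm lam)\<^sup>2 = ((l22 t + l11 t)\<^sup>2 + Dl t) / 4"
    unfolding cmod_power2 lRe lIm using D0 by (simp add: power_divide field_simps)
  also have "(l22 t + l11 t)\<^sup>2 + Dl t = 4 * (l11 t * l22 t - l12 t * l21 t)"
    by (simp add: Dl_def power2_eq_square algebra_simps)
  finally have "(norm lam)\<^sup>2 = 1" using det_l[OF assms] by simp
  then show n1: "norm (l22 t - zl t * l12 t) = 1"
    unfolding lam_def[symmetric] by (metis norm_ge_zero one_power2 power2_eq_imp_eq zero_le_one)
  have ll: "lam * cnj lam = 1" using n1 unfolding lam_def[symmetric] complex_norm_square[symmetric] by simp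
  have "1 - lam\<^sup>2 = lam * (cnj lam - lam)" using ll by (simp add: algebra_simps power2_eq_square)
  then have "norm (1 - lam\<^sup>2) = norm (cnj lam - lam)"
    using n1 unfolding lam_def[symmetric] by (simp add: norm_mult)
  also have "cnj lam - lam = of_real (sqrt (Dl t)) * \<i>" by (simp add: complex_eq_iff lIm)
  finally show "norm (1 - (l22 t - zl t * l12 t)\<^sup>2) = sqrt (Dl t)"
    using D0 unfolding lam_def[symmetric] by (simp add: norm_mult)
qed

lemma Im_zl_lower: "\<exists>b>0. \<forall>t\<in>K. b \<le> \<bar>Im (zl t)\<bar>"
proof (cases "K = {}")
  case False
  have "continuous_on K (\<lambda>t. \<bar>Im (zl t)\<bar>)" by (intro continuous_intros cont_zl)
  from continuous_attains_inf[OF compact_K False this] obtain s where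
    s: "s \<in> K" "\<forall>t\<in>K. \<bar>Im (zl s)\<bar> \<le> \<bar>Im (zl t)\<bar>" by blast
  then show ?thesis using zl_facts(2)[of s] by (intro exI[of _ "\<bar>Im (zl s)\<bar>"]) auto
qed (auto intro: exI[of _ 1])

definition \<phi> :: "(nat \<Rightarrow> real \<Rightarrow> complex) \<Rightarrow> nat \<Rightarrow> real \<Rightarrow> complex" where
  "\<phi> z n t = of_real (p n t) - z n t * of_real (q n t)"

definition lam :: "(nat \<Rightarrow> real \<Rightarrow> complex) \<Rightarrow> nat \<Rightarrow> real \<Rightarrow> complex" where
  "lam z n t = of_real (x22 n t) - z (Suc n) t * of_real (x12 n t)"

text \<open>With residual 0 this would not depend on n: |lam|^2 would be
  \<open>al n / al (Suc n)\<close> times the quotient of the new and the old imaginary part.\<close>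

definition G :: "(nat \<Rightarrow> real \<Rightarrow> complex) \<Rightarrow> nat \<Rightarrow> real \<Rightarrow> real" where
  "G z n t = al n * (norm (\<phi> z n t))\<^sup>2 / \<bar>Im (z n t)\<bar>"

lemma \<phi>_rec: "\<phi> z (Suc n) t = lam z n t * \<phi> z n t + residual z n t * of_real (q n t)"
  by (simp add: \<phi>_def lam_def residual_def rec_p rec_q algebra_simps)

text \<open>The inverse Moebius map leads from \<open>z (Suc n)\<close> back to \<open>z n\<close>
  with denominator \<open>lam\<close>, so it multiplies imaginary parts by the determinant over
  |lam|^2; the residual enters as a correction.\<close>

lemma lam_norm:
  "Im (z (Suc n) t) * (al n / al (Suc n)) = (norm (lam z n t))\<^sup>2 * Im (z n t) - Im (residual z n t * cnj (lam z n t))"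
proof -
  define w w' where "w = z n t" and "w' = z (Suc n) t"
  have "Im w' * (x11 n t * x22 n t - x12 n t * x21 n t)
    = (norm (x22 n t - w' * x12 n t))\<^sup>2 * Im w
      - Im ((w * (x22 n t - w' * x12 n t) - w' * x11 n t + x21 n t) * cnj (x22 n t - w' * x12 n t))"
    unfolding cmod_power2 by (simp add: power2_eq_square algebra_simps)
  then show ?thesis unfolding det lam_def residual_def w_def w'_def .
qed

text \<open>As p and q are real, Im \<phi> = - q Im z. This turns the residual term in
  \<open>\<phi>_rec\<close> into an error relative to \<phi>.\<close>

lemma q_bound: "Im (z n t) \<noteq> 0 \<Longrightarrow> \<bar>q n t\<bar> \<le> norm (\<phi> z n t) / \<bar>Im (z n t)\<bar>"
proof -
  assume nz: "Im (z n t) \<noteq> 0"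
  have "\<bar>q n t\<bar> * \<bar>Im (z n t)\<bar> = \<bar>Im (\<phi> z n t)\<bar>" by (simp add: \<phi>_def abs_mult)
  also have "\<dots> \<le> norm (\<phi> z n t)" by (rule abs_Im_le_cmod)
  finally show ?thesis using nz by (simp add: pos_le_divide_eq)
qed

lemma \<phi>_nz: "Im (z n t) \<noteq> 0 \<Longrightarrow> \<phi> z n t \<noteq> 0"
  using q_bound[of z n t] nontrivial[of n t] by (auto simp: \<phi>_def)

lemma G_pos: "Im (z n t) \<noteq> 0 \<Longrightarrow> G z n t > 0"
  using \<phi>_nz[of z n t] al_pos[of n] by (simp add: G_def)

text \<open>Two errors relative to |\<phi>|^2: replacing the new \<phi> by lam \<phi> costs 2 |lam|
  |R| / |y| + |R|^2 / |y|^2, and replacing |lam|^2 by its value for residual 0 costs another |lam|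
  |R| / |y|; hence the 3.\<close>

lemma G_step:
  assumes nz: "Im (z n t) \<noteq> 0" "Im (z (Suc n) t) \<noteq> 0"
  shows "\<bar>G z (Suc n) t - G z n t\<bar> \<le> (al (Suc n) / al n) * (\<bar>Im (z n t)\<bar> / \<bar>Im (z (Suc n) t)\<bar>) *
     (3 * norm (lam z n t) * norm (residual z n t) / \<bar>Im (z n t)\<bar> + (norm (residual z n t))\<^sup>2 / \<bar>Im (z n t)\<bar>\<^sup>2) * G z n t"
proof -
  define y y' f f' L R Q where "y = Im (z n t)" and "y' = Im (z (Suc n) t)" and "f = \<phi> z n t"
    and "f' = \<phi> z (Suc n) t" and "L = lam z n t" and "R = residual z n t" and "Q = complex_of_real (q n t)"
  define e where "e = 3 * norm L * norm R / \<bar>y\<bar> + (norm R)\<^sup>2 / \<bar>y\<bar>\<^sup>2"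
  have y: "y \<noteq> 0" "y' \<noteq> 0" using nz by (simp_all add: y_def y'_def)
  have f': "f' = L * f + R * Q" unfolding f'_def f_def L_def R_def Q_def by (rule \<phi>_rec)
  have Q: "norm Q \<le> norm f / \<bar>y\<bar>" using q_bound[of z n t] nz by (simp add: Q_def f_def y_def)
  have RQ: "norm (R * Q) \<le> norm R * (norm f / \<bar>y\<bar>)" unfolding norm_mult by (intro mult_left_mono Q) simp
  have sq: "\<bar>(norm f')\<^sup>2 - (norm (L * f))\<^sup>2\<bar> \<le> 2 * norm (L * f) * norm (R * Q) + (norm (R * Q))\<^sup>2"
  proof -
    have "(norm f')\<^sup>2 = (norm (L * f))\<^sup>2 + 2 * Re (L * f * cnj (R * Q)) + (norm (R * Q))\<^sup>2"
      unfolding f' cmod_power2 by (simp add: power2_eq_square algebra_simps)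
    moreover have "\<bar>Re (L * f * cnj (R * Q))\<bar> \<le> norm (L * f) * norm (R * Q)"
      using abs_Re_le_cmod[of "L * f * cnj (R * Q)"] by (simp add: norm_mult)
    moreover have "\<bar>F - A\<bar> \<le> 2 * T + B" if "F = A + 2 * g + B" "\<bar>g\<bar> \<le> T" "0 \<le> B" for F A g B T :: real
      using that by (simp add: abs_le_iff)
    ultimately show ?thesis by (metis mult.assoc zero_le_power2)
  qed
  also have "\<dots> \<le> 2 * norm (L * f) * (norm R * (norm f / \<bar>y\<bar>)) + (norm R * (norm f / \<bar>y\<bar>))\<^sup>2"
    by (intro add_mono mult_left_mono power_mono RQ) auto
  finally have A: "\<bar>(norm f')\<^sup>2 - (norm L)\<^sup>2 * (norm f)\<^sup>2\<bar>
      \<le> (2 * norm L * norm R / \<bar>y\<bar> + (norm R)\<^sup>2 / \<bar>y\<bar>\<^sup>2) * (norm f)\<^sup>2"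
    by (simp add: norm_mult power_mult_distrib power_divide algebra_simps power2_eq_square)
  have L: "(norm L)\<^sup>2 - (y' / y) * (al n / al (Suc n)) = Im (R * cnj L) / y"
    using lam_norm[of z n t] y unfolding L_def[symmetric] R_def[symmetric] y_def[symmetric] y'_def[symmetric]
    by (simp add: field_simps)
  have "\<bar>(norm L)\<^sup>2 - (y' / y) * (al n / al (Suc n))\<bar> \<le> norm L * norm R / \<bar>y\<bar>"
    unfolding L abs_divide using abs_Im_le_cmod[of "R * cnj L"]
    by (intro divide_right_mono) (simp_all add: norm_mult mult.commute)
  then have "\<bar>(norm L)\<^sup>2 - (y' / y) * (al n / al (Suc n))\<bar> * (norm f)\<^sup>2 \<le> norm L * norm R / \<bar>y\<bar> * (norm f)\<^sup>2"
    by (rule mult_right_mono) simp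
  then have B: "\<bar>(norm L)\<^sup>2 * (norm f)\<^sup>2 - (y' / y) * (al n / al (Suc n)) * (norm f)\<^sup>2\<bar> \<le> norm L * norm R / \<bar>y\<bar> * (norm f)\<^sup>2"
    by (simp only: left_diff_distrib[symmetric] abs_mult abs_power2)
  have "\<bar>(norm f')\<^sup>2 - (y' / y) * (al n / al (Suc n)) * (norm f)\<^sup>2\<bar> \<le> e * (norm f)\<^sup>2"
  proof -
    have "e * (norm f)\<^sup>2 = (2 * norm L * norm R / \<bar>y\<bar> + (norm R)\<^sup>2 / \<bar>y\<bar>\<^sup>2) * (norm f)\<^sup>2
        + norm L * norm R / \<bar>y\<bar> * (norm f)\<^sup>2"
      by (simp add: e_def algebra_simps)
    then show ?thesis using A B by linarith
  qed
  \<comment> \<open>y and y' may have different signs here; by the reverse triangle inequality,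
    passing to absolute values does not increase the error.\<close>
  moreover have "\<bar>(norm f')\<^sup>2 - (\<bar>y'\<bar> / \<bar>y\<bar>) * (al n / al (Suc n)) * (norm f)\<^sup>2\<bar>
     \<le> \<bar>(norm f')\<^sup>2 - (y' / y) * (al n / al (Suc n)) * (norm f)\<^sup>2\<bar>"
  proof -
    have "\<bar>(y' / y) * (al n / al (Suc n)) * (norm f)\<^sup>2\<bar> = (\<bar>y'\<bar> / \<bar>y\<bar>) * (al n / al (Suc n)) * (norm f)\<^sup>2"
      using al_pos by (simp add: abs_mult less_imp_le)
    moreover have "\<bar>(norm f')\<^sup>2\<bar> = (norm f')\<^sup>2" by simp
    ultimately show ?thesis using abs_triangle_ineq3[of "(norm f')\<^sup>2" "(y' / y) * (al n / al (Suc n)) * (norm f)\<^sup>2"]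
      by simp
  qed
  ultimately have C: "\<bar>(norm f')\<^sup>2 - (\<bar>y'\<bar> / \<bar>y\<bar>) * (al n / al (Suc n)) * (norm f)\<^sup>2\<bar> \<le> e * (norm f)\<^sup>2" by simp
  have "G z (Suc n) t - G z n t = (al (Suc n) / \<bar>y'\<bar>) * ((norm f')\<^sup>2 - (\<bar>y'\<bar> / \<bar>y\<bar>) * (al n / al (Suc n)) * (norm f)\<^sup>2)"
    using y al_pos[of "Suc n"] unfolding G_def y_def[symmetric] y'_def[symmetric] f_def[symmetric] f'_def[symmetric]
    by (simp add: field_simps)
  then have "\<bar>G z (Suc n) t - G z n t\<bar> = (al (Suc n) / \<bar>y'\<bar>) * \<bar>(norm f')\<^sup>2 - (\<bar>y'\<bar> / \<bar>y\<bar>) * (al n / al (Suc n)) * (norm f)\<^sup>2\<bar>"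
    using al_pos[of "Suc n"] by (simp add: abs_mult)
  also have "\<dots> \<le> (al (Suc n) / \<bar>y'\<bar>) * (e * (norm f)\<^sup>2)"
    using al_pos[of "Suc n"] by (intro mult_left_mono C) simp
  also have "\<dots> = (al (Suc n) / al n) * (\<bar>y\<bar> / \<bar>y'\<bar>) * e * G z n t"
    using y al_pos[of n] unfolding G_def y_def[symmetric] f_def[symmetric] by (simp add: field_simps)
  finally show ?thesis unfolding e_def y_def y'_def L_def R_def .
qed

end

text \<open>In a difference quotient of the distribution function the point varies while the index
  grows, so the densities must converge jointly in both.\<close>

lemma uniform_limit_joint:
  fixes l :: "'a::topological_space \<Rightarrow> 'b::metric_space"
  assumes lim: "uniform_limit K f l sequentially" and l: "continuous_on K l" and t: "t \<in> K"
  shows "((\<lambda>x. f (fst x) (snd x)) \<longlongrightarrow> l t) (sequentially \<times>\<^sub>F inf (nhds t) (principal K))"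
proof (rule tendstoI)
  fix e :: real assume e: "e > 0"
  have 1: "\<forall>\<^sub>F n in sequentially. \<forall>s\<in>K. dist (f n s) (l s) < e / 2"
    using lim e by (intro uniform_limitD) auto
  have "(l \<longlongrightarrow> l t) (at t within K)" using l t by (simp add: continuous_on_def)
  then have "\<forall>\<^sub>F s in at t within K. dist (l s) (l t) < e / 2"
    using e by (intro tendstoD) auto
  then have 2: "\<forall>\<^sub>F s in inf (nhds t) (principal K). s \<in> K \<and> dist (l s) (l t) < e / 2"
    unfolding eventually_at_filter eventually_inf_principal using e by (auto elim!: eventually_mono)
  show "\<forall>\<^sub>F x in sequentially \<times>\<^sub>F inf (nhds t) (principal K). dist (f (fst x) (snd x)) (l t) < e"
    unfolding eventually_prod_filter
  proof (intro exI conjI allI impI)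
    fix n s assume "\<forall>s\<in>K. dist (f n s) (l s) < e / 2" "s \<in> K \<and> dist (l s) (l t) < e / 2"
    then show "dist (f (fst (n, s)) (snd (n, s))) (l t) < e"
      using dist_triangle_half_l[of "f n s" "l s" e "l t"] by (simp add: dist_commute) 
  qed (use 1 2 in auto)
qed

section \<open>Convergence of the amplitude and averaging of the phase\<close>

context elliptic_recurrence
begin

lemma weight_bounded_0E:
  assumes "weight_bounded v K 0 x"
  obtains C where "C \<ge> 0" "\<forall>\<^sub>F n in sequentially. \<forall>t\<in>K. norm (x n t) \<le> C"
  using weight_boundedE[OF assms] by auto

lemma uniform_null_bounded_mult:
  fixes f g :: "nat \<Rightarrow> real \<Rightarrow> complex"
  assumes f: "uniform_limit K f (\<lambda>t. 0) sequentially"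
    and g: "\<forall>\<^sub>F n in sequentially. \<forall>t\<in>K. norm (g n t) \<le> B"
  shows "uniform_limit K (\<lambda>n t. f n t * g n t) (\<lambda>t. 0) sequentially"
proof (rule uniform_limit_null_comparison)
  show "\<forall>\<^sub>F n in sequentially. \<forall>t\<in>K. norm (f n t * g n t) \<le> norm (f n t) * B"
    using g by eventually_elim (auto simp: norm_mult intro: mult_left_mono)
  show "uniform_limit K (\<lambda>n t. norm (f n t) * B) (\<lambda>t. 0) sequentially"
    using bounded_linear.uniform_limit[OF bounded_linear_mult_left uniform_limit_norm[OF f], of B] by simp
qed

lemma amplitude_limit:
  obtains z g b Y L where "uniform_limit K z zl sequentially"
    and "continuous_on K g" and "\<And>t. t \<in> K \<Longrightarrow> g t > 0" and "uniform_limit K (G z) g sequentially"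
    and "b > 0" "\<forall>\<^sub>F n in sequentially. \<forall>t\<in>K. b \<le> \<bar>Im (z n t)\<bar>"
    and "\<forall>\<^sub>F n in sequentially. \<forall>t\<in>K. norm (z n t) \<le> Y"
    and "\<forall>\<^sub>F n in sequentially. \<forall>t\<in>K. norm (lam z n t) \<le> L"
    and "uniform_limit K (residual z) (\<lambda>t. 0) sequentially"
proof -
  obtain z where "approx r z" by (rule riccati_approx)
  then have Wz: "weight_class v K 0 r z" and Wr: "weight_bounded v K r (residual z)" and Wd: "weight_class v K 1 (r - 1) (\<lambda>n t. z n t - z0 n t)"
    and zc: "\<forall>\<^sub>F n in sequentially. continuous_on K (z n)"
    by (auto simp: approx_def)
  have "uniform_limit K (\<lambda>n t. z n t - z0 n t) (\<lambda>t. 0) sequentially"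
    using weight_bounded_uniform_limit[of 0] weight_class_imp_bounded[OF Wd] by simp
  from uniform_limit_add[OF this uniform_z0] have zlim: "uniform_limit K z zl sequentially" by simp
  obtain b where b: "b > 0" "\<And>t. t \<in> K \<Longrightarrow> b \<le> \<bar>Im (zl t)\<bar>" using Im_zl_lower by blast
  have yb: "\<forall>\<^sub>F n in sequentially. \<forall>t\<in>K. b / 2 \<le> \<bar>Im (z n t)\<bar>"
    using uniform_limitD[OF zlim, of "b / 2"] b(1)
  proof (simp, elim eventually_mono, intro ballI)
    fix n t assume "\<forall>t\<in>K. dist (z n t) (zl t) * 2 < b" and t: "t \<in> K"
    then have "norm (z n t - zl t) * 2 < b" by (auto simp: dist_norm)
    then show "b \<le> \<bar>Im (z n t)\<bar> * 2" using abs_Im_le_cmod[of "z n t - zl t"] b(2)[OF t] by simp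
  qed
  obtain Y where Y: "Y \<ge> 0" "\<forall>\<^sub>F n in sequentially. \<forall>t\<in>K. norm (z n t) \<le> Y"
    by (rule weight_bounded_0E[OF weight_class_imp_bounded[OF Wz]])
  have Wl: "weight_class v K 0 r (lam z)"
    unfolding lam_def[abs_def] by (rule weight_class_diff[OF weight_class_of_real[OF W22] weight_class_mult0[OF weight_class_shift[OF Wz] weight_class_of_real[OF W12]]])
  obtain L where L: "L \<ge> 0" "\<forall>\<^sub>F n in sequentially. \<forall>t\<in>K. norm (lam z n t) \<le> L"
    by (rule weight_bounded_0E[OF weight_class_imp_bounded[OF Wl]])
  obtain C where C: "C \<ge> 0" "\<forall>\<^sub>F n in sequentially. \<forall>t\<in>K. norm (residual z n t) \<le> C * v n ^ r"
    by (rule weight_boundedE[OF Wr])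
  have v1: "\<forall>\<^sub>F n in sequentially. v n < 1" using v_lim by (rule order_tendstoD) simp
  have a2: "\<forall>\<^sub>F n in sequentially. al (Suc n) / al n < 2" using al_ratio by (rule order_tendstoD) simp
  \<comment> \<open>Bounds the factor in \<open>G_step\<close>: the ratio of the \<open>al\<close>
    is below 2, the imaginary parts lie between b / 2 and Y, and v^r \<le> 1 absorbs one factor of
    the squared residual.\<close>
  define M where "M = 2 * (Y / (b / 2)) * (3 * L * C / (b / 2) + C\<^sup>2 / (b / 2)\<^sup>2)"
  have step: "\<forall>\<^sub>F n in sequentially. \<forall>t\<in>K. \<bar>G z (Suc n) t - G z n t\<bar> \<le> (M * v n ^ r) * G z n t"
    using yb eventually_sequentially_shift[OF yb] Y(2) L(2) C(2) v1 a2
  proof eventually_elim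
    case (elim n)
    show ?case
    proof
      fix t assume t: "t \<in> K"
      have nz: "Im (z n t) \<noteq> 0" "Im (z (Suc n) t) \<noteq> 0" using elim(1,2) t b(1) by fastforce+
      have Rb: "norm (residual z n t) \<le> C * v n ^ r" using elim t by blast
      have vr: "0 \<le> v n ^ r" "v n ^ r \<le> 1" using v_nonneg[of n] elim(6) by (auto intro!: power_le_one)
      have R2: "(norm (residual z n t))\<^sup>2 \<le> C\<^sup>2 * v n ^ r"
      proof -
        have "(norm (residual z n t))\<^sup>2 \<le> (C * v n ^ r)\<^sup>2" by (rule power_mono[OF Rb]) simp
        also have "\<dots> = C\<^sup>2 * (v n ^ r * v n ^ r)" by (simp add: power_mult_distrib power2_eq_square)
        also have "\<dots> \<le> C\<^sup>2 * (v n ^ r * 1)" using vr by (intro mult_left_mono) auto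
        finally show ?thesis by simp
      qed
      have yb': "b / 2 \<le> \<bar>Im (z n t)\<bar>" "b / 2 \<le> \<bar>Im (z (Suc n) t)\<bar>" using elim t by auto
      have Yb: "\<bar>Im (z n t)\<bar> \<le> Y" using abs_Im_le_cmod[of "z n t"] elim(3) t by force
      have T1: "3 * norm (lam z n t) * norm (residual z n t) / \<bar>Im (z n t)\<bar> \<le> 3 * L * (C * v n ^ r) / (b / 2)"
        using elim(4) t b(1) L(1) C(1) vr by (intro frac_le mult_mono yb' Rb) auto
      have T2: "(norm (residual z n t))\<^sup>2 / \<bar>Im (z n t)\<bar>\<^sup>2 \<le> (C\<^sup>2 * v n ^ r) / (b / 2)\<^sup>2"
        using b(1) vr by (intro frac_le R2 power_mono yb') auto
      have "(al (Suc n) / al n) * (\<bar>Im (z n t)\<bar> / \<bar>Im (z (Suc n) t)\<bar>) *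
         (3 * norm (lam z n t) * norm (residual z n t) / \<bar>Im (z n t)\<bar> + (norm (residual z n t))\<^sup>2 / \<bar>Im (z n t)\<bar>\<^sup>2)
         \<le> 2 * (Y / (b / 2)) * (3 * L * (C * v n ^ r) / (b / 2) + (C\<^sup>2 * v n ^ r) / (b / 2)\<^sup>2)"
        using elim(7) al_pos[of n] al_pos[of "Suc n"] b(1) Y(1) yb'
        by (intro mult_mono add_mono T1 T2 frac_le Yb) (auto intro!: divide_nonneg_nonneg mult_nonneg_nonneg add_nonneg_nonneg)
      also have "\<dots> = M * v n ^ r" unfolding M_def by (simp add: algebra_simps add_divide_distrib)
      finally have "(al (Suc n) / al n) * (\<bar>Im (z n t)\<bar> / \<bar>Im (z (Suc n) t)\<bar>) *
         (3 * norm (lam z n t) * norm (residual z n t) / \<bar>Im (z n t)\<bar> + (norm (residual z n t))\<^sup>2 / \<bar>Im (z n t)\<bar>\<^sup>2) * G z n t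
         \<le> (M * v n ^ r) * G z n t"
        using G_pos[of z n t] nz by (intro mult_right_mono) auto
      with G_step[of z n t, OF nz] show "\<bar>G z (Suc n) t - G z n t\<bar> \<le> (M * v n ^ r) * G z n t" by linarith
    qed
  qed
  have cG: "\<forall>\<^sub>F n in sequentially. continuous_on K (G z n)"
    using zc yb
  proof eventually_elim
    case (elim n)
    then have "Im (z n t) \<noteq> 0" if "t \<in> K" for t using b(1) that by fastforce
    then show ?case unfolding G_def \<phi>_def
      by (intro continuous_intros elim(1) cont_pq) auto
  qed
  have pG: "\<forall>\<^sub>F n in sequentially. \<forall>t\<in>K. G z n t > 0"
    using yb by eventually_elim (use b(1) in \<open>fastforce intro: G_pos\<close>)
  have "summable (\<lambda>n. M * v n ^ r)" by (intro summable_mult summable_v)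
  from perturbed_product_limit[OF compact_K this cG pG step] obtain g
    where g: "continuous_on K g" "\<And>t. t \<in> K \<Longrightarrow> g t > 0" "uniform_limit K (G z) g sequentially" by blast
  have "uniform_limit K (residual z) (\<lambda>t. 0) sequentially"
    using Wr r_pos weight_bounded_uniform_limit[of "r - 1" "residual z"] by simp
  with that[OF zlim g _ yb Y(2) L(2)] b(1) show ?thesis by simp
qed

text \<open>The limit of the coefficient of the rotating term in \<open>p_square\<close>.\<close>

definition m :: "real \<Rightarrow> complex" where "m t = (cnj (zl t) / of_real (Im (zl t)))\<^sup>2"

text \<open>Up to sign, p is the imaginary part of w \<phi> with w = conj z / Im z, and (Im u)^2 =
  (|u|^2 - Re (u^2)) / 2. The modulus is governed by the amplitude \<open>G\<close>; the square of
  \<phi> rotates.\<close>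

lemma p_square:
  assumes "Im (z n t) \<noteq> 0"
  shows "al n * (p n t)\<^sup>2 = (G z n t * ((norm (z n t))\<^sup>2 / \<bar>Im (z n t)\<bar>)
    - Re ((cnj (z n t) / of_real (Im (z n t)))\<^sup>2 * (of_real (al n) * (\<phi> z n t)\<^sup>2))) / 2"
proof -
  define w f y where "w = cnj (z n t) / of_real (Im (z n t))" and "f = \<phi> z n t" and "y = Im (z n t)"
  have y: "y \<noteq> 0" using assms by (simp add: y_def)
  have "p n t = - Im (w * f)"
    using assms by (simp add: w_def f_def \<phi>_def field_simps)
  then have "(p n t)\<^sup>2 = (Im (w * f))\<^sup>2" by (simp only: power2_minus)
  also have "\<dots> = ((norm (w * f))\<^sup>2 - Re ((w * f)\<^sup>2)) / 2"
    unfolding cmod_power2 by (simp add: power2_eq_square)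
  finally have 1: "(p n t)\<^sup>2 = ((norm (w * f))\<^sup>2 - Re ((w * f)\<^sup>2)) / 2" .
  have 2: "al n * (norm (w * f))\<^sup>2 = G z n t * ((norm (z n t))\<^sup>2 / \<bar>Im (z n t)\<bar>)"
    using y unfolding G_def w_def f_def[symmetric] y_def[symmetric]
    by (simp add: norm_mult norm_divide power_mult_distrib power_divide power2_eq_square)
  have 3: "al n * Re ((w * f)\<^sup>2) = Re (w\<^sup>2 * (of_real (al n) * f\<^sup>2))"
    by (simp add: power_mult_distrib mult.left_commute)
  show ?thesis unfolding w_def[symmetric] f_def[symmetric] 3[symmetric] 2[symmetric] unfolding 1
    by (simp add: algebra_simps)
qed

lemma bounded_of_continuous:
  fixes f :: "real \<Rightarrow> 'a::real_normed_vector"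
  shows "continuous_on K f \<Longrightarrow> \<exists>B. \<forall>t\<in>K. norm (f t) \<le> B"
  using compact_imp_bounded[OF compact_continuous_image[OF _ compact_K], of f] by (auto simp: bounded_iff)

text \<open>\<open>al j\<close> times the square of p j is close to h / 2 - Re (m S) / 2 with S = al
  \<phi>^2. Each step multiplies S by almost \<kappa>, where |\<kappa>| = 1 and \<kappa> stays away
  from 1, so the second part averages out and h / 2 is the limit.\<close>

theorem averaged_squares:
  assumes zlim: "uniform_limit K z zl sequentially"
    and g: "continuous_on K g" and Glim: "uniform_limit K (G z) g sequentially"
    and b: "b > 0" and yb: "\<forall>\<^sub>F n in sequentially. \<forall>t\<in>K. b \<le> \<bar>Im (z n t)\<bar>"
    and Y: "\<forall>\<^sub>F n in sequentially. \<forall>t\<in>K. norm (z n t) \<le> Y"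
    and L: "\<forall>\<^sub>F n in sequentially. \<forall>t\<in>K. norm (lam z n t) \<le> L"
    and R: "uniform_limit K (residual z) (\<lambda>t. 0) sequentially"
  shows "uniform_limit K (\<lambda>n t. inverse (\<Sum>j<n. 1 / al j) * (\<Sum>j<n. (p j t)\<^sup>2))
    (\<lambda>t. g t * \<bar>l21 t\<bar> / sqrt (Dl t)) sequentially"
proof -
  define w where "w j = 1 / al j" for j
  have w_pos: "w j > 0" for j using al_pos[of j] by (simp add: w_def)
  have wdiv: "filterlim (\<lambda>n. \<Sum>j<n. w j) at_top sequentially" using div by (simp add: w_def)
  have wratio: "(\<lambda>n. w (Suc n) / w n) \<longlonglongrightarrow> 1"
    using tendsto_inverse[OF al_ratio] by (simp add: w_def field_simps)
  obtain Bg where Bg: "\<And>t. t \<in> K \<Longrightarrow> \<bar>g t\<bar> \<le> Bg" using bounded_of_continuous[OF g] by auto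
  have Gb: "\<forall>\<^sub>F n in sequentially. \<forall>t\<in>K. G z n t \<le> Bg + 1"
    using uniform_limitD[OF Glim zero_less_one]
  proof eventually_elim
    case (elim n)
    show ?case
    proof
      fix t assume t: "t \<in> K"
      then have "\<bar>G z n t - g t\<bar> < 1" using elim by (auto simp: dist_real_def)
      then show "G z n t \<le> Bg + 1" using Bg[OF t] by linarith
    qed
  qed
  define S where "S n t = complex_of_real (al n) * (\<phi> z n t)\<^sup>2" for n t
  have normS: "norm (S n t) = G z n t * \<bar>Im (z n t)\<bar>" if "Im (z n t) \<noteq> 0" for n t
    using that al_pos[of n] by (simp add: S_def G_def norm_mult norm_power)
  have Sb: "\<forall>\<^sub>F n in sequentially. \<forall>t\<in>K. norm (S n t) \<le> (Bg + 1) * Y"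
    using yb Y Gb
  proof eventually_elim
    case (elim n)
    show ?case
    proof
      fix t assume t: "t \<in> K"
      have nz: "Im (z n t) \<noteq> 0" using elim(1) t b by fastforce
      have "\<bar>Im (z n t)\<bar> \<le> Y" using abs_Im_le_cmod[of "z n t"] elim(2) t by force
      then show "norm (S n t) \<le> (Bg + 1) * Y"
        unfolding normS[OF nz] using elim(3) t G_pos[of z n t, OF nz] by (intro mult_mono) (auto intro: order_trans[of 0 "G z n t"] less_imp_le)
    qed
  qed
  then obtain n0 where n0: "\<And>n t. n \<ge> n0 \<Longrightarrow> t \<in> K \<Longrightarrow> norm (S n t) \<le> (Bg + 1) * Y"
    by (auto simp: eventually_sequentially)
  \<comment> \<open>The bound on \<open>S\<close> holds from n0 on, whereas the averaging lemma asks
    for it at every index; \<open>S'\<close> cuts off the finitely many others.\<close>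
  define S' where "S' n t = (if n < n0 then 0 else S n t)" for n t
  define B where "B = \<bar>(Bg + 1) * Y\<bar>"
  have B0: "B \<ge> 0" by (simp add: B_def)
  have S'b: "norm (S' n t) \<le> B" if "t \<in> K" for n t
    using n0[of n t] that by (auto simp: S'_def B_def)
  have S'S: "\<forall>\<^sub>F n in sequentially. \<forall>t\<in>K. S' n t = S n t"
    using eventually_ge_at_top[of n0] by eventually_elim (simp add: S'_def)
  define \<kappa> where "\<kappa> t = (complex_of_real (l22 t) - zl t * complex_of_real (l12 t))\<^sup>2" for t
  have \<kappa>1: "norm (\<kappa> t) = 1" "norm (1 - \<kappa> t) = sqrt (Dl t)" if "t \<in> K" for t
    using zl_facts(4,5)[OF that] by (simp_all add: \<kappa>_def norm_power)
  have ratio_lim: "uniform_limit K (\<lambda>n t. complex_of_real (al (Suc n) / al n) * (lam z n t)\<^sup>2) \<kappa> sequentially"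
  proof -
    define h where "h = (\<lambda>(c::real, x::real, w::complex, d::real). complex_of_real c * (complex_of_real x - w * complex_of_real d)\<^sup>2)"
    have "uniform_limit K (\<lambda>n t. h (al (Suc n) / al n, x22 n t, z (Suc n) t, x12 n t)) (\<lambda>t. h (1, l22 t, zl t, l12 t)) sequentially"
    proof (rule uniform_limit_continuous_compose[OF compact_K, where h = h and U = UNIV
        and l = "\<lambda>t. (1, l22 t, zl t, l12 t)"])
      show "continuous_on K (\<lambda>t. (1::real, l22 t, zl t, l12 t))" by (intro continuous_intros cont_l cont_zl)
      have "uniform_limit K (\<lambda>n. z (Suc n)) zl sequentially"
        using zlim by (auto simp: uniform_limit_iff intro: eventually_sequentially_shift)
      then show "uniform_limit K (\<lambda>n t. (al (Suc n) / al n, x22 n t, z (Suc n) t, x12 n t)) (\<lambda>t. (1, l22 t, zl t, l12 t)) sequentially"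
        by (intro uniform_limit_Pair lim22 lim12 uniform_limit_of_real_const al_ratio)
      show "continuous_on UNIV h" unfolding h_def split_beta by (intro continuous_intros)
    qed auto
    then show ?thesis by (simp add: h_def lam_def \<kappa>_def[abs_def])
  qed
  have rot0: "uniform_limit K (\<lambda>n t. S (Suc n) t - \<kappa> t * S n t) (\<lambda>t. 0) sequentially"
  proof -
    let ?u = "\<lambda>n t. complex_of_real (al (Suc n) / al n) * (lam z n t)\<^sup>2 - \<kappa> t"
    \<comment> \<open>The cofactor of the residual after squaring the recurrence of \<phi>. Since
      |q| is at most |\<phi>| / b, it is bounded by a multiple of |S|.\<close>
    let ?Q = "\<lambda>n t. complex_of_real (al (Suc n)) * (2 * lam z n t * \<phi> z n t * of_real (q n t) + residual z n t * (of_real (q n t))\<^sup>2)"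
    have 1: "uniform_limit K (\<lambda>n t. ?u n t * S n t) (\<lambda>t. 0) sequentially"
      using uniform_limit_minus[OF ratio_lim uniform_limit_const[where c = \<kappa> and S = K]]
      by (intro uniform_null_bounded_mult[OF _ Sb]) simp
    have Rb: "\<forall>\<^sub>F n in sequentially. \<forall>t\<in>K. norm (residual z n t) \<le> 1"
      using uniform_limitD[OF R zero_less_one] by eventually_elim (auto simp: less_imp_le)
    have a2: "\<forall>\<^sub>F n in sequentially. al (Suc n) / al n < 2" using al_ratio by (rule order_tendstoD) simp
    have "\<forall>\<^sub>F n in sequentially. \<forall>t\<in>K. norm (?Q n t) \<le> 2 * (2 * L / b + 1 / b\<^sup>2) * ((Bg + 1) * Y)"
      using yb L Sb Rb a2
    proof eventually_elim
      case (elim n)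
      show ?case
      proof
        fix t assume t: "t \<in> K"
        have yn: "b \<le> \<bar>Im (z n t)\<bar>" using elim t by blast
        then have nz: "Im (z n t) \<noteq> 0" using b by auto
        define F where "F = norm (\<phi> z n t)"
        have F0: "F \<ge> 0" by (simp add: F_def)
        have "\<bar>q n t\<bar> \<le> F / \<bar>Im (z n t)\<bar>" unfolding F_def by (rule q_bound[of z n t, OF nz])
        also have "\<dots> \<le> F / b" using yn b F0 by (intro divide_left_mono) auto
        finally have q: "\<bar>q n t\<bar> \<le> F / b" .
        have Ln: "norm (lam z n t) \<le> L" using elim t by blast
        have "norm (?Q n t) \<le> al (Suc n) * (2 * L * F * (F / b) + 1 * (F / b)\<^sup>2)"
        proof -
          have "norm (2 * lam z n t * \<phi> z n t * of_real (q n t) + residual z n t * (of_real (q n t))\<^sup>2)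
            \<le> 2 * norm (lam z n t) * F * \<bar>q n t\<bar> + norm (residual z n t) * \<bar>q n t\<bar>\<^sup>2"
            by (rule order_trans[OF norm_triangle_ineq]) (simp add: norm_mult norm_power F_def)
          also have "\<dots> \<le> 2 * L * F * (F / b) + 1 * (F / b)\<^sup>2"
            using q Ln elim(4) t F0 b order_trans[OF norm_ge_zero Ln]
            by (intro add_mono mult_mono power_mono) auto
          finally show ?thesis
            using al_pos[of "Suc n"] by (simp add: norm_mult mult_left_mono)
        qed
        also have "\<dots> = (al (Suc n) / al n) * (2 * L / b + 1 / b\<^sup>2) * (al n * F\<^sup>2)"
          using al_pos[of n] b by (simp add: power2_eq_square field_simps)
        also have "al n * F\<^sup>2 = norm (S n t)"
          using al_pos[of n] by (simp add: S_def F_def norm_mult norm_power)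
        also have "(al (Suc n) / al n) * (2 * L / b + 1 / b\<^sup>2) * norm (S n t) \<le> 2 * (2 * L / b + 1 / b\<^sup>2) * ((Bg + 1) * Y)"
          using elim(3,5) t b order_trans[OF norm_ge_zero Ln] by (intro mult_mono) auto
        finally show "norm (?Q n t) \<le> 2 * (2 * L / b + 1 / b\<^sup>2) * ((Bg + 1) * Y)" .
      qed
    qed
    then have 2: "uniform_limit K (\<lambda>n t. residual z n t * ?Q n t) (\<lambda>t. 0) sequentially"
      by (rule uniform_null_bounded_mult[OF R])
    have "S (Suc n) t - \<kappa> t * S n t = ?u n t * S n t + residual z n t * ?Q n t" for n t
    proof -
      have "S (Suc n) t = complex_of_real (al (Suc n)) * (lam z n t * \<phi> z n t + residual z n t * of_real (q n t))\<^sup>2"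
        by (simp add: S_def \<phi>_rec)
      also have "\<dots> = complex_of_real (al (Suc n)) * (lam z n t)\<^sup>2 * (\<phi> z n t)\<^sup>2 + residual z n t * ?Q n t"
        by (simp add: power2_eq_square algebra_simps)
      also have "complex_of_real (al (Suc n)) * (lam z n t)\<^sup>2 * (\<phi> z n t)\<^sup>2
         = complex_of_real (al (Suc n) / al n) * (lam z n t)\<^sup>2 * S n t"
        using al_pos[of n] by (simp add: S_def)
      finally show ?thesis by (simp add: algebra_simps)
    qed
    then show ?thesis using uniform_limit_add[OF 1 2] by simp
  qed
  have rot: "uniform_limit K (\<lambda>n t. S' (Suc n) t - \<kappa> t * S' n t) (\<lambda>t. 0) sequentially"
  proof (rule uniform_limit_cong[THEN iffD1, OF _ _ rot0])
    show "\<forall>\<^sub>F n in sequentially. \<forall>t\<in>K. S (Suc n) t - \<kappa> t * S n t = S' (Suc n) t - \<kappa> t * S' n t"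
      using S'S eventually_sequentially_shift[OF S'S] by eventually_elim simp
  qed simp
  have avgS: "uniform_limit K (\<lambda>n t. inverse (\<Sum>j<n. w j) *\<^sub>R (\<Sum>j<n. w j *\<^sub>R S' j t)) (\<lambda>t. 0) sequentially"
  proof (rule rotating_average_null[OF w_pos wdiv wratio _ rot])
    show "norm (S' n t) \<le> B" if "t \<in> K" for n t by (rule S'b[OF that])
    show "sqrt c > 0" using c_pos by simp
    show "sqrt c \<le> norm (1 - \<kappa> t)" "norm (\<kappa> t) \<le> 1" if "t \<in> K" for t
      using \<kappa>1[OF that] Dl_ge[OF that] by simp_all
  qed
  define h where "h t = g t * ((norm (zl t))\<^sup>2 / \<bar>Im (zl t)\<bar>)" for t
  have hc: "continuous_on K h"
    unfolding h_def using zl_facts(2) by (intro continuous_intros g cont_zl) auto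
  have mc: "continuous_on K m"
    unfolding m_def using zl_facts(2) by (intro continuous_intros cont_zl) auto
  have zim: "zl ` K \<subseteq> {u. Im u \<noteq> 0}" using zl_facts(2) by auto
  have op: "open {u. Im u \<noteq> 0}"
    using open_Collect_neq[of Im "\<lambda>_. 0"] by (simp add: continuous_on_Im)
  have hlim: "uniform_limit K (\<lambda>n t. G z n t * ((norm (z n t))\<^sup>2 / \<bar>Im (z n t)\<bar>)) h sequentially"
  proof -
    define H where "H = (\<lambda>(x::real, u::complex). x * ((norm u)\<^sup>2 / \<bar>Im u\<bar>))"
    have "uniform_limit K (\<lambda>n t. H (G z n t, z n t)) (\<lambda>t. H (g t, zl t)) sequentially"
    proof (rule uniform_limit_continuous_compose[OF compact_K, where h = H and U = "UNIV \<times> {u. Im u \<noteq> 0}"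
        and l = "\<lambda>t. (g t, zl t)"])
      show "continuous_on (UNIV \<times> {u. Im u \<noteq> 0}) H" unfolding H_def split_beta
        by (intro continuous_intros) auto
      show "uniform_limit K (\<lambda>n t. (G z n t, z n t)) (\<lambda>t. (g t, zl t)) sequentially"
        by (intro uniform_limit_Pair Glim zlim)
    qed (use zim op in \<open>auto intro!: continuous_intros g cont_zl open_Times\<close>)
    then show ?thesis by (simp add: H_def h_def[abs_def])
  qed
  have mlim: "uniform_limit K (\<lambda>n t. (cnj (z n t) / of_real (Im (z n t)))\<^sup>2) m sequentially"
  proof -
    have "uniform_limit K (\<lambda>n t. (\<lambda>u. (cnj u / of_real (Im u))\<^sup>2) (z n t)) (\<lambda>t. (\<lambda>u. (cnj u / of_real (Im u))\<^sup>2) (zl t)) sequentially"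
      by (rule uniform_limit_continuous_compose[OF compact_K cont_zl zlim op zim])
         (auto intro!: continuous_intros)
    then show ?thesis by (simp add: m_def[abs_def])
  qed
  define e where "e n t = al n * (p n t)\<^sup>2 - (h t - Re (m t * S' n t)) / 2" for n t
  have e0: "uniform_limit K e (\<lambda>t. 0) sequentially"
  proof -
    have "uniform_limit K (\<lambda>n t. ((cnj (z n t) / of_real (Im (z n t)))\<^sup>2 - m t) * S n t) (\<lambda>t. 0) sequentially"
      using uniform_limit_minus[OF mlim uniform_limit_const[where c = m and S = K]]
      by (intro uniform_null_bounded_mult[OF _ Sb]) simp
    from bounded_linear.uniform_limit[OF bounded_linear_Re this]
    have 1: "uniform_limit K (\<lambda>n t. Re (((cnj (z n t) / of_real (Im (z n t)))\<^sup>2 - m t) * S n t)) (\<lambda>t. 0) sequentially"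
      by simp
    have 2: "uniform_limit K (\<lambda>n t. G z n t * ((norm (z n t))\<^sup>2 / \<bar>Im (z n t)\<bar>) - h t) (\<lambda>t. h t - h t) sequentially"
      by (intro uniform_limit_minus hlim uniform_limit_const)
    have "uniform_limit K (\<lambda>n t. ((G z n t * ((norm (z n t))\<^sup>2 / \<bar>Im (z n t)\<bar>) - h t)
        - Re (((cnj (z n t) / of_real (Im (z n t)))\<^sup>2 - m t) * S n t)) * (1 / 2)) (\<lambda>t. 0) sequentially"
      using bounded_linear.uniform_limit[OF bounded_linear_mult_left uniform_limit_minus[OF 2 1], of "1 / 2"]
      by simp
    then show ?thesis
    proof (rule uniform_limit_cong[THEN iffD1, rotated 2])
      show "\<forall>\<^sub>F n in sequentially. \<forall>t\<in>K. ((G z n t * ((norm (z n t))\<^sup>2 / \<bar>Im (z n t)\<bar>) - h t)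
        - Re (((cnj (z n t) / of_real (Im (z n t)))\<^sup>2 - m t) * S n t)) * (1 / 2) = e n t"
        using yb S'S
      proof eventually_elim
        case (elim n)
        show ?case
        proof
          fix t assume t: "t \<in> K"
          have nz: "Im (z n t) \<noteq> 0" using elim(1) t b by fastforce
          have "S' n t = S n t" using elim t by blast
          then show "((G z n t * ((norm (z n t))\<^sup>2 / \<bar>Im (z n t)\<bar>) - h t)
            - Re (((cnj (z n t) / of_real (Im (z n t)))\<^sup>2 - m t) * S n t)) * (1 / 2) = e n t"
            unfolding e_def p_square[of z n t, OF nz] S_def by (simp only: left_diff_distrib minus_complex.sel) (simp add: diff_divide_distrib)
        qed
      qed
    qed simp
  qed
  obtain Bh Bm where Bh: "\<And>t. t \<in> K \<Longrightarrow> \<bar>h t\<bar> \<le> Bh" and Bm: "\<And>t. t \<in> K \<Longrightarrow> norm (m t) \<le> Bm"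
    using bounded_of_continuous[OF hc] bounded_of_continuous[OF mc] by auto
  have eb: "bounded (e n ` K)" for n
  proof -
    have "continuous_on K (\<lambda>t. al n * (p n t)\<^sup>2)" by (intro continuous_intros cont_pq)
    then obtain Bp where Bp: "\<And>t. t \<in> K \<Longrightarrow> \<bar>al n * (p n t)\<^sup>2\<bar> \<le> Bp"
      using bounded_of_continuous by fastforce
    have "norm (e n t) \<le> Bp + (Bh + Bm * B) / 2" if t: "t \<in> K" for t
    proof -
      have "\<bar>Re (m t * S' n t)\<bar> \<le> norm (m t) * norm (S' n t)"
        using abs_Re_le_cmod[of "m t * S' n t"] by (simp add: norm_mult)
      also have "\<dots> \<le> Bm * B"
        using S'b[OF t] Bm[OF t] order_trans[OF norm_ge_zero Bm[OF t]] by (intro mult_mono) auto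
      finally have 1: "\<bar>Re (m t * S' n t)\<bar> \<le> Bm * B" .
      have "\<bar>x - (y - u) / 2\<bar> \<le> x' + (y' + u') / 2" if "\<bar>x\<bar> \<le> x'" "\<bar>y\<bar> \<le> y'" "\<bar>u\<bar> \<le> u'" for x y u x' y' u' :: real
        using that unfolding abs_le_iff by (elim conjE, intro conjI) (simp_all add: field_simps)
      from this[OF Bp[OF t] Bh[OF t] 1] show ?thesis unfolding e_def real_norm_def .
    qed
    then show ?thesis unfolding bounded_iff by blast
  qed
  have avge: "uniform_limit K (\<lambda>n t. inverse (\<Sum>j<n. w j) *\<^sub>R (\<Sum>j<n. w j *\<^sub>R e j t)) (\<lambda>t. 0) sequentially"
    by (rule weighted_average_null[OF w_pos wdiv e0 eb])
  have avgm: "uniform_limit K (\<lambda>n t. Re ((inverse (\<Sum>j<n. w j) *\<^sub>R (\<Sum>j<n. w j *\<^sub>R S' j t)) * m t) * (1 / 2)) (\<lambda>t. 0) sequentially"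
  proof -
    have "\<forall>\<^sub>F n in sequentially. \<forall>t\<in>K. norm (m t) \<le> Bm" using Bm by simp
    from uniform_null_bounded_mult[OF avgS this]
    have "uniform_limit K (\<lambda>n t. (inverse (\<Sum>j<n. w j) *\<^sub>R (\<Sum>j<n. w j *\<^sub>R S' j t)) * m t) (\<lambda>t. 0) sequentially" .
    from bounded_linear.uniform_limit[OF bounded_linear_mult_left bounded_linear.uniform_limit[OF bounded_linear_Re this], of "1 / 2"]
    show ?thesis by simp
  qed
  have fin: "uniform_limit K (\<lambda>n t. (inverse (\<Sum>j<n. w j) *\<^sub>R (\<Sum>j<n. w j *\<^sub>R e j t)
      - Re ((inverse (\<Sum>j<n. w j) *\<^sub>R (\<Sum>j<n. w j *\<^sub>R S' j t)) * m t) * (1 / 2)) + h t / 2) (\<lambda>t. (0 - 0) + h t / 2) sequentially"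
    by (intro uniform_limit_add uniform_limit_minus avge avgm uniform_limit_const)
  have lim: "uniform_limit K (\<lambda>n t. inverse (\<Sum>j<n. 1 / al j) * (\<Sum>j<n. (p j t)\<^sup>2)) (\<lambda>t. (0 - 0) + h t / 2) sequentially"
  proof (rule uniform_limit_cong[THEN iffD1, OF _ _ fin])
    have "\<forall>\<^sub>F n in sequentially. (\<Sum>j<n. w j) > 0" using wdiv by (simp add: filterlim_at_top_dense)
    then show "\<forall>\<^sub>F n in sequentially. \<forall>t\<in>K. (inverse (\<Sum>j<n. w j) *\<^sub>R (\<Sum>j<n. w j *\<^sub>R e j t)
      - Re ((inverse (\<Sum>j<n. w j) *\<^sub>R (\<Sum>j<n. w j *\<^sub>R S' j t)) * m t) * (1 / 2)) + h t / 2
      = inverse (\<Sum>j<n. 1 / al j) * (\<Sum>j<n. (p j t)\<^sup>2)"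
    proof eventually_elim
      case (elim n)
      show ?case
      proof
        fix t assume t: "t \<in> K"
        have we: "w j * e j t = (p j t)\<^sup>2 - w j * (h t / 2) + Re ((w j *\<^sub>R S' j t) * m t) * (1 / 2)" for j
          using al_pos[of j] unfolding e_def w_def by (simp add: field_simps)
        have "(\<Sum>j<n. w j *\<^sub>R e j t) = (\<Sum>j<n. (p j t)\<^sup>2) - (\<Sum>j<n. w j) * (h t / 2)
           + Re ((\<Sum>j<n. w j *\<^sub>R S' j t) * m t) * (1 / 2)"
          by (simp only: real_scaleR_def we sum.distrib sum_subtractf sum_distrib_right Re_sum)
        moreover have "(inverse V *\<^sub>R A - Re ((inverse V *\<^sub>R T) * u) * (1 / 2)) + x / 2 = inverse V * Q"
          if "A = Q - V * (x / 2) + Re (T * u) * (1 / 2)" "V > 0" for A Q V x :: real and T u :: complex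
        proof -
          have "Re ((inverse V *\<^sub>R T) * u) = inverse V * Re (T * u)" by (simp add: right_diff_distrib)
          moreover have "inverse V * (V * (x / 2)) = x / 2" using that(2) by simp
          ultimately show ?thesis unfolding that(1) real_scaleR_def distrib_left right_diff_distrib by simp
        qed
        ultimately show "(inverse (\<Sum>j<n. w j) *\<^sub>R (\<Sum>j<n. w j *\<^sub>R e j t)
            - Re ((inverse (\<Sum>j<n. w j) *\<^sub>R (\<Sum>j<n. w j *\<^sub>R S' j t)) * m t) * (1 / 2)) + h t / 2
          = inverse (\<Sum>j<n. 1 / al j) * (\<Sum>j<n. (p j t)\<^sup>2)"
          using elim unfolding w_def[symmetric] by blast
      qed
    qed
  qed simp
  show ?thesis
  proof (rule uniform_limit_cong[THEN iffD1, OF _ _ lim])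
    fix t assume "t \<in> K"
    from zl_facts(3)[OF this] show "(0 - 0) + h t / 2 = g t * \<bar>l21 t\<bar> / sqrt (Dl t)"
      by (simp add: h_def)
  qed simp
qed

end

section \<open>Freezing the fixed point at one point of K\<close>

context elliptic_recurrence
begin

text \<open>Replacing z n t by the constant zl t0 changes \<phi> by |z n t - zl t0| |q|, which is
  small relative to |\<phi>| by \<open>q_bound\<close>. A constant is required because the contour
  argument for Bernstein-Szego densities works with a polynomial denominator.\<close>

theorem amplitude_joint_limit:
  assumes zlim: "uniform_limit K z zl sequentially"
    and g: "continuous_on K g" and Glim: "uniform_limit K (G z) g sequentially"
    and gp: "g t0 > 0" and t0: "t0 \<in> K"
  shows "((\<lambda>x. \<bar>Im (zl t0)\<bar> / (pi * (al (fst x) *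
      (norm (p (fst x) (snd x) - zl t0 * q (fst x) (snd x)))\<^sup>2))) \<longlongrightarrow> 1 / (pi * g t0))
    (sequentially \<times>\<^sub>F inf (nhds t0) (principal K))" (is "(_ \<longlongrightarrow> _) ?F")
proof -
  define y0 where "y0 = Im (zl t0)"
  have y0: "y0 \<noteq> 0" using zl_facts(2)[OF t0] by (simp add: y0_def)
  define Z where "Z x = z (fst x) (snd x)" for x
  have Zl: "(Z \<longlongrightarrow> zl t0) ?F" unfolding Z_def by (rule uniform_limit_joint[OF zlim cont_zl t0])
  have Gl: "((\<lambda>x. G z (fst x) (snd x)) \<longlongrightarrow> g t0) ?F" by (rule uniform_limit_joint[OF Glim g t0])
  define A where "A x = G z (fst x) (snd x) * \<bar>Im (Z x)\<bar> / \<bar>y0\<bar>" for x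
  define d where "d x = norm (Z x - zl t0)" for x
  define H where "H x = al (fst x) * (norm (p (fst x) (snd x) - zl t0 * q (fst x) (snd x)))\<^sup>2 / \<bar>y0\<bar>" for x
  have Al: "(A \<longlongrightarrow> g t0 * \<bar>y0\<bar> / \<bar>y0\<bar>) ?F"
    unfolding A_def y0_def by (intro tendsto_intros Gl Zl) (use y0 y0_def in auto)
  have dl: "(d \<longlongrightarrow> 0) ?F" unfolding d_def using Zl by (rule tendsto_norm_zero[OF LIM_zero])
  have yl: "((\<lambda>x. \<bar>Im (Z x)\<bar>) \<longlongrightarrow> \<bar>y0\<bar>) ?F" unfolding y0_def by (intro tendsto_intros Zl)
  have El: "((\<lambda>x. A x * (2 * d x / \<bar>Im (Z x)\<bar> + (d x)\<^sup>2 / \<bar>Im (Z x)\<bar>\<^sup>2)) \<longlongrightarrow> g t0 * \<bar>y0\<bar> / \<bar>y0\<bar> * (2 * 0 / \<bar>y0\<bar> + 0\<^sup>2 / \<bar>y0\<bar>\<^sup>2)) ?F"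
    by (intro tendsto_intros Al dl yl) (use y0 in auto)
  have ev: "\<forall>\<^sub>F x in ?F. Im (Z x) \<noteq> 0"
    using tendsto_imp_eventually_ne[OF tendsto_Im[OF Zl]] y0 y0_def by simp
  have le: "\<forall>\<^sub>F x in ?F. norm (H x - A x) \<le> A x * (2 * d x / \<bar>Im (Z x)\<bar> + (d x)\<^sup>2 / \<bar>Im (Z x)\<bar>\<^sup>2)"
    using ev
  proof eventually_elim
    case (elim x)
    define n t where "n = fst x" and "t = snd x"
    have nz: "Im (z n t) \<noteq> 0" using elim by (simp add: Z_def n_def t_def)
    define f y where "f = \<phi> z n t" and "y = \<bar>Im (z n t)\<bar>"
    define u where "u = (z n t - zl t0) * of_real (q n t)"
    have y: "y > 0" using nz by (simp add: y_def)
    have "norm u \<le> d x * (norm f / y)"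
      unfolding u_def norm_mult d_def Z_def n_def[symmetric] t_def[symmetric] f_def y_def
      using q_bound[of z n t, OF nz] by (intro mult_left_mono) auto
    then have u: "norm u \<le> d x / y * norm f" by simp
    have e: "complex_of_real (p n t) - zl t0 * q n t = f + u"
      by (simp add: f_def u_def \<phi>_def algebra_simps)
    have "\<bar>(norm (f + u))\<^sup>2 - (norm f)\<^sup>2\<bar> \<le> 2 * norm f * norm u + (norm u)\<^sup>2"
    proof -
      have "norm (f + u) \<le> norm f + norm u" "norm f \<le> norm (f + u) + norm u"
        using norm_triangle_ineq[of f u] norm_triangle_ineq4[of "f + u" u] by simp_all
      then have 1: "\<bar>norm (f + u) - norm f\<bar> \<le> norm u" by simp
      have 2: "norm (f + u) + norm f \<le> 2 * norm f + norm u" using norm_triangle_ineq[of f u] by simp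
      have "\<bar>(norm (f + u))\<^sup>2 - (norm f)\<^sup>2\<bar> = \<bar>norm (f + u) - norm f\<bar> * (norm (f + u) + norm f)"
        by (simp add: abs_mult power2_eq_square square_diff_square_factored mult.commute)
      also have "\<dots> \<le> norm u * (2 * norm f + norm u)" by (intro mult_mono 1 2) auto
      finally show ?thesis by (simp add: algebra_simps power2_eq_square)
    qed
    also have "\<dots> \<le> 2 * norm f * (d x / y * norm f) + (d x / y * norm f)\<^sup>2"
      by (intro add_mono mult_left_mono power_mono u) auto
    finally have "\<bar>(norm (f + u))\<^sup>2 - (norm f)\<^sup>2\<bar> \<le> (norm f)\<^sup>2 * (2 * d x / y + (d x)\<^sup>2 / y\<^sup>2)"
      by (simp add: power_mult_distrib power_divide power2_eq_square algebra_simps)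
    then have "al n / \<bar>y0\<bar> * \<bar>(norm (f + u))\<^sup>2 - (norm f)\<^sup>2\<bar> \<le> al n / \<bar>y0\<bar> * ((norm f)\<^sup>2 * (2 * d x / y + (d x)\<^sup>2 / y\<^sup>2))"
      using al_pos[of n] by (intro mult_left_mono) auto
    moreover have "A x = al n / \<bar>y0\<bar> * (norm f)\<^sup>2"
      unfolding A_def G_def Z_def n_def[symmetric] t_def[symmetric] f_def using nz by simp
    moreover have "H x = al n / \<bar>y0\<bar> * (norm (f + u))\<^sup>2"
      unfolding H_def n_def[symmetric] t_def[symmetric] e by simp
    moreover have "\<bar>al n / \<bar>y0\<bar> * (norm (f + u))\<^sup>2 - al n / \<bar>y0\<bar> * (norm f)\<^sup>2\<bar> = al n / \<bar>y0\<bar> * \<bar>(norm (f + u))\<^sup>2 - (norm f)\<^sup>2\<bar>"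
      unfolding right_diff_distrib[symmetric] using al_pos[of n] by (simp add: abs_mult)
    ultimately show ?case
      unfolding real_norm_def Z_def n_def[symmetric] t_def[symmetric] y_def[symmetric] by simp
  qed
  have "((\<lambda>x. H x - A x) \<longlongrightarrow> 0) ?F"
    by (rule Lim_null_comparison[OF le]) (use El in simp)
  from tendsto_add[OF this Al] have Hl: "(H \<longlongrightarrow> g t0) ?F" using y0 by simp
  have "((\<lambda>x. 1 / (pi * H x)) \<longlongrightarrow> 1 / (pi * g t0)) ?F"
    by (intro tendsto_intros Hl) (use gp in auto)
  then show ?thesis unfolding H_def y0_def[symmetric] using y0 by simp
qed

text \<open>The limit of \<open>G\<close> bounds al |\<phi>|^2 from below, and |\<phi>|^2 is at most
  2 Y^2 (p^2 + q^2). A convergent series would therefore majorise the divergent one of 1 / al. This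
  will exclude atoms of \<mu> in K.\<close>

theorem not_square_summable:
  assumes zlim: "uniform_limit K z zl sequentially"
    and Glim: "uniform_limit K (G z) g sequentially" and gp: "g t > 0" and t: "t \<in> K"
  shows "\<not> summable (\<lambda>n. (p n t)\<^sup>2 + (q n t)\<^sup>2)"
proof
  assume s: "summable (\<lambda>n. (p n t)\<^sup>2 + (q n t)\<^sup>2)"
  have Zl: "(\<lambda>n. z n t) \<longlonglongrightarrow> zl t" by (rule tendsto_uniform_limitI[OF zlim t])
  have Gl: "(\<lambda>n. G z n t) \<longlonglongrightarrow> g t" by (rule tendsto_uniform_limitI[OF Glim t])
  define c1 where "c1 = g t * \<bar>Im (zl t)\<bar>"
  have c1: "c1 > 0" using gp zl_facts(2)[OF t] by (simp add: c1_def)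
  have "(\<lambda>n. G z n t * \<bar>Im (z n t)\<bar>) \<longlonglongrightarrow> c1" unfolding c1_def by (intro tendsto_intros Zl Gl)
  then have 1: "\<forall>\<^sub>F n in sequentially. G z n t * \<bar>Im (z n t)\<bar> > c1 / 2" using c1 by (intro order_tendstoD) auto
  have "(\<lambda>n. Im (z n t)) \<longlonglongrightarrow> Im (zl t)" by (intro tendsto_intros Zl)
  then have 2: "\<forall>\<^sub>F n in sequentially. Im (z n t) \<noteq> 0"
    using zl_facts(2)[OF t] by (intro tendsto_imp_eventually_ne)
  define Y where "Y = norm (zl t) + 1"
  have Y: "Y \<ge> 1" by (simp add: Y_def)
  have 3: "\<forall>\<^sub>F n in sequentially. norm (z n t) < Y"
    by (rule order_tendstoD(2)[OF tendsto_norm[OF Zl]]) (simp add: Y_def)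
  have "\<forall>\<^sub>F n in sequentially. norm (1 / al n) \<le> 4 * Y\<^sup>2 / c1 * ((p n t)\<^sup>2 + (q n t)\<^sup>2)"
    using 1 2 3
  proof eventually_elim
    case (elim n)
    have "al n * (norm (\<phi> z n t))\<^sup>2 = G z n t * \<bar>Im (z n t)\<bar>" using elim by (simp add: G_def)
    then have a: "c1 / 2 \<le> al n * (norm (\<phi> z n t))\<^sup>2" using elim by simp
    have "norm (\<phi> z n t) \<le> \<bar>p n t\<bar> + norm (z n t) * \<bar>q n t\<bar>"
      unfolding \<phi>_def by (rule order_trans[OF norm_triangle_ineq4]) (simp add: norm_mult)
    also have "\<dots> \<le> Y * \<bar>p n t\<bar> + Y * \<bar>q n t\<bar>"
      using elim Y by (intro add_mono mult_right_mono) (auto simp: mult_le_cancel_right1)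
    finally have "norm (\<phi> z n t) \<le> Y * (\<bar>p n t\<bar> + \<bar>q n t\<bar>)" by (simp add: distrib_left)
    then have "(norm (\<phi> z n t))\<^sup>2 \<le> (Y * (\<bar>p n t\<bar> + \<bar>q n t\<bar>))\<^sup>2" by (rule power_mono) simp
    also have "\<dots> \<le> Y\<^sup>2 * (2 * ((p n t)\<^sup>2 + (q n t)\<^sup>2))"
      unfolding power_mult_distrib using sum_squares_bound[of "\<bar>p n t\<bar>" "\<bar>q n t\<bar>"]
      by (intro mult_left_mono) (auto simp: power2_sum)
    finally have "al n * (norm (\<phi> z n t))\<^sup>2 \<le> al n * (Y\<^sup>2 * (2 * ((p n t)\<^sup>2 + (q n t)\<^sup>2)))"
      using al_pos[of n] by (intro mult_left_mono) auto
    with a have "c1 / 2 \<le> al n * (Y\<^sup>2 * (2 * ((p n t)\<^sup>2 + (q n t)\<^sup>2)))" by simp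
    then show ?case using al_pos[of n] c1 by (simp add: field_simps)
  qed
  from summable_comparison_test_ev[OF this summable_mult[OF s]] have sm: "summable (\<lambda>n. 1 / al n)" .
  have "(\<Sum>j<n. 1 / al j) \<le> (\<Sum>j. 1 / al j)" for n
    using al_pos by (intro sum_le_suminf sm) (auto simp: less_imp_le)
  moreover have "\<forall>\<^sub>F n in sequentially. (\<Sum>j<n. 1 / al j) > (\<Sum>j. 1 / al j)"
    using div by (simp add: filterlim_at_top_dense)
  ultimately show False by (metis (no_types, lifting) eventually_sequentially linorder_not_le order_refl)
qed

end

section \<open>Continuous densities and the distribution function\<close>

lemma nn_integral_continuous_Icc:
  fixes w :: "real \<Rightarrow> real"
  assumes w: "continuous_on {a..b} w" and nonneg: "\<And>x. x \<in> {a..b} \<Longrightarrow> 0 \<le> w x"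
  shows "(\<integral>\<^sup>+x\<in>{a..b}. ennreal (w x) \<partial>lborel) = ennreal (integral {a..b} w)"
proof -
  have si: "set_integrable lborel {a..b} w" by (rule borel_integrable_atLeastAtMost'[OF w])
  have "(\<integral>\<^sup>+x\<in>{a..b}. ennreal (w x) \<partial>lborel) = (\<integral>\<^sup>+x. ennreal (indicator {a..b} x *\<^sub>R w x) \<partial>lborel)"
    by (intro nn_integral_cong) (auto simp: indicator_def)
  also have "\<dots> = ennreal (\<integral>x. indicator {a..b} x *\<^sub>R w x \<partial>lborel)"
    using si nonneg unfolding set_integrable_def
    by (intro nn_integral_eq_integral) (auto simp: indicator_def intro!: AE_I2)
  also have "(\<integral>x. indicator {a..b} x *\<^sub>R w x \<partial>lborel) = integral {a..b} w"
    using set_borel_integral_eq_integral(2)[OF si] by (simp add: set_lebesgue_integral_def)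
  finally show ?thesis .
qed

context real_distribution
begin

text \<open>The restriction of M to the interval and the measure with density w there agree on all
  half lines, by the fundamental theorem of calculus. Increments of the distribution function from
  \<open>k1\<close> on do not see mass at \<open>k1\<close> itself, hence the assumption on that
  point.\<close>

lemma density_of_cdf_derivative:
  assumes k: "k1 < k2" and w: "continuous_on {k1..k2} w" and pos: "\<And>t. t \<in> {k1..k2} \<Longrightarrow> 0 < w t"
    and deriv: "\<And>t. t \<in> {k1..k2} \<Longrightarrow> (cdf M has_vector_derivative w t) (at t within {k1..k2})"
    and atom: "measure M {k1} = 0"
  shows "is_continuous_density_on M {k1..k2} w"
proof -
  let ?K = "{k1..k2}"
  define wK where "wK x = indicator ?K x *\<^sub>R w x" for x
  have Wm [measurable]: "wK \<in> borel_measurable borel"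
    unfolding wK_def by (rule borel_measurable_continuous_on_indicator) (use w in auto)
  define M1 where "M1 = density M (indicator ?K)"
  define M2 where "M2 = density lborel (\<lambda>x. ennreal (wK x))"
  have e1: "emeasure M1 A = emeasure M (A \<inter> ?K)" if "A \<in> sets borel" for A
  proof -
    have "emeasure M1 A = (\<integral>\<^sup>+x. indicator ?K x * indicator A x \<partial>M)"
      unfolding M1_def using that by (intro emeasure_density) auto
    also have "\<dots> = (\<integral>\<^sup>+x. indicator (A \<inter> ?K) x \<partial>M)" by (intro nn_integral_cong) (auto simp: indicator_def)
    finally show ?thesis using that by simp
  qed
  have e2: "emeasure M2 A = (\<integral>\<^sup>+x\<in>A \<inter> ?K. ennreal (w x) \<partial>lborel)" if "A \<in> sets borel" for A
  proof -
    have "emeasure M2 A = (\<integral>\<^sup>+x. ennreal (wK x) * indicator A x \<partial>lborel)"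
      unfolding M2_def using that by (intro emeasure_density) auto
    also have "\<dots> = (\<integral>\<^sup>+x\<in>A \<inter> ?K. ennreal (w x) \<partial>lborel)"
      by (intro nn_integral_cong) (auto simp: indicator_def wK_def)
    finally show ?thesis .
  qed
  have half: "emeasure M1 {..x} = emeasure M2 {..x}" for x
  proof (cases "x < k1")
    case True
    then have "{..x} \<inter> ?K = {}" by auto
    then show ?thesis by (simp add: e1 e2)
  next
    case False
    define y where "y = min x k2"
    have y: "k1 \<le> y" "y \<le> k2" using False k by (auto simp: y_def)
    have eq: "{..x} \<inter> ?K = {k1..y}" by (auto simp: y_def)
    have "measure M {k1..y} = measure M {k1} + measure M {k1<..y}"
    proof -
      have "{k1..y} = {k1} \<union> {k1<..y}" using y by auto
      show ?thesis unfolding \<open>{k1..y} = {k1} \<union> {k1<..y}\<close> by (rule finite_measure_Union) auto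
    qed
    also have "measure M {k1<..y} = cdf M y - cdf M k1"
      using cdf_diff_eq[of k1 y] y by (cases "k1 = y") auto
    finally have m: "measure M {k1..y} = cdf M y - cdf M k1" using atom by simp
    have "(w has_integral (cdf M y - cdf M k1)) {k1..y}"
    proof (rule fundamental_theorem_of_calculus[OF y(1)])
      fix t assume "t \<in> {k1..y}"
      then show "(cdf M has_vector_derivative w t) (at t within {k1..y})"
        using y by (intro has_vector_derivative_within_subset[OF deriv]) auto
    qed
    then have "integral {k1..y} w = cdf M y - cdf M k1" by (rule integral_unique)
    moreover have "(\<integral>\<^sup>+x\<in>{k1..y}. ennreal (w x) \<partial>lborel) = ennreal (integral {k1..y} w)"
      using pos y by (intro nn_integral_continuous_Icc continuous_on_subset[OF w]) (auto simp: less_imp_le)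
    ultimately show ?thesis using m e1[of "{..x}"] e2[of "{..x}"] unfolding eq by (simp add: emeasure_eq_measure)
  qed
  have f1: "finite_borel_measure M1"
  proof -
    have "emeasure M1 (space M1) \<noteq> \<infinity>"
      using e1[of UNIV] by (simp add: M1_def emeasure_eq_measure)
    then have "finite_measure M1" by (rule finite_measureI)
    then show ?thesis by (simp add: finite_borel_measure_def finite_borel_measure_axioms_def M1_def)
  qed
  have f2: "finite_borel_measure M2"
  proof -
    have "emeasure M2 UNIV = ennreal (integral ?K w)"
      using e2[of UNIV] nn_integral_continuous_Icc[OF w] pos by (simp add: less_imp_le)
    then have "emeasure M2 (space M2) \<noteq> \<infinity>" by (simp add: M2_def)
    then have "finite_measure M2" by (rule finite_measureI)
    then show ?thesis by (simp add: finite_borel_measure_def finite_borel_measure_axioms_def M2_def)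
  qed
  have "cdf M1 = cdf M2"
    by (rule ext) (simp add: cdf_def measure_def half)
  then have "M1 = M2" by (rule cdf_unique'[OF f1 f2])
  then have "emeasure M A = (\<integral>\<^sup>+x\<in>A. ennreal (w x) \<partial>lborel)" if "A \<in> sets borel" "A \<subseteq> ?K" for A
    using e1[OF that(1)] e2[OF that(1)] that(2) by (simp add: Int_absorb2)
  then show ?thesis unfolding is_continuous_density_on_def using w pos by blast
qed

lemma cdf_derivative_of_density:
  assumes k: "k1 < k2" and d: "is_continuous_density_on M {k1..k2} w" and t: "t \<in> {k1..k2}"
  shows "(cdf M has_vector_derivative w t) (at t within {k1..k2})"
proof -
  have w: "continuous_on {k1..k2} w" and pos: "\<And>t. t \<in> {k1..k2} \<Longrightarrow> 0 < w t"
    and em: "\<And>A. A \<in> sets borel \<Longrightarrow> A \<subseteq> {k1..k2} \<Longrightarrow> emeasure M A = (\<integral>\<^sup>+x\<in>A. ennreal (w x) \<partial>lborel)"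
    using d by (auto simp: is_continuous_density_on_def)
  have m: "measure M {k1..y} = integral {k1..y} w" if y: "y \<in> {k1..k2}" for y
  proof -
    have "ennreal (measure M {k1..y}) = ennreal (integral {k1..y} w)"
      using em[of "{k1..y}"] nn_integral_continuous_Icc[of k1 y w] y pos continuous_on_subset[OF w, of "{k1..y}"]
      by (auto simp: emeasure_eq_measure less_imp_le)
    moreover have "0 \<le> integral {k1..y} w" using pos y
      by (intro integral_nonneg integrable_continuous_interval continuous_on_subset[OF w]) (auto simp: less_imp_le)
    ultimately show ?thesis by simp
  qed
  have cdf: "cdf M y = cdf M k1 + integral {k1..y} w" if y: "y \<in> {k1..k2}" for y
  proof -
    have "measure M {k1} = 0" using m[of k1] k by simp
    moreover have "measure M {k1..y} = measure M {k1} + measure M {k1<..y}"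
    proof -
      have "{k1..y} = {k1} \<union> {k1<..y}" using y by auto
      show ?thesis unfolding \<open>{k1..y} = {k1} \<union> {k1<..y}\<close> by (rule finite_measure_Union) auto
    qed
    moreover have "measure M {k1<..y} = cdf M y - cdf M k1"
      using cdf_diff_eq[of k1 y] y by (cases "k1 = y") auto
    ultimately show ?thesis using m[OF y] by simp
  qed
  have "((\<lambda>y. cdf M k1 + integral {k1..y} w) has_vector_derivative 0 + w t) (at t within {k1..k2})"
    by (intro has_vector_derivative_add has_vector_derivative_const integral_has_vector_derivative w t)
  then have "((\<lambda>y. cdf M k1 + integral {k1..y} w) has_vector_derivative w t) (at t within {k1..k2})"
    by simp
  then show ?thesis
    using has_vector_derivative_transform[OF t, of "cdf M" "\<lambda>y. cdf M k1 + integral {k1..y} w" "w t"] cdf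
    by blast
qed

text \<open>Both densities are the derivative of the same distribution function at every point, end
  points included. This pins down the values of \<open>continuous_density_on\<close>, which is
  defined by choice.\<close>

lemma density_unique:
  assumes k: "k1 < k2" and d: "is_continuous_density_on M {k1..k2} w" "is_continuous_density_on M {k1..k2} w'"
    and t: "t \<in> {k1..k2}"
  shows "w t = w' t"
  using vector_derivative_unique_within_closed_interval[of k1 k2 t "cdf M" "w t" "w' t"] k t
    cdf_derivative_of_density[OF k d(1) t] cdf_derivative_of_density[OF k d(2) t] by simp

text \<open>On a short interval [a, b] in K near t0 the mass of \<nu> l differs from w0 (b - a) by
  at most e / 2 (b - a), for all large l at once. The end points carry no mass, so the distribution
  functions converge there and the estimate passes to M.\<close>

lemma cdf_derivative_of_weak_limit:
  assumes weak: "weak_conv_m \<nu> M"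
    and \<nu>: "\<And>l. \<nu> l = density lborel (\<lambda>x. ennreal (f l x))" "\<And>l. real_distribution (\<nu> l)"
    and f: "\<And>l. continuous_on UNIV (f l)" "\<And>l x. 0 \<le> f l x"
    and atoms: "\<And>t. t \<in> K \<Longrightarrow> measure M {t} = 0" and K: "is_interval K" and t0: "t0 \<in> K"
    and lim: "((\<lambda>x. f (fst x) (snd x)) \<longlongrightarrow> w0) (sequentially \<times>\<^sub>F inf (nhds t0) (principal K))"
  shows "(cdf M has_vector_derivative w0) (at t0 within K)"
proof -
  have "((\<lambda>y. (cdf M y - cdf M t0) / (y - t0)) \<longlongrightarrow> w0) (at t0 within K)"
  proof (rule tendstoI)
    fix e :: real assume e: "e > 0"
    have "\<forall>\<^sub>F x in sequentially \<times>\<^sub>F inf (nhds t0) (principal K). dist (f (fst x) (snd x)) w0 < e / 2"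
      using lim e by (intro tendstoD) auto
    then obtain P Q where P: "eventually P sequentially" and Q: "eventually Q (inf (nhds t0) (principal K))"
      and PQ: "\<And>l t. P l \<Longrightarrow> Q t \<Longrightarrow> dist (f l t) w0 < e / 2"
      unfolding eventually_prod_filter by auto
    obtain d where d: "d > 0" "\<And>t. t \<in> K \<Longrightarrow> dist t t0 < d \<Longrightarrow> Q t"
      using Q unfolding eventually_inf_principal eventually_nhds_metric by blast
    have main: "\<bar>(cdf M b - cdf M a) - w0 * (b - a)\<bar> \<le> e / 2 * (b - a)"
      if ab: "a < b" "a \<in> K" "b \<in> K" "\<bar>a - t0\<bar> < d" "\<bar>b - t0\<bar> < d" for a b
    proof -
      have "\<forall>\<^sub>F l in sequentially. \<bar>(cdf (\<nu> l) b - cdf (\<nu> l) a) - w0 * (b - a)\<bar> \<le> e / 2 * (b - a)"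
        using P
      proof eventually_elim
        case (elim l)
        interpret N: real_distribution "\<nu> l" by (rule \<nu>)
        have near: "\<bar>f l t - w0\<bar> \<le> e / 2" if "t \<in> {a..b}" for t
        proof -
          have "t \<in> K" using K ab that unfolding is_interval_1 by (meson atLeastAtMost_iff)
          moreover have "dist t t0 < d" using ab that by (auto simp: dist_real_def)
          ultimately show ?thesis using PQ[OF elim d(2)] by (force simp: dist_real_def)
        qed
        have cf: "continuous_on {a..b} (f l)" using f(1) continuous_on_subset by blast
        have "emeasure (\<nu> l) {a<..b} = (\<integral>\<^sup>+x. ennreal (f l x) * indicator {a<..b} x \<partial>lborel)"
          unfolding \<nu>(1) using borel_measurable_continuous_onI[OF f(1)[of l]] by (intro emeasure_density) auto
        also have "\<dots> = (\<integral>\<^sup>+x\<in>{a..b}. ennreal (f l x) \<partial>lborel)"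
          by (rule nn_integral_cong_AE)
             (use AE_lborel_singleton[of a] in \<open>auto elim!: eventually_mono simp: indicator_def\<close>)
        also have "\<dots> = ennreal (integral {a..b} (f l))"
          by (rule nn_integral_continuous_Icc[OF cf f(2)])
        finally have "measure (\<nu> l) {a<..b} = integral {a..b} (f l)"
          using f(2) by (simp add: N.emeasure_eq_measure integral_nonneg integrable_continuous_interval[OF cf])
        then have c: "cdf (\<nu> l) b - cdf (\<nu> l) a = integral {a..b} (f l)"
          using N.cdf_diff_eq[OF ab(1)] by simp
        have "integral {a..b} (\<lambda>t. f l t - w0) = integral {a..b} (f l) - w0 * (b - a)"
          using ab by (subst Henstock_Kurzweil_Integration.integral_diff)
            (auto intro: integrable_continuous_interval[OF cf])
        moreover have "norm (integral {a..b} (\<lambda>t. f l t - w0)) \<le> e / 2 * (b - a)"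
          using ab near by (intro integral_bound) (auto intro!: continuous_intros cf)
        ultimately show ?case unfolding c by simp
      qed
      moreover have "(\<lambda>l. \<bar>(cdf (\<nu> l) b - cdf (\<nu> l) a) - w0 * (b - a)\<bar>) \<longlonglongrightarrow> \<bar>(cdf M b - cdf M a) - w0 * (b - a)\<bar>"
        using weak atoms[OF ab(2)] atoms[OF ab(3)]
        unfolding weak_conv_m_def weak_conv_def
        by (intro tendsto_intros) (auto simp: isCont_cdf)
      ultimately show ?thesis by (intro tendsto_upperbound) auto
    qed
    have "dist ((cdf M y - cdf M t0) / (y - t0)) w0 < e" if y: "y \<in> K" "y \<noteq> t0" "dist y t0 < d" for y
    proof -
      have "\<bar>(cdf M y - cdf M t0) - w0 * (y - t0)\<bar> \<le> e / 2 * \<bar>y - t0\<bar>"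
      proof (cases "y > t0")
        case True
        then show ?thesis using main[of t0 y] y t0 d by (auto simp: dist_real_def)
      next
        case False
        then have "y < t0" using y by simp
        then show ?thesis using main[of y t0] y t0 d by (auto simp: dist_real_def abs_minus_commute algebra_simps abs_le_iff)
      qed
      moreover have "(cdf M y - cdf M t0) / (y - t0) - w0 = ((cdf M y - cdf M t0) - w0 * (y - t0)) / (y - t0)"
        using y by (simp add: field_simps)
      ultimately have "\<bar>(cdf M y - cdf M t0) / (y - t0) - w0\<bar> \<le> e / 2"
        using y by (simp add: abs_divide divide_le_eq)
      then show ?thesis using e by (simp add: dist_real_def)
    qed
    then show "\<forall>\<^sub>F y in at t0 within K. dist ((cdf M y - cdf M t0) / (y - t0)) w0 < e"
      unfolding eventually_at using d(1) by blast
  qed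
  then show ?thesis
    unfolding has_real_derivative_iff_has_vector_derivative[symmetric] has_field_derivative_iff by simp
qed

end

context jacobi
begin

text \<open>Bessel's inequality for the indicator of the point: with c its mass, the coefficients
  are c p k t and the squared norm is c, so the squares of p k t sum to at most 1 / c.\<close>

lemma no_atom:
  assumes M: "\<And>n. orthonormal_upto n M" and ns: "\<not> summable (\<lambda>k. (p k t)\<^sup>2)"
  shows "measure M {t} = 0"
proof (rule ccontr)
  assume a: "measure M {t} \<noteq> 0"
  interpret real_distribution M by (rule orthonormal_real_distribution[OF M])
  define c where "c = measure M {t}"
  have c: "c > 0" using a measure_nonneg[of M "{t}"] unfolding c_def by linarith
  have "(\<Sum>k<n. (p k t)\<^sup>2) \<le> 1 / c" for n
  proof -
    have i: "(\<integral>x. p k x * indicator {t} x \<partial>M) = p k t * c" for k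
    proof -
      have "(\<integral>x. p k x * indicator {t} x \<partial>M) = (\<integral>x. p k t * indicator {t} x \<partial>M)"
        by (intro Bochner_Integration.integral_cong) (auto simp: indicator_def)
      then show ?thesis by (simp add: c_def)
    qed
    have "(\<Sum>k\<le>n. (\<integral>x. p k x * indicator {t} x \<partial>M)\<^sup>2) \<le> (\<integral>x. (indicator {t} x)\<^sup>2 \<partial>M)"
      by (rule bessel_real[OF M, where B = 1]) (auto simp: indicator_def)
    also have "(\<integral>x. (indicator {t} x)\<^sup>2 \<partial>M) = (\<integral>x. (indicator {t} x :: real) \<partial>M)"
      by (intro Bochner_Integration.integral_cong) (auto simp: indicator_def)
    also have "\<dots> = c" by (simp add: c_def)
    finally have "(\<Sum>k\<le>n. (p k t)\<^sup>2) * c\<^sup>2 \<le> c"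
      unfolding i by (simp add: power_mult_distrib sum_distrib_right)
    then have "(\<Sum>k\<le>n. (p k t)\<^sup>2) \<le> 1 / c"
      using c by (simp add: power2_eq_square field_simps)
    moreover have "(\<Sum>k<n. (p k t)\<^sup>2) \<le> (\<Sum>k\<le>n. (p k t)\<^sup>2)" by (intro sum_mono2) auto
    ultimately show ?thesis by simp
  qed
  then have "summable (\<lambda>k. (p k t)\<^sup>2)" by (intro summableI_nonneg_bounded) auto
  with ns show False by simp
qed

end

section \<open>Transfer matrices\<close>

text \<open>Summing the future of u with weights 2^(-m) gives U n = u n + U (Suc n) / 2. Both
  inequalities are immediate from this, and summing it over n gives summability.\<close>

lemma slowly_varying_majorant:
  fixes u :: "nat \<Rightarrow> real"
  assumes u: "\<And>n. 0 \<le> u n" and s: "summable u"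
  obtains U where "\<And>n. u n \<le> U n" "\<And>n. U (Suc n) \<le> 2 * U n" "summable U"
proof -
  define U where "U n = (\<Sum>m. (1 / 2) ^ m * u (n + m))" for n
  have geo: "summable (\<lambda>m. (1 / 2 :: real) ^ m)" by (rule summable_geometric) simp
  obtain B where B: "\<And>n. u n \<le> B"
    using convergent_imp_Bseq[OF summable_LIMSEQ_zero[OF s, THEN convergentI]]
    by (metis BseqE abs_le_D1 real_norm_def)
  have sm: "summable (\<lambda>m. (1 / 2) ^ m * u (n + m))" for n
    by (rule summable_comparison_test'[OF summable_mult2[OF geo, of B]])
       (use u B in \<open>simp add: mult_left_mono\<close>)
  have split: "U n = u n + (1 / 2) * U (Suc n)" for n
  proof -
    have "U n = (1 / 2) ^ 0 * u (n + 0) + (\<Sum>m. (1 / 2) ^ Suc m * u (n + Suc m))"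
      unfolding U_def using suminf_split_head[OF sm[of n]] by simp
    also have "(\<Sum>m. (1 / 2) ^ Suc m * u (n + Suc m)) = (1 / 2) * U (Suc n)"
      unfolding U_def using suminf_mult[OF sm[of "Suc n"], of "1 / 2"] by (simp add: mult.assoc)
    finally show ?thesis by simp
  qed
  have U0: "0 \<le> U n" for n unfolding U_def using u by (intro suminf_nonneg sm) simp
  have "summable U"
  proof (rule summableI_nonneg_bounded[OF U0])
    fix k
    have "(\<Sum>n<k. U n) \<le> (\<Sum>n<k. u n) + (1 / 2) * (\<Sum>n<k. U (Suc n))"
      by (subst split) (simp add: sum.distrib sum_distrib_left)
    also have "(\<Sum>n<k. U (Suc n)) = (\<Sum>n<k. U n) + U k - U 0"
      using sum_lessThan_telescope[of U k] by (simp add: sum_subtractf)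
    finally have "(\<Sum>n<k. U n) \<le> 2 * (\<Sum>n<k. u n) + U k" using U0[of 0] by (simp add: field_simps)
    moreover have "(\<Sum>n<k. u n) \<le> suminf u" using u s by (intro sum_le_suminf) auto
    moreover have "U k \<le> (\<Sum>m. (1 / 2) ^ m * B)"
      unfolding U_def using u B by (intro suminf_le sm summable_mult2 geo mult_left_mono) auto
    ultimately show "(\<Sum>n<k. U n) \<le> 2 * suminf u + (\<Sum>m. (1 / 2) ^ m * B)" by linarith
  qed
  moreover have "u n \<le> U n" for n using split[of n] U0[of "Suc n"] by simp
  moreover have "U (Suc n) \<le> 2 * U n" for n using split[of n] u[of n] by simp
  ultimately show ?thesis using that by blast
qed

lemma fwd_diff_Suc_right: "fwd_diff k (\<lambda>n. x (Suc n) - x n) n = fwd_diff (Suc k) x n"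
  by (induction k arbitrary: n) auto

lemma (in slow_weight) weight_class_of_fwd_diff:
  fixes x :: "nat \<Rightarrow> real \<Rightarrow> 'a::real_normed_vector"
  assumes "\<And>k. k \<le> d \<Longrightarrow> weight_bounded v K (s + k) (fwd_diff k x)"
  shows "weight_class v K s d x"
  using assms
proof (induction d arbitrary: s x)
  case 0
  have "fwd_diff 0 x = x" by (rule ext) simp
  then show ?case using 0[of 0] by simp
next
  case (Suc d)
  have "weight_class v K (Suc s) d (\<lambda>n. x (Suc n) - x n)"
  proof (rule Suc.IH)
    fix k assume "k \<le> d"
    moreover have "fwd_diff k (\<lambda>n. x (Suc n) - x n) = fwd_diff (Suc k) x"
      by (rule ext) (rule fwd_diff_Suc_right)
    ultimately show "weight_bounded v K (Suc s + k) (fwd_diff k (\<lambda>n. x (Suc n) - x n))"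
      using Suc.prems[of "Suc k"] \<open>k \<le> d\<close> by (simp del: fwd_diff.simps)
  qed
  moreover have "(\<lambda>n. x (Suc n) - x n) = (\<lambda>n t. x (Suc n) t - x n t)" by (intro ext) simp
  moreover have "fwd_diff 0 x = x" by (rule ext) simp
  ultimately show ?case using Suc.prems[of 0] by simp
qed

lemma continuous_on_fwd_diff:
  fixes Y :: "nat \<Rightarrow> real \<Rightarrow> real^2^2"
  assumes "\<And>n. continuous_on K (Y n)"
  shows "continuous_on K (fwd_diff k Y n)"
proof (induction k arbitrary: n)
  case 0 then show ?case using assms by simp
next
  case (Suc k)
  have "fwd_diff (Suc k) Y n = (\<lambda>t. fwd_diff k Y (Suc n) t - fwd_diff k Y n t)" by (rule ext) simp
  then show ?case using continuous_on_diff[OF Suc Suc, of "Suc n" n] by simp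
qed

lemma fwd_diff_entry: "fwd_diff k Y n t $ i $ j = fwd_diff k (\<lambda>n t. Y n t $ i $ j) n t"
  for Y :: "nat \<Rightarrow> real \<Rightarrow> real^2^2"
  by (induction k arbitrary: n) auto

lemma entry_le_spectral_norm:
  fixes A :: "real^2^2"
  shows "\<bar>A $ i $ j\<bar> \<le> spectral_norm A"
proof -
  have "\<bar>A $ i $ j\<bar> = \<bar>(A *v axis j 1) $ i\<bar>" by (simp add: matrix_vector_mult_basis column_def)
  also have "\<dots> \<le> norm (A *v axis j 1)" by (rule component_le_norm_cart)
  also have "\<dots> \<le> onorm (\<lambda>v. A *v v) * norm (axis j (1::real) :: real^2)"
    by (rule onorm) (rule matrix_vector_mul_bounded_linear)
  finally show ?thesis by (simp add: spectral_norm_def)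
qed

text \<open>A real supremum dominates its members only if the family is bounded; compactness of K
  bounds the sum of all entries and with it the operator norm.\<close>

lemma entry_le_sup_spectral_norm:
  fixes F :: "real \<Rightarrow> real^2^2"
  assumes K: "compact K" and F: "continuous_on K F" and t: "t \<in> K"
  shows "\<bar>F t $ i $ j\<bar> \<le> sup_spectral_norm K F"
proof -
  have "continuous_on K (\<lambda>t. \<Sum>i\<in>UNIV. \<Sum>j\<in>UNIV. \<bar>F t $ i $ j\<bar>)"
    by (intro continuous_intros F)
  then have "bdd_above ((\<lambda>t. \<Sum>i\<in>UNIV. \<Sum>j\<in>UNIV. \<bar>F t $ i $ j\<bar>) ` K)"
    using K by (intro bounded_imp_bdd_above compact_imp_bounded compact_continuous_image)
  then obtain B where B: "\<And>t. t \<in> K \<Longrightarrow> (\<Sum>i\<in>UNIV. \<Sum>j\<in>UNIV. \<bar>F t $ i $ j\<bar>) \<le> B"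
    by (auto simp: bdd_above_def)
  have "bdd_above ((\<lambda>t. spectral_norm (F t)) ` K)"
  proof (rule bdd_aboveI2)
    fix t assume "t \<in> K"
    then show "spectral_norm (F t) \<le> B"
      unfolding spectral_norm_def using onorm_le_matrix_component_sum[of "F t"] B by fastforce
  qed
  then have "spectral_norm (F t) \<le> sup_spectral_norm K F"
    unfolding sup_spectral_norm_def using t by (intro cSUP_upper)
  then show ?thesis using entry_le_spectral_norm[of "F t" i j] by simp
qed

text \<open>Each difference order k contributes one summable sequence
  \<open>N k n powr (real r / real k)\<close>. The r-th root of a slowly varying majorant of their
  sum is the weight, and taking the power k / r of the majorisation yields
  \<open>N k n \<le> v n ^ k\<close>.\<close>

lemma stolz_GL2_weight:
  fixes Y :: "nat \<Rightarrow> real \<Rightarrow> real^2^2" and K :: "real set"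
  assumes Y: "Y \<in> stolz_GL2 r K" and K: "compact K" "K \<noteq> {}" and r: "r \<ge> 1"
  obtains v where "slow_weight v" "summable (\<lambda>n. v n ^ r)" "\<And>i j. weight_class v K 0 r (\<lambda>n t. Y n t $ i $ j)"
proof -
  have cY: "continuous_on K (Y n)" for n using Y by (simp add: stolz_GL2_def)
  define N where "N k n = sup_spectral_norm K (fwd_diff k Y n)" for k n
  have le: "\<bar>fwd_diff k Y n t $ i $ j\<bar> \<le> N k n" if "t \<in> K" for k n t i j
    unfolding N_def by (rule entry_le_sup_spectral_norm[OF K(1) continuous_on_fwd_diff[OF cY] that])
  have N0: "0 \<le> N k n" for k n
  proof -
    obtain t where "t \<in> K" using K by auto
    from order_trans[OF abs_ge_zero le[OF this]] show ?thesis .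
  qed
  have st: "Y \<in> stolz_class (sup_spectral_norm K) r" using Y by (simp add: stolz_GL2_def)
  have sN: "summable (\<lambda>n. N k n powr (real r / real k))" if "k \<in> {1..r}" for k
    using st that unfolding stolz_class_def N_def by auto
  obtain B where B: "\<And>n. N 0 n \<le> B"
    using st unfolding stolz_class_def N_def bdd_above_def by auto
  define u where "u n = (\<Sum>k\<in>{1..r}. N k n powr (real r / real k))" for n
  have u0: "0 \<le> u n" for n unfolding u_def by (intro sum_nonneg) simp
  have su: "summable u" unfolding u_def using sN by (intro summable_sum) auto
  obtain U where U: "\<And>n. u n \<le> U n" "\<And>n. U (Suc n) \<le> 2 * U n" "summable U"
    using slowly_varying_majorant[OF u0 su] by blast
  have U0: "0 \<le> U n" for n using order_trans[OF u0 U(1)] .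
  define v where "v n = U n powr (1 / real r)" for n
  have rr: "real r > 0" using r by simp
  have vk: "v n ^ k = U n powr (real k / real r)" if "k \<ge> 1" for n k
  proof (cases "U n = 0")
    case False
    then show ?thesis unfolding v_def using U0[of n] by (simp add: powr_powr flip: powr_realpow)
  qed (use that in \<open>simp add: v_def\<close>)
  have vr: "v n ^ r = U n" for n using vk[OF r, of n] U0[of n] rr by simp
  have sw: "slow_weight v"
  proof
    show "0 \<le> v n" for n by (simp add: v_def)
    show "v (Suc n) \<le> 2 * v n" for n
    proof -
      have "v (Suc n) \<le> (2 * U n) powr (1 / real r)"
        unfolding v_def using U U0 by (intro powr_mono2) auto
      also have "\<dots> = 2 powr (1 / real r) * v n" using U0 by (simp add: v_def powr_mult)
      also have "\<dots> \<le> 2 powr 1 * v n"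
        using rr r by (intro mult_right_mono powr_mono) (auto simp: v_def)
      finally show ?thesis by simp
    qed
    have "(\<lambda>n. U n powr (1 / real r)) \<longlonglongrightarrow> 0 powr (1 / real r)"
      using summable_LIMSEQ_zero[OF U(3)] U0 rr by (intro tendsto_powr') (auto intro!: always_eventually)
    then show "v \<longlonglongrightarrow> 0" by (simp add: v_def[abs_def])
  qed
  interpret slow_weight v K by (rule sw)
  have Nv: "N k n \<le> v n ^ k" if k: "k \<in> {1..r}" for k n
  proof -
    have "N k n powr (real r / real k) \<le> u n"
      unfolding u_def using k by (intro member_le_sum) auto
    then have "N k n powr (real r / real k) \<le> U n" using U(1)[of n] by simp
    then have "(N k n powr (real r / real k)) powr (real k / real r) \<le> U n powr (real k / real r)"
      by (intro powr_mono2) auto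
    moreover have "(N k n powr (real r / real k)) powr (real k / real r) = N k n"
      using k rr N0[of k n] by (simp add: powr_powr)
    ultimately show ?thesis using vk[of k n] k by simp
  qed
  have "weight_class v K 0 r (\<lambda>n t. Y n t $ i $ j)" for i j
  proof (rule weight_class_of_fwd_diff)
    fix k assume k: "k \<le> r"
    show "weight_bounded v K (0 + k) (fwd_diff k (\<lambda>n t. Y n t $ i $ j))"
    proof (cases "k = 0")
      case True
      have "norm (Y n t $ i $ j) \<le> B" if "t \<in> K" for n t
        using le[OF that, of 0 n i j] B[of n] by simp
      then show ?thesis unfolding True by (intro weight_boundedI[where C = B]) simp
    next
      case False
      have "norm (fwd_diff k (\<lambda>n t. Y n t $ i $ j) n t) \<le> 1 * v n ^ (0 + k)" if "t \<in> K" for n t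
        using order_trans[OF le[OF that, of k n i j] Nv[of k n]] k False
        by (simp add: fwd_diff_entry)
      then show ?thesis by (intro weight_boundedI[where C = 1]) simp
    qed
  qed
  with that[OF sw] show ?thesis using U(3) vr by simp
qed

text \<open>Dividing P n x - P n x0 by x - x0 lowers the degree and keeps pointwise convergence on
  the remaining infinite set, so an induction on the degree bound applies.\<close>

lemma polynomial_uniform_limit:
  fixes P :: "nat \<Rightarrow> real poly" and S K :: "real set"
  assumes "\<And>n. degree (P n) \<le> d" and "infinite S" and "\<And>x. x \<in> S \<Longrightarrow> convergent (\<lambda>n. poly (P n) x)"
    and K: "bounded K"
  shows "\<exists>l. uniform_limit K (\<lambda>n. poly (P n)) l sequentially \<and> bounded (l ` K)"
  using assms(1-3)
proof (induction d arbitrary: P S)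
  case 0
  obtain x0 where "x0 \<in> S" using 0(2) by (metis finite.emptyI ex_in_conv)
  then obtain c where c: "(\<lambda>n. poly (P n) x0) \<longlonglongrightarrow> c" using 0(3) by (auto simp: convergent_def)
  have "poly (P n) x = poly (P n) x0" for n x
  proof -
    obtain e where "P n = [:e:]" using 0(1)[of n] by (metis degree_eq_zeroE le_zero_eq)
    then show ?thesis by simp
  qed
  then have "poly (P n) = (\<lambda>x. poly (P n) x0)" for n by (intro ext)
  moreover have "uniform_limit K (\<lambda>n x. poly (P n) x0) (\<lambda>x. c) sequentially"
    by (rule uniform_limit_of_real_const[OF c])
  ultimately show ?case by (intro exI[of _ "\<lambda>x. c"]) (auto simp: bounded_iff)
next
  case (Suc d)
  obtain x0 where x0: "x0 \<in> S" using Suc.prems(2) by (metis finite.emptyI ex_in_conv)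
  define Q where "Q n = synthetic_div (P n) x0" for n
  have PQ: "poly (P n) x = (x - x0) * poly (Q n) x + poly (P n) x0" for n x
    using arg_cong[OF synthetic_div_correct'[of x0 "P n"], of "\<lambda>p. poly p x"] by (simp add: Q_def algebra_simps)
  obtain c where c: "(\<lambda>n. poly (P n) x0) \<longlonglongrightarrow> c" using Suc.prems(3)[OF x0] by (auto simp: convergent_def)
  have "\<exists>l. uniform_limit K (\<lambda>n. poly (Q n)) l sequentially \<and> bounded (l ` K)"
  proof (rule Suc.IH)
    show "degree (Q n) \<le> d" for n using Suc.prems(1)[of n] by (simp add: Q_def degree_synthetic_div)
    show "infinite (S - {x0})" using Suc.prems(2) by simp
    fix x assume x: "x \<in> S - {x0}"
    obtain e where e: "(\<lambda>n. poly (P n) x) \<longlonglongrightarrow> e"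
      using Suc.prems(3)[of x] x by (auto simp: convergent_def)
    have "x - x0 \<noteq> 0" using x by simp
    from tendsto_divide[OF tendsto_diff[OF e c] tendsto_const this]
    have "convergent (\<lambda>n. (poly (P n) x - poly (P n) x0) / (x - x0))" by (rule convergentI)
    moreover have "(poly (P n) x - poly (P n) x0) / (x - x0) = poly (Q n) x" for n
      using PQ[of n x] x by (simp add: field_simps)
    ultimately show "convergent (\<lambda>n. poly (Q n) x)" by simp
  qed
  then obtain l where l: "uniform_limit K (\<lambda>n. poly (Q n)) l sequentially" "bounded (l ` K)" by blast
  have bK: "bounded ((\<lambda>x. x - x0) ` K)"
    using K by (rule bounded_translation_minus[of K x0, simplified])
  have "uniform_limit K (\<lambda>n x. (x - x0) * poly (Q n) x + poly (P n) x0) (\<lambda>x. (x - x0) * l x + c) sequentially"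
    by (intro uniform_limit_add uniform_lim_mult uniform_limit_const uniform_limit_of_real_const c l bK)
  moreover have "bounded ((\<lambda>x. (x - x0) * l x + c) ` K)"
  proof -
    obtain B1 B2 where "\<And>x. x \<in> K \<Longrightarrow> \<bar>x - x0\<bar> \<le> B1" "\<And>x. x \<in> K \<Longrightarrow> \<bar>l x\<bar> \<le> B2"
      using bK l(2) by (auto simp: bounded_iff)
    then have "\<bar>(x - x0) * l x + c\<bar> \<le> B1 * B2 + \<bar>c\<bar>" if "x \<in> K" for x
      using that by (intro order_trans[OF abs_triangle_ineq] add_mono)
        (auto simp: abs_mult intro!: mult_mono order_trans[OF abs_ge_zero])
    then show ?thesis unfolding bounded_iff by auto
  qed
  ultimately show ?case unfolding PQ[symmetric] by blast
qed

section \<open>Transfer matrices and the recurrence\<close>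

lemma transfer_matrix_Suc_entries:
  "transfer_matrix a b (Suc N) n x $ 1 $ j = transfer_matrix a b N n x $ 2 $ j"
  "transfer_matrix a b (Suc N) n x $ 2 $ j = - (a (n + N - 1) / a (n + N)) * transfer_matrix a b N n x $ 1 $ j
     + (x - b (n + N)) / a (n + N) * transfer_matrix a b N n x $ 2 $ j"
  by (simp_all add: matrix_matrix_mult_def step_matrix_def sum_2)

lemma transfer_matrix_polynomial:
  "\<exists>p. degree p \<le> N \<and> (\<forall>x. transfer_matrix a b N n x $ i $ j = poly p x)"
proof (induction N arbitrary: i)
  case 0
  show ?case by (rule exI[of _ "[:mat 1 $ i $ j:]"]) simp
next
  case (Suc N)
  obtain p1 p2 where p: "degree p1 \<le> N" "\<And>x. transfer_matrix a b N n x $ 1 $ j = poly p1 x"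
    "degree p2 \<le> N" "\<And>x. transfer_matrix a b N n x $ 2 $ j = poly p2 x"
    using Suc[of 1] Suc[of 2] by blast
  show ?case
  proof (cases "i = 1")
    case True
    then show ?thesis using p by (intro exI[of _ p2]) (simp add: transfer_matrix_Suc_entries del: transfer_matrix.simps)
  next
    case False
    then have i: "i = 2" using exhaust_2 by auto
    define q where "q = smult (- (a (n + N - 1) / a (n + N))) p1 + smult (1 / a (n + N)) ([:- b (n + N), 1:] * p2)"
    have "degree ([:- b (n + N), 1:] * p2) \<le> Suc N"
      using degree_mult_le[of "[:- b (n + N), 1:]" p2] p(3) by simp
    then have "degree q \<le> Suc N" unfolding q_def using p(1)
      by (intro degree_add_le) (auto intro: order_trans[OF degree_smult_le])
    moreover have "transfer_matrix a b (Suc N) n x $ 2 $ j = poly q x" for x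
      unfolding transfer_matrix_Suc_entries(2) p q_def by (simp add: algebra_simps diff_divide_distrib)
    ultimately show ?thesis using i by blast
  qed
qed

context jacobi
begin

lemma transfer_matrix_shift:
  assumes n: "n \<ge> 1"
  shows "transfer_matrix a b N n x $ 1 $ 1 * p (n - 1) x + transfer_matrix a b N n x $ 1 $ 2 * p n x = p (n + N - 1) x"
    and "transfer_matrix a b N n x $ 2 $ 1 * p (n - 1) x + transfer_matrix a b N n x $ 2 $ 2 * p n x = p (n + N) x"
proof (induction N)
  case 0
  { case 1 show ?case by (simp add: mat_def) next case 2 show ?case by (simp add: mat_def) }
next
  case (Suc N)
  have m: "n + N = Suc (n + N - 1)" using n by simp
  have "a (n + N) * p (Suc (n + N)) x = (x - b (n + N)) * p (n + N) x - a (n + N - 1) * p (n + N - 1) x"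
    using p_rec[of x "n + N"] m am_simps(2)[of "n + N - 1"] by (simp add: algebra_simps)
  then have rec: "p (Suc (n + N)) x = - (a (n + N - 1) / a (n + N)) * p (n + N - 1) x + (x - b (n + N)) / a (n + N) * p (n + N) x"
    using a_pos[of "n + N"] by (simp add: eq_divide_eq mult.commute diff_divide_distrib[symmetric])
  { case 1 show ?case using Suc.IH(2) unfolding transfer_matrix_Suc_entries by simp
  next
    case 2
    have "transfer_matrix a b (Suc N) n x $ 2 $ 1 * p (n - 1) x + transfer_matrix a b (Suc N) n x $ 2 $ 2 * p n x
      = - (a (n + N - 1) / a (n + N)) * (transfer_matrix a b N n x $ 1 $ 1 * p (n - 1) x + transfer_matrix a b N n x $ 1 $ 2 * p n x)
       + (x - b (n + N)) / a (n + N) * (transfer_matrix a b N n x $ 2 $ 1 * p (n - 1) x + transfer_matrix a b N n x $ 2 $ 2 * p n x)"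
      unfolding transfer_matrix_Suc_entries by (simp only: algebra_simps)
    then show ?case unfolding Suc.IH by (simp only: add_Suc_right rec) }
qed

lemma transfer_matrix_det:
  assumes n: "n \<ge> 1"
  shows "det (transfer_matrix a b N n x) = a (n - 1) / a (n + N - 1)"
proof (induction N)
  case 0 then show ?case by simp
next
  case (Suc N)
  have "det (step_matrix a b (n + N) x) = a (n + N - 1) / a (n + N)"
    by (simp add: det_2 step_matrix_def)
  then show ?case using Suc a_pos[of "n + N - 1"] by (simp add: det_mul)
qed

end

section \<open>The Christoffel function asymptotics\<close>

text \<open>In the extended reals the supremum is meaningful for each n without a bound on
  \<open>E n\<close>.\<close>

lemma SUP_ereal_abs_tendsto_0:
  fixes E :: "nat \<Rightarrow> 'a \<Rightarrow> real"
  assumes "K \<noteq> {}" and E: "uniform_limit K E (\<lambda>x. 0) sequentially"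
  shows "(\<lambda>n. SUP x\<in>K. ereal \<bar>E n x\<bar>) \<longlonglongrightarrow> 0"
proof (rule order_tendstoI)
  obtain x0 where x0: "x0 \<in> K" using assms(1) by blast
  fix a :: ereal assume a: "a < 0"
  have "a < (SUP x\<in>K. ereal \<bar>E n x\<bar>)" for n
    by (rule less_le_trans[OF a SUP_upper2[OF x0]]) simp
  then show "\<forall>\<^sub>F n in sequentially. a < (SUP x\<in>K. ereal \<bar>E n x\<bar>)" by simp
next
  fix a :: ereal assume "0 < a"
  then obtain e where e: "0 < ereal e" "ereal e < a" using ereal_dense2 by blast
  then have "\<forall>\<^sub>F n in sequentially. \<forall>x\<in>K. dist (E n x) 0 < e"
    by (intro uniform_limitD[OF E]) simp
  then show "\<forall>\<^sub>F n in sequentially. (SUP x\<in>K. ereal \<bar>E n x\<bar>) < a"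
  proof eventually_elim
    case (elim n)
    then have "(SUP x\<in>K. ereal \<bar>E n x\<bar>) \<le> ereal e" by (intro SUP_least) (simp add: less_imp_le)
    then show ?case using e(2) by simp
  qed
qed

lemma discr_entries: "discr Y = (Y $ 2 $ 2 - Y $ 1 $ 1)\<^sup>2 + 4 * (Y $ 1 $ 2) * (Y $ 2 $ 1)"
  by (simp add: discr_def trace_def det_2 sum_2 power2_eq_square algebra_simps)

lemma compact_interval_nonempty_interior:
  fixes K :: "real set"
  assumes "compact K" "is_interval K" "interior K \<noteq> {}"
  obtains k1 k2 where "K = {k1..k2}" "k1 < k2"
proof -
  obtain k1 k2 where K: "K = {k1..k2}" using assms(1,2) is_interval_compact[of K] by auto
  moreover have "k1 < k2" using assms(3) unfolding K by (simp add: interior_atLeastAtMost_real)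
  ultimately show ?thesis using that by blast
qed

lemma (in jacobi) transfer_entry_uniform_limit:
  fixes m :: "nat \<Rightarrow> nat"
  assumes K: "infinite K" "bounded K"
    and lim: "\<And>x. x \<in> K \<Longrightarrow> (\<lambda>n. transfer_matrix a b N (m n) x) \<longlonglongrightarrow> \<X> x"
  shows "uniform_limit K (\<lambda>n t. transfer_matrix a b N (m n) t $ i $ j) (\<lambda>t. \<X> t $ i $ j) sequentially"
proof -
  have "\<forall>n. \<exists>q. degree q \<le> N \<and> (\<forall>x. transfer_matrix a b N (m n) x $ i $ j = poly q x)"
    using transfer_matrix_polynomial by blast
  then obtain Q where Q: "\<And>n. degree (Q n) \<le> N"
    "\<And>n x. transfer_matrix a b N (m n) x $ i $ j = poly (Q n) x" by metis
  have pw: "(\<lambda>n. poly (Q n) x) \<longlonglongrightarrow> \<X> x $ i $ j" if "x \<in> K" for x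
    unfolding Q(2)[symmetric] by (intro tendsto_intros lim that)
  obtain l where l: "uniform_limit K (\<lambda>n. poly (Q n)) l sequentially"
    using polynomial_uniform_limit[OF Q(1) K(1) convergentI[OF pw] K(2)] by blast
  have "l x = \<X> x $ i $ j" if "x \<in> K" for x
    using tendsto_uniform_limitI[OF l that] pw[OF that] by (rule LIMSEQ_unique)
  then have "uniform_limit K (\<lambda>n. poly (Q n)) (\<lambda>t. \<X> t $ i $ j) sequentially"
    using l by (simp cong: uniform_limit_cong')
  then show ?thesis by (simp add: Q)
qed

lemma compact_positive_lower_bound:
  fixes f :: "real \<Rightarrow> real"
  assumes "compact K" "continuous_on K f" "\<And>t. t \<in> K \<Longrightarrow> 0 < f t"
  obtains c where "c > 0" "\<And>t. t \<in> K \<Longrightarrow> c \<le> f t"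
proof (cases "K = {}")
  case True then show ?thesis using that[of 1] by simp
next
  case False
  from continuous_attains_inf[OF assms(1) False assms(2)] obtain s where
    "s \<in> K" "\<forall>t\<in>K. f s \<le> f t" by blast
  then show ?thesis using that[of "f s"] assms(3) by blast
qed

lemma uniform_limit_eventually_ge:
  fixes f :: "nat \<Rightarrow> real \<Rightarrow> real"
  assumes "uniform_limit K f l sequentially" "c > 0" "\<And>t. t \<in> K \<Longrightarrow> 2 * c \<le> l t"
  shows "\<forall>\<^sub>F n in sequentially. \<forall>t\<in>K. c \<le> f n t"
  using uniform_limitD[OF assms(1,2)]
proof eventually_elim
  case (elim n)
  show ?case
  proof
    fix t assume "t \<in> K"
    then have "\<bar>f n t - l t\<bar> < c" "2 * c \<le> l t" using elim assms(3) by (auto simp: dist_real_def)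
    then show "c \<le> f n t" by linarith
  qed
qed

theorem theorem1p1:
  fixes a b :: "nat \<Rightarrow> real" and \<mu> :: "real measure"
    and N r i :: nat and K \<Lambda> :: "real set"
    and \<X> :: "real \<Rightarrow> real^2^2"
  assumes "\<And>n. a n > 0"
    and "orthonormality_measure a b \<mu>"
    and "N \<ge> 1" and "r \<ge> 1" and "i < N"
    and "\<Lambda> = {x. \<exists>l. (\<lambda>j. discr (transfer_matrix a b N (j * N + i) x)) \<longlonglongrightarrow> l \<and> l < 0}"
    and "compact K" and "is_interval K" and "interior K \<noteq> {}" and "K \<subseteq> \<Lambda>"
    and "(\<lambda>j. a ((j + 1) * N + i - 1) / a (j * N + i - 1)) \<longlonglongrightarrow> 1"
    and "(\<lambda>j. transfer_matrix a b N (Suc j * N + i)) \<in> stolz_GL2 r K"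
    and "\<And>x. x \<in> K \<Longrightarrow> (\<lambda>j. transfer_matrix a b N (j * N + i) x) \<longlonglongrightarrow> \<X> x"
    and "filterlim (\<lambda>n. \<Sum>j=1..n. 1 / a (j * N + i - 1)) at_top sequentially"
  shows "\<exists>E :: nat \<Rightarrow> real \<Rightarrow> real.
    (\<forall>n\<ge>1. \<forall>x\<in>K.
       inverse (\<Sum>j=1..n. 1 / a (j * N + i - 1)) *
         (\<Sum>j=0..n. (poly (orth_poly a b (j * N + i)) x)\<^sup>2)
       = \<bar>\<X> x $ 2 $ 1\<bar> / (pi * continuous_density_on \<mu> K x * sqrt (- discr (\<X> x))) + E n x) \<and>
    (\<lambda>n. SUP x\<in>K. ereal \<bar>E n x\<bar>) \<longlonglongrightarrow> 0"
proof -
  obtain k1 k2 where K: "K = {k1..k2}" and k12: "k1 < k2"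
    using compact_interval_nonempty_interior[OF assms(7-9)] .
  have Kne: "K \<noteq> {}" and Kinf: "infinite K" and Kb: "bounded K"
    using k12 unfolding K by (auto simp: infinite_Icc)
  interpret jacobi a b by standard (rule assms(1))
  have orth: "orthonormal_upto n \<mu>" for n
    using assms(2) unfolding orthonormality_measure_def orthonormal_upto_def by blast
  interpret \<mu>: real_distribution \<mu> by (rule orthonormal_real_distribution[OF orth])
  \<comment> \<open>Starting at j = 1 keeps the index m n - 1 genuine: j = 0 and i = 0 would lead to
    -1. The term j = 0 of the sum of squares is treated separately at the end.\<close>
  define m where "m n = Suc n * N + i" for n
  have m1: "m n \<ge> 1" for n using assms(3) by (simp add: m_def)
  have mS: "m (Suc n) = m n + N" for n by (simp add: m_def)
  have m_inj: "inj m" using assms(3) by (auto simp: inj_on_def m_def)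
  have m_inj': "inj (\<lambda>n. m n - 1)"
    using m_inj m1 unfolding inj_on_def by (metis diff_add_inverse2 le_add_diff_inverse2)
  define M where "M n = transfer_matrix a b N (m n)" for n
  define al where "al n = a (m n - 1)" for n
  define pp where "pp n t = p (m n) t" for n t
  define qq where "qq n t = p (m n - 1) t" for n t
  have al_pos: "al n > 0" for n by (simp add: al_def a_pos)
  have lim: "(\<lambda>n. M n x) \<longlonglongrightarrow> \<X> x" if "x \<in> K" for x
    using LIMSEQ_Suc[OF assms(13)[OF that]] by (simp only: M_def m_def)
  have ul: "uniform_limit K (\<lambda>n t. M n t $ i' $ j') (\<lambda>t. \<X> t $ i' $ j') sequentially" for i' j'
    unfolding M_def by (rule transfer_entry_uniform_limit[OF Kinf Kb]) (use lim M_def in simp)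
  have stolz: "M \<in> stolz_GL2 r K" using assms(12) by (simp only: M_def[abs_def] m_def)
  then have cM: "continuous_on K (M n)" for n by (simp add: stolz_GL2_def)
  have cMe: "continuous_on K (\<lambda>t. M n t $ i' $ j')" for n i' j' by (intro continuous_intros cM)
  have c\<X>: "continuous_on K (\<lambda>t. \<X> t $ i' $ j')" for i' j'
    by (rule uniform_limit_theorem[OF _ ul]) (auto simp: cMe)
  have neg: "discr (\<X> x) < 0" if x: "x \<in> K" for x
  proof -
    obtain l where l: "(\<lambda>j. discr (transfer_matrix a b N (j * N + i) x)) \<longlonglongrightarrow> l" "l < 0"
      using assms(6,10) x by blast
    have "(\<lambda>j. discr (transfer_matrix a b N (j * N + i) x)) \<longlonglongrightarrow> discr (\<X> x)"
      unfolding discr_entries by (intro tendsto_intros assms(13)[OF x])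
    then show ?thesis using l LIMSEQ_unique by blast
  qed
  \<comment> \<open>With a vanishing off-diagonal entry the discriminant would be a square and hence
    non-negative.\<close>
  have nz12: "\<X> x $ 1 $ 2 \<noteq> 0" if "x \<in> K" for x
    using neg[OF that] unfolding discr_entries by auto
  obtain c1 where c1: "c1 > 0" "\<And>t. t \<in> K \<Longrightarrow> c1 \<le> - discr (\<X> t)"
  proof (rule compact_positive_lower_bound[OF assms(7), of "\<lambda>t. - discr (\<X> t)"])
    show "continuous_on K (\<lambda>t. - discr (\<X> t))"
      unfolding discr_entries by (intro continuous_intros c\<X>)
  qed (use neg in auto)
  obtain c2 where c2: "c2 > 0" "\<And>t. t \<in> K \<Longrightarrow> c2 \<le> \<bar>\<X> t $ 1 $ 2\<bar>"
  proof (rule compact_positive_lower_bound[OF assms(7), of "\<lambda>t. \<bar>\<X> t $ 1 $ 2\<bar>"])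
    show "continuous_on K (\<lambda>t. \<bar>\<X> t $ 1 $ 2\<bar>)" by (intro continuous_intros c\<X>)
  qed (use nz12 in auto)
  \<comment> \<open>The limits stay above 2 c, which leaves room for the eventual bounds by
    c.\<close>
  define c where "c = min c1 c2 / 2"
  have c: "c > 0" using c1 c2 by (simp add: c_def)
  obtain v where v: "slow_weight v" "summable (\<lambda>n. v n ^ r)" "\<And>i' j'. weight_class v K 0 r (\<lambda>n t. M n t $ i' $ j')"
    using stolz_GL2_weight[OF stolz assms(7) Kne assms(4)] by blast
  have div: "filterlim (\<lambda>n. \<Sum>j<n. 1 / al j) at_top sequentially"
    using assms(14) by (simp add: sum.atLeast1_atMost_eq al_def m_def)
  interpret E: elliptic_recurrence v K r "\<lambda>n t. M n t $ 1 $ 1" "\<lambda>n t. M n t $ 1 $ 2" "\<lambda>n t. M n t $ 2 $ 1"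
    "\<lambda>n t. M n t $ 2 $ 2" c "\<lambda>t. \<X> t $ 1 $ 1" "\<lambda>t. \<X> t $ 1 $ 2" "\<lambda>t. \<X> t $ 2 $ 1" "\<lambda>t. \<X> t $ 2 $ 2" al pp qq
  proof (unfold_locales)
    show "\<forall>\<^sub>F n in sequentially. \<forall>t\<in>K. c \<le> \<bar>M n t $ 1 $ 2\<bar>"
      using uniform_limit_norm[OF ul[of 1 2]] c c2 by (intro uniform_limit_eventually_ge) (auto simp: c_def intro: order_trans[OF min.cobounded2])
    have "uniform_limit K (\<lambda>n t. (\<lambda>(x::real,y,z,w). - ((w - x)\<^sup>2 + 4 * y * z)) (M n t $ 1 $ 1, M n t $ 1 $ 2, M n t $ 2 $ 1, M n t $ 2 $ 2))
      (\<lambda>t. (\<lambda>(x::real,y,z,w). - ((w - x)\<^sup>2 + 4 * y * z)) (\<X> t $ 1 $ 1, \<X> t $ 1 $ 2, \<X> t $ 2 $ 1, \<X> t $ 2 $ 2)) sequentially"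
      by (rule uniform_limit_continuous_compose[OF assms(7), where U = UNIV])
         (auto intro!: continuous_intros c\<X> uniform_limit_Pair ul simp: split_beta)
    then have "uniform_limit K (\<lambda>n t. - ((M n t $ 2 $ 2 - M n t $ 1 $ 1)\<^sup>2 + 4 * M n t $ 1 $ 2 * M n t $ 2 $ 1)) (\<lambda>t. - discr (\<X> t)) sequentially"
      by (simp add: discr_entries)
    then show "\<forall>\<^sub>F n in sequentially. \<forall>t\<in>K. c \<le> - ((M n t $ 2 $ 2 - M n t $ 1 $ 1)\<^sup>2 + 4 * M n t $ 1 $ 2 * M n t $ 2 $ 1)"
      by (rule uniform_limit_eventually_ge[OF _ c]) (use c1 in \<open>auto simp: c_def intro: order_trans[OF min.cobounded1]\<close>)
    have "(\<lambda>n. a ((Suc n + 1) * N + i - 1) / a (Suc n * N + i - 1)) \<longlonglongrightarrow> 1"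
      using LIMSEQ_Suc[OF assms(11)] .
    then show "(\<lambda>n. al (Suc n) / al n) \<longlonglongrightarrow> 1" by (simp add: al_def m_def)
    show "M n t $ 1 $ 1 * M n t $ 2 $ 2 - M n t $ 1 $ 2 * M n t $ 2 $ 1 = al n / al (Suc n)" for n t
      using transfer_matrix_det[OF m1[of n], of N t] by (simp add: M_def det_2 al_def mS)
    show "qq (Suc n) t = M n t $ 1 $ 1 * qq n t + M n t $ 1 $ 2 * pp n t" for n t
      using transfer_matrix_shift(1)[OF m1[of n], of N t] by (simp add: M_def pp_def qq_def mS)
    show "pp (Suc n) t = M n t $ 2 $ 1 * qq n t + M n t $ 2 $ 2 * pp n t" for n t
      using transfer_matrix_shift(2)[OF m1[of n], of N t] by (simp add: M_def pp_def qq_def mS)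
    show "pp n t \<noteq> 0 \<or> qq n t \<noteq> 0" for n t
      using P_not_both_zero[of "m n - 1" "of_real t"] m1[of n] by (auto simp: pp_def qq_def orth_poly_complex_of_real)
    show "continuous_on K (pp n)" "continuous_on K (qq n)" for n
      unfolding pp_def[abs_def] qq_def[abs_def] by (intro continuous_intros)+
  qed (use slow_weight.v_nonneg[OF v(1)] slow_weight.v_Suc[OF v(1)] slow_weight.v_lim[OF v(1)]
      v(2,3) c assms(4,7) ul cMe al_pos div in auto)
  obtain z g bb Y L where zlim: "uniform_limit K z E.zl sequentially"
    and g: "continuous_on K g" and gp: "\<And>t. t \<in> K \<Longrightarrow> g t > 0" and Glim: "uniform_limit K (E.G z) g sequentially"
    and bb: "bb > 0" and rest: "\<forall>\<^sub>F n in sequentially. \<forall>t\<in>K. bb \<le> \<bar>Im (z n t)\<bar>"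
    "\<forall>\<^sub>F n in sequentially. \<forall>t\<in>K. norm (z n t) \<le> Y"
    "\<forall>\<^sub>F n in sequentially. \<forall>t\<in>K. norm (E.lam z n t) \<le> L"
    "uniform_limit K (E.residual z) (\<lambda>t. 0) sequentially"
    using E.amplitude_limit by blast
  have avg: "uniform_limit K (\<lambda>n t. inverse (\<Sum>j<n. 1 / al j) * (\<Sum>j<n. (pp j t)\<^sup>2))
      (\<lambda>t. g t * \<bar>\<X> t $ 2 $ 1\<bar> / sqrt (E.Dl t)) sequentially"
    by (rule E.averaged_squares[OF zlim g Glim bb rest])
  have Dl: "E.Dl t = - discr (\<X> t)" for t by (simp add: E.Dl_def discr_entries)
  \<comment> \<open>The indices m n - 1 are distinct, so the divergent series along them is a
    subseries of the positive series of 1 / a n.\<close>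
  have ndiv: "\<not> summable (\<lambda>n. 1 / a n)"
  proof
    assume "summable (\<lambda>n. 1 / a n)"
    then have "summable ((\<lambda>n. 1 / a n) \<circ> (\<lambda>n. m n - 1))"
      by (rule summable_reindex[OF _ m_inj']) (simp add: a_pos less_imp_le)
    then have "summable (\<lambda>n. 1 / al n)" by (simp add: o_def al_def)
    then have "(\<lambda>n. \<Sum>j<n. 1 / al j) \<longlonglongrightarrow> (\<Sum>j. 1 / al j)" by (rule summable_LIMSEQ)
    then show False using div not_tendsto_and_filterlim_at_infinity[of sequentially]
      filterlim_at_top_imp_at_infinity by (metis trivial_limit_sequentially)
  qed
  have atoms: "measure \<mu> {t} = 0" if t: "t \<in> K" for t
  proof (rule no_atom[OF orth])
    show "\<not> summable (\<lambda>k. (p k t)\<^sup>2)"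
    proof
      assume s: "summable (\<lambda>k. (p k t)\<^sup>2)"
      have "summable ((\<lambda>k. (p k t)\<^sup>2) \<circ> m)" "summable ((\<lambda>k. (p k t)\<^sup>2) \<circ> (\<lambda>n. m n - 1))"
        by (rule summable_reindex[OF s], use m_inj m_inj' in auto)+
      then have "summable (\<lambda>n. (pp n t)\<^sup>2 + (qq n t)\<^sup>2)"
        unfolding o_def pp_def qq_def by (rule summable_add)
      then show False using E.not_square_summable[OF zlim Glim gp[OF t] t] by simp
    qed
  qed
  define w where "w t = 1 / (pi * g t)" for t
  have deriv: "(cdf \<mu> has_vector_derivative w t0) (at t0 within K)" if t0: "t0 \<in> K" for t0
  proof -
    \<comment> \<open>The sign of Im zl follows the entry (1,2), but a Bernstein-Szego parameter
      must lie in the upper half plane. Conjugation does not change |p - z q|, since p and q are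
      real.\<close>
    define z0 where "z0 = (if Im (E.zl t0) > 0 then E.zl t0 else cnj (E.zl t0))"
    have Imz0: "Im z0 = \<bar>Im (E.zl t0)\<bar>" "Im z0 > 0"
      using E.zl_facts(2)[OF t0] by (auto simp: z0_def)
    \<comment> \<open>\<open>Suc l\<close> ensures s l \<ge> 1, which the second moment requires;
      \<open>m 0 - 1\<close> is 0 when N = 1 and i = 0.\<close>
    define s where "s l = m (Suc l) - 1" for l
    \<comment> \<open>The factor al turns the denominator a p (m) - al z0 p (m - 1) into al (p - z0
      q), since al is the parameter a at m - 1. The density becomes Im z0 / (pi al |p - z0 q|^2),
      the expression of \<open>amplitude_joint_limit\<close>.\<close>
    define \<nu> where "\<nu> l = bernstein_szego.bs_measure a b (s l) (of_real (al (Suc l)) * z0)" for l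
    define f where "f l = bernstein_szego.dens a b (s l) (of_real (al (Suc l)) * z0)" for l
    have BS: "bernstein_szego a (of_real (al (Suc l)) * z0)" for l
      by unfold_locales (use Imz0 al_pos in simp)
    have ss: "Suc (s l) = m (Suc l)" for l using m1[of "Suc l"] by (simp add: s_def)
    have f_eq: "f l t = \<bar>Im (E.zl t0)\<bar> / (pi * (al (Suc l) * (norm (pp (Suc l) t - E.zl t0 * qq (Suc l) t))\<^sup>2))" for l t
    proof -
      have "norm (complex_of_real x - z0 * y) = norm (complex_of_real x - E.zl t0 * y)" for x y :: real
      proof (cases "Im (E.zl t0) > 0")
        case False
        have "complex_of_real x - cnj (E.zl t0) * y = cnj (complex_of_real x - E.zl t0 * y)" by simp
        then show ?thesis using False by (simp only: z0_def if_False complex_mod_cnj)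
      qed (simp add: z0_def)
      moreover have "of_real (a (s l)) * of_real (p (Suc (s l)) t) - (of_real (al (Suc l)) * z0) * of_real (p (s l) t)
         = of_real (al (Suc l)) * (complex_of_real (pp (Suc l) t) - z0 * qq (Suc l) t)"
        by (simp add: al_def pp_def qq_def ss, simp add: s_def algebra_simps)
      ultimately have "norm (of_real (a (s l)) * of_real (p (Suc (s l)) t) - (of_real (al (Suc l)) * z0) * of_real (p (s l) t))
         = al (Suc l) * norm (complex_of_real (pp (Suc l) t) - E.zl t0 * qq (Suc l) t)"
        using al_pos[of "Suc l"] by (simp add: norm_mult)
      then show ?thesis unfolding f_def bernstein_szego.dens_def[OF BS]
        using Imz0(1) al_pos[of "Suc l"] by (simp add: power2_eq_square)
    qed
    have orth\<nu>: "orthonormal_upto (s l) (\<nu> l)" for l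
      unfolding \<nu>_def by (rule bernstein_szego.bs_measure_orthonormal[OF BS])
    have sl: "s l \<ge> Suc l" for l
    proof -
      have "Suc (Suc l) * 1 \<le> Suc (Suc l) * N" using assms(3) by (intro mult_le_mono2)
      then show ?thesis by (simp add: s_def m_def)
    qed
    have s_lim: "filterlim s at_top sequentially"
      by (rule filterlim_at_top_mono[OF filterlim_ident]) (use Suc_leD[OF sl] in \<open>auto intro!: always_eventually\<close>)
    have s1: "1 \<le> s l" for l using sl[of l] by simp
    have weak: "weak_conv_m \<nu> \<mu>"
      by (rule orthonormal_weak_convergence[OF orth orth\<nu> s_lim s1 ndiv])
    show ?thesis
    proof (rule \<mu>.cdf_derivative_of_weak_limit[OF weak, where f = f])
      show "\<nu> l = density lborel (\<lambda>x. ennreal (f l x))" for l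
        unfolding \<nu>_def f_def by (rule bernstein_szego.bs_measure_def[OF BS])
      show "real_distribution (\<nu> l)" for l by (rule orthonormal_real_distribution[OF orth\<nu>])
      show "continuous_on UNIV (f l)" for l
        unfolding f_def by (rule bernstein_szego.continuous_dens[OF BS])
      show "0 \<le> f l x" for l x
        unfolding f_def using bernstein_szego.dens_pos[OF BS] by (simp add: less_imp_le)
      let ?F = "sequentially \<times>\<^sub>F inf (nhds t0) (principal K)"
      \<comment> \<open>The measures use the polynomials with index \<open>Suc l\<close>; the joint
        limit is unaffected by this shift of the index.\<close>
      have sh: "filterlim (\<lambda>x. (Suc (fst x), snd x)) ?F ?F"
        by (intro filterlim_Pair filterlim_compose[OF filterlim_Suc filterlim_fst] filterlim_snd)
      show "((\<lambda>x. f (fst x) (snd x)) \<longlongrightarrow> w t0) ?F"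
        using filterlim_compose[OF E.amplitude_joint_limit[OF zlim g Glim gp[OF t0] t0] sh]
        by (simp add: f_eq w_def)
    qed (use atoms assms(8) t0 in auto)
  qed
  have wc: "continuous_on K w"
    unfolding w_def using gp by (intro continuous_intros g) (auto simp: less_imp_neq[symmetric])
  have wp: "0 < w t" if "t \<in> K" for t using gp[OF that] by (simp add: w_def)
  have dens: "is_continuous_density_on \<mu> K w"
    unfolding K by (rule \<mu>.density_of_cdf_derivative[OF k12])
      (use wc wp deriv atoms k12 in \<open>auto simp: K\<close>)
  \<comment> \<open>w is a witness, so the choice yields some continuous density, and uniqueness
    gives it the values of w on K.\<close>
  have "is_continuous_density_on \<mu> K (continuous_density_on \<mu> K)"
    unfolding continuous_density_on_def
    using someI[of "is_continuous_density_on \<mu> K", OF dens] by simp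
  then have cd: "continuous_density_on \<mu> K t = w t" if "t \<in> K" for t
    using \<mu>.density_unique[OF k12 _ _ that[unfolded K]] dens unfolding K by blast
  define R where "R x = \<bar>\<X> x $ 2 $ 1\<bar> / (pi * continuous_density_on \<mu> K x * sqrt (- discr (\<X> x)))" for x
  have R: "R t = g t * \<bar>\<X> t $ 2 $ 1\<bar> / sqrt (E.Dl t)" if "t \<in> K" for t
    unfolding R_def cd[OF that] w_def Dl by simp
  define T where "T n x = inverse (\<Sum>j=1..n. 1 / a (j * N + i - 1)) *
         (\<Sum>j=0..n. (poly (orth_poly a b (j * N + i)) x)\<^sup>2)" for n x
  \<comment> \<open>The term j = 0 is a function bounded on K, multiplied by the inverse of a
    diverging sum, and disappears in the limit.\<close>
  have T: "T n x = inverse (\<Sum>j<n. 1 / al j) * (p i x)\<^sup>2 + inverse (\<Sum>j<n. 1 / al j) * (\<Sum>j<n. (pp j x)\<^sup>2)" for n x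
  proof -
    have "(\<Sum>j=0..n. (p (j * N + i) x)\<^sup>2) = (p i x)\<^sup>2 + (\<Sum>j<n. (pp j x)\<^sup>2)"
      by (simp add: sum.atLeast_Suc_atMost[of 0 n] sum.atLeast1_atMost_eq pp_def m_def)
    moreover have "(\<Sum>j=1..n. 1 / a (j * N + i - 1)) = (\<Sum>j<n. 1 / al j)"
      by (simp add: sum.atLeast1_atMost_eq al_def m_def)
    ultimately show ?thesis unfolding T_def by (simp add: distrib_left)
  qed
  have "uniform_limit K T R sequentially"
  proof -
    have "(\<lambda>n. inverse (\<Sum>j<n. 1 / al j)) \<longlonglongrightarrow> 0"
      using div by (rule tendsto_inverse_0_at_top)
    moreover have "bounded ((\<lambda>x. (p i x)\<^sup>2) ` K)"
      using assms(7) by (intro compact_imp_bounded compact_continuous_image continuous_intros)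
    ultimately have "uniform_limit K (\<lambda>n x. inverse (\<Sum>j<n. 1 / al j) * (p i x)\<^sup>2) (\<lambda>x. 0 * (p i x)\<^sup>2) sequentially"
      by (intro uniform_lim_mult uniform_limit_of_real_const uniform_limit_const) (auto simp: bounded_iff)
    from uniform_limit_add[OF this avg] have "uniform_limit K T (\<lambda>t. g t * \<bar>\<X> t $ 2 $ 1\<bar> / sqrt (E.Dl t)) sequentially"
      by (simp add: T[abs_def])
    then show ?thesis using R by (simp cong: uniform_limit_cong')
  qed
  from uniform_limit_minus[OF this uniform_limit_const[where c = R and S = K]]
  have "uniform_limit K (\<lambda>n x. T n x - R x) (\<lambda>x. 0) sequentially" by simp
  from SUP_ereal_abs_tendsto_0[OF Kne this] show ?thesis
    by (intro exI[of _ "\<lambda>n x. T n x - R x"] conjI) (simp_all add: T_def R_def)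
qed

end
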